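(* Let $W\times T\subset\mathbb{R}^2\times\mathbb{R}$ be a bounded non-empty open set, let $\boldsymbol\theta_0\in\boldsymbol\Theta$ be the true parameter value, and assume: (i) $\{Y_i\}_{i\ge1}$ and $\{E_i\}_{i\ge1}$ are two independent sequences of independent and identically distributed point processes on $W\times T$, defined on the same underlying probability space; $X_n=\bigcup_{i=1}^nY_i$ and $D_n=\bigcup_{i=1}^nE_i$. (ii) Each $Y_i$ is a point process (not necessarily Poisson) with intensity function $\lambda(u;\boldsymbol\theta)=b(u)\exp(\boldsymbol\theta^\top\boldsymbol z(u))$, where $b:W\times T\to(0,\infty)$ is absolutely integrable, $\boldsymbol z=[z^{(1)},\dots,z^{(m)}]^\top:W\times T\to\mathbb{R}^m$ is measurable, and $\boldsymbol\theta$ lies in an open set $\boldsymbol\Theta\subset\mathbb{R}^m$; each $E_i$ has an absolutely integrable intensity function $\rho(u)>0$. (iii) $E_i$ and $Y_i$ have bounded pair correlation functions $g$ and $h$, respectively: $\sup_{(u,v)\in(W\times T)^2}g(u,v)<\infty$ and $\sup_{(u,v)\in(W\times T)^2}h(u,v)<\infty$. (iv) For every $\boldsymbol\theta\in\boldsymbol\Theta$ there exist $\epsilon_1(\boldsymbol\theta),\epsilon_2(\boldsymbol\theta)>0$ with $\epsilon_1(\boldsymbol\theta)<\inf_{u}\rho(u)/\lambda(u;\boldsymbol\theta)$ and $\sup_{u}\rho(u)/\lambda(u;\boldsymbol\theta)<\epsilon_2(\boldsymbol\theta)$, where $u$ ranges over $W\times T$. (v) $\sup_{u\in W\times T}\|\boldsymbol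 z(u)\|<\infty$. (vi) $\boldsymbol\Theta$ is convex. (vii) For $\boldsymbol\theta,\tilde{\boldsymbol\theta}\in\boldsymbol\Theta$, if $\lambda(u;\boldsymbol\theta)=\lambda(u;\tilde{\boldsymbol\theta})$ for almost every $u\in W\times T$, then $\boldsymbol\theta=\tilde{\boldsymbol\theta}$. (viii) The matrix $$\boldsymbol U=\left[\int_{W\times T}\frac{\lambda(u;\boldsymbol\theta_0)\rho(u)}{\lambda(u;\boldsymbol\theta_0)+\rho(u)}z^{(k)}(u)z^{(l)}(u)\,du\right]_{k,l=1}^m$$ is positive definite. For $\boldsymbol\theta\in\boldsymbol\Theta$ let $$\boldsymbol s_n(\boldsymbol\theta)=\sum_{x\in X_n}\frac{\rho(x)}{\lambda(x;\boldsymbol\theta)+\rho(x)}\boldsymbol z(x)-\sum_{x\in D_n}\frac{\lambda(x;\boldsymbol\theta)}{\lambda(x;\boldsymbol\theta)+\rho(x)}\boldsymbol z(x),$$ and let $\widehat{\boldsymbol\theta}_n$ be the logistic regression estimator, for which $\boldsymbol s_n(\widehat{\boldsymbol\theta}_n)=\boldsymbol 0$. If $\widehat{\boldsymbol\theta}_n$ is attained (such a solution in $\boldsymbol\Theta$ exists), then, as $n\to\infty$, $n^{1/2}(\widehat{\boldsymbol\theta}_n-\boldsymbol\theta_0)$ converges in distribution under $P_{\boldsymbol\theta_0}$ to an $m$-dimensional normally distributed random vector with mean zero and covariance matrix $\boldsymbol U^{-1}\boldsymbol V(\boldsymbol U^{-1})^\top$, where $$\boldsymbol V=\boldsymbol U+\left[\int_{W\times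 T}\int_{W\times T}\frac{\lambda(u;\boldsymbol\theta_0)\lambda(v;\boldsymbol\theta_0)\rho(u)\rho(v)z^{(k)}(u)z^{(l)}(v)}{(\lambda(u;\boldsymbol\theta_0)+\rho(u))(\lambda(v;\boldsymbol\theta_0)+\rho(v))}(g(u,v)+h(u,v)-2)\,du\,dv\right]_{k,l=1}^m.$$
   Context: A point process $Z$ on $W\times T$ has intensity function $\kappa:W\times T\to[0,\infty)$ if $\mathbb{E}\{\sum_{x\in Z}1(x\in B)\}=\int_B\kappa(u)\,du$ for every Borel set $B\subset W\times T$. It has second-order product density $\kappa^{(2)}$ if $\mathbb{E}\{\sum^{\neq}_{x,y\in Z}1(x\in B_1,y\in B_2)\}=\int_{B_1}\int_{B_2}\kappa^{(2)}(u,v)\,du\,dv$ for all Borel $B_1,B_2$ (sum over ordered pairs of distinct points, the left-hand side defining a $\sigma$-finite measure); the pair correlation function is then $\kappa^{(2)}(u,v)/(\kappa(u)\kappa(v))$. Unions of point processes are superpositions, so $\sum_{x\in X_n}=\sum_{i=1}^n\sum_{x\in Y_i}$ and likewise for $D_n$. $P_{\boldsymbol\theta_0}$ denotes the probability distribution under the true parameter value $\boldsymbol\theta_0$, i.e. when each $Y_i$ has intensity function $\lambda(\cdot;\boldsymbol\theta_0)$; the law of the $E_i$ does not depend on $\boldsymbol\theta$. The function $\boldsymbol s_n$ is the gradient in $\boldsymbol\theta$ of the logistic log-likelihood $l_n(\boldsymbol\theta)=\sum_{x\in X_n}\log[\lambda(x;\boldsymbol\theta)/(\lambda(x;\boldsymbol\theta)+\rho(x))]+\sum_{x\in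 D_n}\log[\rho(x)/(\lambda(x;\boldsymbol\theta)+\rho(x))]$. *)

theory Defs
  imports "HOL-Probability.Probability"
begin

section \<open>Point processes\<close>

text \<open>
  A configuration on a bounded set \<open>S\<close> is a finite multiset of points of \<open>S\<close>: locally finite
  configurations on a bounded set are finite, and with multisets the union (superposition) of
  point processes is the sum of multisets, so that
  sums over the superposition are exactly sums of sums. The sigma-algebra is the usual one,
  generated by the counts of points in Borel sets.
\<close>

definition config_space :: "'a::euclidean_space set \<Rightarrow> 'a multiset measure" where
  "config_space S = sigma {C. set_mset C \<subseteq> S}
     {{C. set_mset C \<subseteq> S \<and> size (filter_mset (\<lambda>x. x \<in> B) C) = k} | B k. B \<in> sets borel}"

definition point_process ::
  "'w measure \<Rightarrow> 'a::euclidean_space set \<Rightarrow> ('w \<Rightarrow> 'a multiset) \<Rightarrow> bool" where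
  "point_process M S Z \<longleftrightarrow> Z \<in> measurable M (config_space S)"

definition has_intensity ::
  "'w measure \<Rightarrow> 'a::euclidean_space set \<Rightarrow> ('w \<Rightarrow> 'a multiset) \<Rightarrow> ('a \<Rightarrow> real) \<Rightarrow> bool" where
  "has_intensity M S Z \<kappa> \<longleftrightarrow>
     point_process M S Z \<and>
     \<kappa> \<in> borel_measurable (restrict_space borel S) \<and> (\<forall>u\<in>S. 0 \<le> \<kappa> u) \<and>
     (\<forall>B\<in>sets borel. B \<subseteq> S \<longrightarrow>
        (\<integral>\<^sup>+\<omega>. (\<Sum>x\<in>#Z \<omega>. indicator B x) \<partial>M) = (\<integral>\<^sup>+u\<in>B. ennreal (\<kappa> u) \<partial>lborel))"

text \<open>
  The inner sum ranges over the configuration with one copy of \<open>x\<close> removed, so the ordered pairs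
  are pairs of distinct points even if points coincide in location.
\<close>

definition pair_sum :: "'a multiset \<Rightarrow> ('a \<times> 'a) set \<Rightarrow> ennreal" where
  "pair_sum C A = (\<Sum>x\<in>#C. \<Sum>y\<in>#(C - {#x#}). indicator A (x, y))"

text \<open>The last conjunct says that the second-order factorial moment measure is sigma-finite.\<close>

definition has_product_density ::
  "'w measure \<Rightarrow> 'a::euclidean_space set \<Rightarrow> ('w \<Rightarrow> 'a multiset) \<Rightarrow> ('a \<Rightarrow> 'a \<Rightarrow> real) \<Rightarrow> bool" where
  "has_product_density M S Z \<kappa>2 \<longleftrightarrow>
     point_process M S Z \<and>
     (\<lambda>(u, v). \<kappa>2 u v) \<in> borel_measurable (restrict_space borel (S \<times> S)) \<and>
     (\<forall>u\<in>S. \<forall>v\<in>S. 0 \<le> \<kappa>2 u v) \<and>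
     (\<forall>B1\<in>sets borel. \<forall>B2\<in>sets borel. B1 \<subseteq> S \<longrightarrow> B2 \<subseteq> S \<longrightarrow>
        (\<integral>\<^sup>+\<omega>. pair_sum (Z \<omega>) (B1 \<times> B2) \<partial>M) =
        (\<integral>\<^sup>+u\<in>B1. (\<integral>\<^sup>+v\<in>B2. ennreal (\<kappa>2 u v) \<partial>lborel) \<partial>lborel)) \<and>
     (\<exists>A :: nat \<Rightarrow> ('a \<times> 'a) set. (\<forall>j. A j \<in> sets borel) \<and> (\<Union>j. A j) = S \<times> S \<and>
        (\<forall>j. (\<integral>\<^sup>+\<omega>. pair_sum (Z \<omega>) (A j) \<partial>M) < \<infinity>))"

definition has_pair_correlation ::
  "'w measure \<Rightarrow> 'a::euclidean_space set \<Rightarrow> ('w \<Rightarrow> 'a multiset) \<Rightarrow> ('a \<Rightarrow> real) \<Rightarrow>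
   ('a \<Rightarrow> 'a \<Rightarrow> real) \<Rightarrow> bool" where
  "has_pair_correlation M S Z \<kappa> g \<longleftrightarrow>
     has_intensity M S Z \<kappa> \<and>
     (\<exists>\<kappa>2. has_product_density M S Z \<kappa>2 \<and>
        (\<forall>u\<in>S. \<forall>v\<in>S. g u v = \<kappa>2 u v / (\<kappa> u * \<kappa> v)))"

definition iid_sequence :: "'w measure \<Rightarrow> 'b measure \<Rightarrow> (nat \<Rightarrow> 'w \<Rightarrow> 'b) \<Rightarrow> bool" where
  "iid_sequence M N Z \<longleftrightarrow>
     prob_space.indep_vars M (\<lambda>_. N) Z UNIV \<and> (\<forall>i. distr M N (Z i) = distr M N (Z 0))"

definition indep_sequences ::
  "'w measure \<Rightarrow> 'b measure \<Rightarrow> (nat \<Rightarrow> 'w \<Rightarrow> 'b) \<Rightarrow> (nat \<Rightarrow> 'w \<Rightarrow> 'b) \<Rightarrow> bool" where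
  "indep_sequences M N Y Z \<longleftrightarrow>
     prob_space.indep_var M (PiM UNIV (\<lambda>_. N)) (\<lambda>\<omega> i. Y i \<omega>) (PiM UNIV (\<lambda>_. N)) (\<lambda>\<omega> i. Z i \<omega>)"

definition superposition :: "(nat \<Rightarrow> 'w \<Rightarrow> 'a multiset) \<Rightarrow> nat \<Rightarrow> 'w \<Rightarrow> 'a multiset" where
  "superposition Z n \<omega> = (\<Sum>i<n. Z i \<omega>)"


section \<open>The logistic score and its limiting matrices\<close>

definition loglin :: "('a \<Rightarrow> real) \<Rightarrow> ('a \<Rightarrow> real^'m) \<Rightarrow> real^'m \<Rightarrow> 'a \<Rightarrow> real" where
  "loglin b z \<theta> u = b u * exp (\<theta> \<bullet> z u)"

definition logistic_score ::
  "('a \<Rightarrow> real) \<Rightarrow> ('a \<Rightarrow> real^'m) \<Rightarrow> ('a \<Rightarrow> real) \<Rightarrow> 'a multiset \<Rightarrow> 'a multiset \<Rightarrow>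
   real^'m \<Rightarrow> real^'m" where
  "logistic_score b z \<rho> X D \<theta> =
     (\<Sum>x\<in>#X. (\<rho> x / (loglin b z \<theta> x + \<rho> x)) *\<^sub>R z x) -
     (\<Sum>x\<in>#D. (loglin b z \<theta> x / (loglin b z \<theta> x + \<rho> x)) *\<^sub>R z x)"

definition U_mat ::
  "'a::euclidean_space set \<Rightarrow> ('a \<Rightarrow> real) \<Rightarrow> ('a \<Rightarrow> real) \<Rightarrow> ('a \<Rightarrow> real^'m) \<Rightarrow> real^'m^'m" where
  "U_mat S lam \<rho> z = (\<chi> k l. LINT u:S|lborel.
     lam u * \<rho> u / (lam u + \<rho> u) * (z u $ k) * (z u $ l))"

definition V_mat ::
  "'a::euclidean_space set \<Rightarrow> ('a \<Rightarrow> real) \<Rightarrow> ('a \<Rightarrow> real) \<Rightarrow> ('a \<Rightarrow> real^'m) \<Rightarrow>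
   ('a \<Rightarrow> 'a \<Rightarrow> real) \<Rightarrow> ('a \<Rightarrow> 'a \<Rightarrow> real) \<Rightarrow> real^'m^'m" where
  "V_mat S lam \<rho> z g h = U_mat S lam \<rho> z +
     (\<chi> k l. LINT u:S|lborel. LINT v:S|lborel.
        lam u * lam v * \<rho> u * \<rho> v * (z u $ k) * (z v $ l) /
          ((lam u + \<rho> u) * (lam v + \<rho> v)) * (g u v + h u v - 2))"

definition positive_definite :: "real^'n^'n \<Rightarrow> bool" where
  "positive_definite A \<longleftrightarrow> transpose A = A \<and> (\<forall>x. x \<noteq> 0 \<longrightarrow> 0 < x \<bullet> (A *v x))"


section \<open>Multivariate normal laws and convergence in distribution\<close>

definition normal_law :: "real \<Rightarrow> real \<Rightarrow> real measure \<Rightarrow> bool" where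
  "normal_law \<mu> v N \<longleftrightarrow>
     0 < v \<and> N = density lborel (\<lambda>x. ennreal (normal_density \<mu> (sqrt v) x)) \<or>
     v = 0 \<and> N = return borel \<mu>"

text \<open>
  The covariance matrix may be singular, so the law need not have a Lebesgue density; it is
  determined by the laws of its one-dimensional projections.
\<close>

definition mv_normal_law :: "real^'m \<Rightarrow> real^'m^'m \<Rightarrow> (real^'m) measure \<Rightarrow> bool" where
  "mv_normal_law \<mu> \<Sigma> N \<longleftrightarrow>
     prob_space N \<and> sets N = sets borel \<and> transpose \<Sigma> = \<Sigma> \<and>
     (\<forall>a. normal_law (a \<bullet> \<mu>) (a \<bullet> (\<Sigma> *v a)) (distr N borel (\<lambda>x. a \<bullet> x)))"

definition converges_in_distribution ::
  "'w measure \<Rightarrow> (nat \<Rightarrow> 'w \<Rightarrow> 'b::euclidean_space) \<Rightarrow> 'b measure \<Rightarrow> bool" where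
  "converges_in_distribution M X N \<longleftrightarrow>
     (\<forall>n. X n \<in> borel_measurable M) \<and>
     (\<forall>f :: 'b \<Rightarrow> real. continuous_on UNIV f \<longrightarrow> bounded (range f) \<longrightarrow>
        (\<lambda>n. LINT \<omega>|M. f (X n \<omega>)) \<longlonglongrightarrow> (LINT x|N. f x))"

end

theory Submission
  imports Defs "HOL-Real_Asymp.Real_Asymp"
begin

text \<open>
  Write \<open>\<delta> = \<theta> - \<theta>0\<close> and let \<open>L x s\<close> be the logistic function \<open>\<lambda> e\<^sup>s / (\<lambda> e\<^sup>s + \<rho>)\<close> at the point \<open>x\<close>, with
  \<open>\<lambda> = \<lambda>(x; \<theta>0)\<close>. Since \<open>\<lambda>(x; \<theta>) = \<lambda>(x; \<theta>0) exp (\<delta> \<bullet> z x)\<close>, the score changes by a single sum over the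
  merged pattern, \<open>s\<^sub>n \<theta>0 - s\<^sub>n \<theta> = \<Sum>x. (L x (\<delta> \<bullet> z x) - L x 0) z x\<close>. Two properties of \<open>L x\<close> then control every
  zero of the score. It is increasing, so \<open>\<delta> \<bullet> (s\<^sub>n \<theta>0 - s\<^sub>n \<theta>)\<close> can only shrink when \<open>\<delta>\<close> is scaled down to a small
  ball, where it is quadratic; this confines the zeros to \<open>norm \<delta> \<le> C norm (s\<^sub>n \<theta>0) / n\<close> without a separate
  consistency argument. And it equals its tangent up to \<open>s\<^sup>2\<close>, so that at a zero \<open>s\<^sub>n \<theta>0 = n U \<delta>\<close> up to a remainder.
  Both steps are deterministic inequalities about one pattern (\<open>logistic_zero_bounds\<close>,
  \<open>logistic_zero_linearization\<close>).

  Their hypotheses concern finitely many sums of a bounded function over the superposed pattern: the score at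
  \<open>\<theta>0\<close>, the entries of the Hessian and the number of points. Each is a sum of independent, identically
  distributed, square integrable variables, the square integrability being a consequence of the bounded pair
  correlation. By Chebyshev's inequality all of them deviate from their means by at most \<open>n\<^bsup>5/8\<^esup>\<close> with probability
  tending to one, and this single rate suffices: the remainder above becomes \<open>O(n\<^bsup>1/4\<^esup>) = o(n\<^bsup>1/2\<^esup>)\<close>, so
  \<open>\<surd>n \<delta>\<close> and \<open>U\<^sup>-\<^sup>1 s\<^sub>n \<theta>0 / \<surd>n\<close> have the same limit law (\<open>estimator_linearization\<close>).

  The score at \<open>\<theta>0\<close> is a sum over the \<open>Y\<^sub>i\<close> minus a sum over the \<open>E\<^sub>i\<close>. The two parts are independent and have
  the same mean, because \<open>(\<rho> / (\<lambda> + \<rho>)) \<lambda> = (\<lambda> / (\<lambda> + \<rho>)) \<rho>\<close>, so the central limit theorem applied to each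
  part gives the limiting characteristic function of every linear combination of its coordinates. Campbell's
  formulas for one and two points identify the covariance: the diagonal terms \<open>\<rho>\<^sup>2 \<lambda> + \<lambda>\<^sup>2 \<rho> = \<lambda> \<rho> (\<lambda> + \<rho>)\<close> add up
  to \<open>U\<close>, and the pair terms minus the products of the means give the double integral in \<open>V\<close> (\<open>V_entry\<close>). That
  \<open>V\<close> is symmetric and positive semidefinite is read off from this covariance.

  The passage from characteristic functions to convergence in distribution is Levy's continuity theorem in
  Euclidean space (\<open>levy_continuity_euclidean\<close>). Trigonometric polynomials are dense by Stone-Weierstrass on every
  ball, and tightness comes from the one-dimensional theorem applied to the coordinates. The limit law is the
  image of independent standard normal variables under a factor of the covariance matrix.
\<close>

section \<open>Levy's continuity theorem in Euclidean space\<close>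

inductive trig_polynomial :: "('b::euclidean_space \<Rightarrow> real) \<Rightarrow> bool" where
  cos: "trig_polynomial (\<lambda>x. c * cos (a \<bullet> x))"
| sin: "trig_polynomial (\<lambda>x. c * sin (a \<bullet> x))"
| add: "trig_polynomial f \<Longrightarrow> trig_polynomial g \<Longrightarrow> trig_polynomial (\<lambda>x. f x + g x)"

lemma trig_polynomial_const: "trig_polynomial (\<lambda>_. c)"
  using trig_polynomial.cos[of c 0] by simp

lemma trig_polynomial_continuous: "trig_polynomial f \<Longrightarrow> continuous_on A f"
  by (induction rule: trig_polynomial.induct) (intro continuous_intros; assumption)+

lemma trig_polynomial_bounded: "trig_polynomial f \<Longrightarrow> \<exists>B. \<forall>x. \<bar>f x\<bar> \<le> B"
proof (induction rule: trig_polynomial.induct)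
  case (cos c a)
  have "\<bar>c * cos (a \<bullet> x)\<bar> \<le> \<bar>c\<bar>" for x
    by (simp add: abs_mult mult_left_le)
  then show ?case by blast
next
  case (sin c a)
  have "\<bar>c * sin (a \<bullet> x)\<bar> \<le> \<bar>c\<bar>" for x
    by (simp add: abs_mult mult_left_le)
  then show ?case by blast
next
  case (add f g)
  then obtain B1 B2 where "\<And>x. \<bar>f x\<bar> \<le> B1" "\<And>x. \<bar>g x\<bar> \<le> B2" by blast
  then have "\<bar>f x + g x\<bar> \<le> B1 + B2" for x
    by (metis abs_triangle_ineq add_mono order_trans)
  then show ?case by blast
qed

lemma trig_polynomial_times_cos:
  "trig_polynomial f \<Longrightarrow> trig_polynomial (\<lambda>x. f x * (d * cos (b \<bullet> x)))"
proof (induction rule: trig_polynomial.induct)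
  case (cos c a)
  have "(\<lambda>x. c * cos (a \<bullet> x) * (d * cos (b \<bullet> x))) =
    (\<lambda>x. (c * d / 2) * cos ((a - b) \<bullet> x) + (c * d / 2) * cos ((a + b) \<bullet> x))"
    by (rule ext) (simp add: inner_diff_left inner_add_left cos_add cos_diff algebra_simps)
  then show ?case by (simp only:) (intro trig_polynomial.intros)
next
  case (sin c a)
  have "(\<lambda>x. c * sin (a \<bullet> x) * (d * cos (b \<bullet> x))) =
    (\<lambda>x. (c * d / 2) * sin ((a - b) \<bullet> x) + (c * d / 2) * sin ((a + b) \<bullet> x))"
    by (rule ext) (simp add: inner_diff_left inner_add_left sin_add sin_diff algebra_simps)
  then show ?case by (simp only:) (intro trig_polynomial.intros)
next
  case (add f g)
  then show ?case by (simp add: distrib_right trig_polynomial.add)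
qed

lemma trig_polynomial_times_sin:
  "trig_polynomial f \<Longrightarrow> trig_polynomial (\<lambda>x. f x * (d * sin (b \<bullet> x)))"
proof (induction rule: trig_polynomial.induct)
  case (cos c a)
  have "(\<lambda>x. c * cos (a \<bullet> x) * (d * sin (b \<bullet> x))) =
    (\<lambda>x. (- c * d / 2) * sin ((a - b) \<bullet> x) + (c * d / 2) * sin ((a + b) \<bullet> x))"
    by (rule ext) (simp add: inner_diff_left inner_add_left sin_add sin_diff algebra_simps)
  then show ?case by (simp only:) (intro trig_polynomial.intros)
next
  case (sin c a)
  have "(\<lambda>x. c * sin (a \<bullet> x) * (d * sin (b \<bullet> x))) =
    (\<lambda>x. (c * d / 2) * cos ((a - b) \<bullet> x) + (- c * d / 2) * cos ((a + b) \<bullet> x))"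
    by (rule ext) (simp add: inner_diff_left inner_add_left cos_add cos_diff algebra_simps)
  then show ?case by (simp only:) (intro trig_polynomial.intros)
next
  case (add f g)
  then show ?case by (simp add: distrib_right trig_polynomial.add)
qed

text \<open>
  The product-to-sum identities make the trigonometric polynomials an algebra, as the Stone-Weierstrass theorem
  requires.
\<close>
lemma trig_polynomial_mult:
  assumes "trig_polynomial f" "trig_polynomial g"
  shows "trig_polynomial (\<lambda>x. f x * g x)"
  using assms(2,1)
proof (induction arbitrary: f rule: trig_polynomial.induct)
  case (add g h)
  then show ?case by (simp add: distrib_left trig_polynomial.add)
qed (auto intro: trig_polynomial_times_cos trig_polynomial_times_sin)

lemma trig_polynomial_compose_polynomial:
  fixes q :: "real \<Rightarrow> real"
  assumes "real_polynomial_function q" and f: "trig_polynomial f"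
  shows "trig_polynomial (\<lambda>x. q (f x))"
  using assms(1)
proof (induction rule: real_polynomial_function.induct)
  case (linear q)
  then obtain c where "q = (\<lambda>x. x * c)"
    by (metis real_bounded_linear)
  then show ?case
    using trig_polynomial_mult[OF f trig_polynomial_const[of c]] by simp
qed (auto intro: trig_polynomial_const trig_polynomial_mult trig_polynomial.add)

text \<open>
  Along a suitable direction two distinct points have phases that differ by exactly 1, which is not a multiple of
  the period.
\<close>
lemma trig_polynomial_separates:
  fixes x y :: "'b::euclidean_space"
  assumes "x \<noteq> y"
  shows "\<exists>f. trig_polynomial f \<and> f x \<noteq> f y"
proof -
  \<comment> \<open>This direction has inner product 1 with \<open>x - y\<close>.\<close>
  define a where "a = (1 / (norm (x - y))\<^sup>2) *\<^sub>R (x - y)"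
  have "a \<bullet> (x - y) = 1"
    using assms by (simp add: a_def power2_norm_eq_inner)
  then have *: "a \<bullet> x = a \<bullet> y + 1" by (simp add: inner_diff_right)
  have "cos 1 < (1::real)"
    using cos_monotone_0_pi[of 0 1] pi_gt3 by simp
  have "cos (a \<bullet> x) \<noteq> cos (a \<bullet> y) \<or> sin (a \<bullet> x) \<noteq> sin (a \<bullet> y)"
  proof (rule ccontr)
    assume "\<not> ?thesis"
    then have "cos (a \<bullet> x - a \<bullet> y) = 1" by (simp add: cos_diff flip: power2_eq_square)
    with * \<open>cos 1 < 1\<close> show False by simp
  qed
  then show ?thesis
    using trig_polynomial.cos[of 1 a] trig_polynomial.sin[of 1 a] by (elim disjE) (rule exI, force)+
qed

text \<open>
  Stone-Weierstrass controls the approximant on \<open>K\<close> only. Composing it with the clamp onto the interval from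
  \<open>- C\<close> to \<open>C\<close> restores a global bound; the clamp is itself approximated by a polynomial on the bounded range of the
  first approximant, and a polynomial in a trigonometric polynomial is again one.
\<close>
lemma trig_polynomial_approximation:
  fixes f :: "'b::euclidean_space \<Rightarrow> real"
  assumes f: "continuous_on UNIV f" and C: "\<And>x. \<bar>f x\<bar> \<le> C" and K: "compact K" and e: "0 < e"
  obtains q where "trig_polynomial q" "\<And>x. x \<in> K \<Longrightarrow> \<bar>f x - q x\<bar> < e" "\<And>x. \<bar>q x\<bar> \<le> C + e"
proof -
  have "\<exists>g. trig_polynomial g \<and> (\<forall>x \<in> K. \<bar>f x - g x\<bar> < e / 2)"
    by (rule Stone_Weierstrass_HOL)
       (use K e f trig_polynomial_separates in
         \<open>auto intro: trig_polynomial_const trig_polynomial_continuous trig_polynomial.add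
                      trig_polynomial_mult continuous_on_subset\<close>)
  then obtain p where p: "trig_polynomial p" "\<And>x. x \<in> K \<Longrightarrow> \<bar>f x - p x\<bar> < e / 2" by blast
  obtain B where B: "\<And>x. \<bar>p x\<bar> \<le> B"
    using trig_polynomial_bounded[OF p(1)] by blast
  have "C \<ge> 0" using C[of undefined] by linarith
  define clamp where "clamp t = max (- C) (min C t)" for t
  obtain q where q: "real_polynomial_function q" "\<And>t. t \<in> {-B..B} \<Longrightarrow> \<bar>clamp t - q t\<bar> < e / 2"
  proof (rule Stone_Weierstrass_real_polynomial_function[of "{-B..B}" clamp "e / 2"])
    show "continuous_on {- B..B} clamp" unfolding clamp_def by (intro continuous_intros)
  qed (use e in auto)
  have near: "\<bar>clamp (p x) - q (p x)\<bar> < e / 2" for x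
    using q(2)[of "p x"] B[of x] by (auto simp: abs_le_iff)
  show thesis
  proof
    show "trig_polynomial (\<lambda>x. q (p x))"
      using q(1) p(1) by (rule trig_polynomial_compose_polynomial)
    show "\<bar>f x - q (p x)\<bar> < e" if "x \<in> K" for x
      using near[of x] p(2)[OF that] C[of x] unfolding clamp_def by (auto simp: max_def min_def abs_if split: if_splits)
    show "\<bar>q (p x)\<bar> \<le> C + e" for x
      using near[of x] \<open>C \<ge> 0\<close> e unfolding clamp_def by (auto simp: max_def min_def abs_if split: if_splits)
  qed
qed

lemma (in prob_space) integrable_bounded_real:
  fixes f :: "'a \<Rightarrow> real"
  assumes "f \<in> borel_measurable M" "\<And>x. x \<in> space M \<Longrightarrow> \<bar>f x\<bar> \<le> B"
  shows "integrable M f"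
  using assms by (intro integrable_const_bound[where B=B]) auto

text \<open>
  Cosines and sines are the real and imaginary parts of the characters, so convergence of the characteristic
  functions passes to all their linear combinations.
\<close>
lemma trig_polynomial_integral_conv:
  fixes X :: "nat \<Rightarrow> 'w \<Rightarrow> 'b::euclidean_space"
  assumes "prob_space M" "prob_space N" and sets_N: "sets N = sets borel"
    and X: "\<And>n. X n \<in> borel_measurable M"
    and conv: "\<And>a. (\<lambda>n. CLINT \<omega>|M. iexp (a \<bullet> X n \<omega>)) \<longlonglongrightarrow> (CLINT x|N. iexp (a \<bullet> x))"
    and "trig_polynomial q"
  shows "(\<lambda>n. LINT \<omega>|M. q (X n \<omega>)) \<longlonglongrightarrow> (LINT x|N. q x)"
proof -
  interpret M: prob_space M by fact
  interpret N: prob_space N by fact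
  note [measurable] = X
  have [measurable_cong]: "sets N = sets borel" by (fact sets_N)
  have iM: "integrable M (\<lambda>\<omega>. iexp (a \<bullet> X n \<omega>))" for a n
    by (rule M.integrable_const_bound[where B=1]) auto
  have iN: "integrable N (\<lambda>x. iexp (a \<bullet> x))" for a
    by (rule N.integrable_const_bound[where B=1]) auto
  have re: "cos t = Re (iexp t)" and im: "sin t = Im (iexp t)" for t
    by (simp_all flip: cis_conv_exp)
  have mq: "trig_polynomial p \<Longrightarrow> p \<in> borel_measurable borel" for p :: "'b \<Rightarrow> real"
    by (rule borel_measurable_continuous_onI[OF trig_polynomial_continuous])
  from \<open>trig_polynomial q\<close> show ?thesis
  proof (induction rule: trig_polynomial.induct)
    case (cos c a)
    have "(\<lambda>n. Re (CLINT \<omega>|M. iexp (a \<bullet> X n \<omega>))) \<longlonglongrightarrow> Re (CLINT x|N. iexp (a \<bullet> x))"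
      by (rule tendsto_Re[OF conv])
    then have "(\<lambda>n. LINT \<omega>|M. cos (a \<bullet> X n \<omega>)) \<longlonglongrightarrow> (LINT x|N. cos (a \<bullet> x))"
      unfolding re by (simp add: integral_Re iM iN del: Re_exp)
    then show ?case by (auto intro: tendsto_intros)
  next
    case (sin c a)
    have "(\<lambda>n. Im (CLINT \<omega>|M. iexp (a \<bullet> X n \<omega>))) \<longlonglongrightarrow> Im (CLINT x|N. iexp (a \<bullet> x))"
      by (rule tendsto_Im[OF conv])
    then have "(\<lambda>n. LINT \<omega>|M. sin (a \<bullet> X n \<omega>)) \<longlonglongrightarrow> (LINT x|N. sin (a \<bullet> x))"
      unfolding im by (simp add: integral_Im iM iN del: Im_exp)
    then show ?case by (auto intro: tendsto_intros)
  next
    case (add f g)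
    have [measurable]: "f \<in> borel_measurable borel" "g \<in> borel_measurable borel"
      using add mq by auto
    have "integrable M (\<lambda>\<omega>. f (X n \<omega>))" "integrable M (\<lambda>\<omega>. g (X n \<omega>))" for n
      using trig_polynomial_bounded[OF add(1)] trig_polynomial_bounded[OF add(2)]
      by (auto intro: M.integrable_bounded_real)
    moreover have "integrable N f" "integrable N g"
      using trig_polynomial_bounded[OF add(1)] trig_polynomial_bounded[OF add(2)]
      by (auto intro: N.integrable_bounded_real)
    ultimately show ?case using add by (auto intro: tendsto_intros)
  qed
qed

lemma (in real_distribution) small_tail:
  assumes "0 < e"
  shows "\<exists>R. prob {x. R < \<bar>x\<bar>} < e"
proof -
  have "(\<lambda>n. prob {x. real n < \<bar>x\<bar>}) \<longlonglongrightarrow> prob (\<Inter>n. {x. real n < \<bar>x\<bar>})"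
    by (rule finite_Lim_measure_decseq) (auto simp: decseq_def)
  also have "(\<Inter>n. {x. real n < \<bar>x\<bar>}) = {}"
    using reals_Archimedean2 by (auto dest: less_asym)
  finally have "\<forall>\<^sub>F n in sequentially. prob {x. real n < \<bar>x\<bar>} < e"
    using assms by (intro order_tendstoD(2)) auto
  then show ?thesis by (auto simp: eventually_sequentially)
qed

text \<open>
  A continuous ramp that vanishes on \<open>[-R, R]\<close> and is 1 outside \<open>[-R - 1, R + 1]\<close> transfers the small tail of the
  limit to the sequence.
\<close>
lemma weak_conv_m_tight:
  assumes "\<And>n. real_distribution (\<mu> n)" "real_distribution \<nu>" "weak_conv_m \<mu> \<nu>" "0 < e"
  shows "\<exists>R. \<forall>\<^sub>F n in sequentially. measure (\<mu> n) {x. R < \<bar>x\<bar>} < e"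
proof -
  interpret N: real_distribution \<nu> by fact
  obtain R where R: "measure \<nu> {x. R < \<bar>x\<bar>} < e"
    using N.small_tail[OF \<open>0 < e\<close>] by blast
  define ramp where "ramp x = max 0 (min 1 (\<bar>x\<bar> - R))" for x :: real
  have ramp01: "0 \<le> ramp x" "ramp x \<le> 1" for x by (auto simp: ramp_def)
  have cont: "continuous_on UNIV ramp"
    unfolding ramp_def by (intro continuous_intros)
  then have [measurable]: "ramp \<in> borel_measurable borel"
    by (rule borel_measurable_continuous_onI)
  have lim: "(\<lambda>n. LINT x|\<mu> n. ramp x) \<longlonglongrightarrow> (LINT x|\<nu>. ramp x)"
    using cont assms(1,2,3) ramp01
    by (intro weak_conv_imp_integral_bdd_continuous_conv[where B=1])
       (auto simp: continuous_on_eq_continuous_at)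
  have "(LINT x|\<nu>. ramp x) \<le> (LINT x|\<nu>. indicator {x. R < \<bar>x\<bar>} x)"
    using ramp01 by (intro integral_mono N.integrable_bounded_real[where B=1])
       (auto simp: ramp_def indicator_def)
  also have "\<dots> = measure \<nu> {x. R < \<bar>x\<bar>}" by simp
  also note R
  finally have ev: "\<forall>\<^sub>F n in sequentially. (LINT x|\<mu> n. ramp x) < e"
    using lim by (intro order_tendstoD(2))
  have "measure (\<mu> n) {x. R + 1 < \<bar>x\<bar>} \<le> (LINT x|\<mu> n. ramp x)" for n
  proof -
    interpret real_distribution "\<mu> n" by fact
    have "measure (\<mu> n) {x. R + 1 < \<bar>x\<bar>} = (LINT x|\<mu> n. indicator {x. R + 1 < \<bar>x\<bar>} x)"
      by simp
    also have "\<dots> \<le> (LINT x|\<mu> n. ramp x)"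
      using ramp01 by (intro integral_mono integrable_bounded_real[where B=1])
         (auto simp: ramp_def indicator_def)
    finally show ?thesis .
  qed
  with ev show ?thesis
    by (intro exI[of _ "R + 1"]) (auto elim!: eventually_mono intro: le_less_trans)
qed

text \<open>
  Each coordinate converges weakly by the one-dimensional continuity theorem, hence is tight, and the norm is at
  most the sum of the absolute coordinates.
\<close>
lemma char_conv_tight:
  fixes X :: "nat \<Rightarrow> 'w \<Rightarrow> 'b::euclidean_space"
  assumes "prob_space M" "prob_space N" and sets_N: "sets N = sets borel"
    and X: "\<And>n. X n \<in> borel_measurable M"
    and conv: "\<And>a. (\<lambda>n. CLINT \<omega>|M. iexp (a \<bullet> X n \<omega>)) \<longlonglongrightarrow> (CLINT x|N. iexp (a \<bullet> x))"
    and "0 < e"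
  shows "\<exists>R. \<forall>\<^sub>F n in sequentially. measure M {\<omega> \<in> space M. R < norm (X n \<omega>)} < e"
proof -
  interpret M: prob_space M by fact
  interpret N: prob_space N by fact
  note [measurable] = X
  have [measurable_cong]: "sets N = sets borel" by (fact sets_N)
  have rdM: "real_distribution (distr M borel (\<lambda>\<omega>. i \<bullet> X n \<omega>))" for i n by simp
  have rdN: "real_distribution (distr N borel (\<lambda>x. i \<bullet> x))" for i
    by (intro N.real_distribution_distr) simp
  define d where "d = e / DIM('b)"
  have "d > 0" using \<open>0 < e\<close> by (simp add: d_def)
  have "\<exists>R. \<forall>\<^sub>F n in sequentially. measure M {\<omega> \<in> space M. R < \<bar>i \<bullet> X n \<omega>\<bar>} < d" for i
  proof -
    have "weak_conv_m (\<lambda>n. distr M borel (\<lambda>\<omega>. i \<bullet> X n \<omega>)) (distr N borel (\<lambda>x. i \<bullet> x))"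
    proof (rule levy_continuity[OF rdM rdN])
      fix t :: real
      show "(\<lambda>n. char (distr M borel (\<lambda>\<omega>. i \<bullet> X n \<omega>)) t) \<longlonglongrightarrow> char (distr N borel (\<lambda>x. i \<bullet> x)) t"
        using conv[of "t *\<^sub>R i"] by (simp add: char_def integral_distr)
    qed
    from weak_conv_m_tight[OF rdM rdN this \<open>d > 0\<close>] show ?thesis
      by (simp add: measure_distr vimage_def Int_def conj_commute)
  qed
  then have "\<forall>i. \<exists>R. \<forall>\<^sub>F n in sequentially. measure M {\<omega> \<in> space M. R < \<bar>i \<bullet> X n \<omega>\<bar>} < d"
    by (rule allI)
  from choice[OF this]
  obtain R where R: "\<forall>i. \<forall>\<^sub>F n in sequentially. measure M {\<omega> \<in> space M. R i < \<bar>i \<bullet> X n \<omega>\<bar>} < d"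
    by (rule exE)
  define R' where "R' = (\<Sum>i\<in>Basis. R i)"
  have "\<forall>\<^sub>F n in sequentially. \<forall>i\<in>(Basis::'b set). measure M {\<omega> \<in> space M. R i < \<bar>i \<bullet> X n \<omega>\<bar>} < d"
    using R by (intro eventually_ball_finite) auto
  then have "\<forall>\<^sub>F n in sequentially. measure M {\<omega> \<in> space M. R' < norm (X n \<omega>)} < e"
  proof eventually_elim
    case (elim n)
    have "{\<omega> \<in> space M. R' < norm (X n \<omega>)} \<subseteq> (\<Union>i\<in>Basis. {\<omega> \<in> space M. R i < \<bar>i \<bullet> X n \<omega>\<bar>})"
    proof
      fix \<omega> assume \<omega>: "\<omega> \<in> {\<omega> \<in> space M. R' < norm (X n \<omega>)}"
      show "\<omega> \<in> (\<Union>i\<in>Basis. {\<omega> \<in> space M. R i < \<bar>i \<bullet> X n \<omega>\<bar>})"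
      proof (rule ccontr)
        assume "\<not> ?thesis"
        then have "\<bar>X n \<omega> \<bullet> i\<bar> \<le> R i" if "i \<in> Basis" for i
          using \<omega> that by (force simp: inner_commute)
        then have "(\<Sum>i\<in>Basis. \<bar>X n \<omega> \<bullet> i\<bar>) \<le> R'"
          unfolding R'_def by (intro sum_mono)
        with norm_le_l1[of "X n \<omega>"] \<omega> show False by simp
      qed
    qed
    then have "measure M {\<omega> \<in> space M. R' < norm (X n \<omega>)}
        \<le> measure M (\<Union>i\<in>Basis. {\<omega> \<in> space M. R i < \<bar>i \<bullet> X n \<omega>\<bar>})"
      by (intro M.finite_measure_mono) auto
    also have "\<dots> \<le> (\<Sum>i\<in>Basis. measure M {\<omega> \<in> space M. R i < \<bar>i \<bullet> X n \<omega>\<bar>})"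
      by (intro M.finite_measure_subadditive_finite) auto
    also have "\<dots> < (\<Sum>i\<in>(Basis::'b set). d)"
      using elim by (intro sum_strict_mono) auto
    also have "\<dots> = e" by (simp add: d_def)
    finally show ?case .
  qed
  then show ?thesis by blast
qed

text \<open>
  The price of replacing \<open>f\<close> by \<open>q\<close> is the uniform error inside the ball plus the mass outside, where only the
  bounds of the two functions are known.
\<close>
lemma (in prob_space) integral_approximation_off_ball:
  fixes X :: "'a \<Rightarrow> 'b::euclidean_space" and f q :: "'b \<Rightarrow> real"
  assumes [measurable]: "X \<in> borel_measurable M" "f \<in> borel_measurable borel" "q \<in> borel_measurable borel"
    and f: "\<And>x. \<bar>f x\<bar> \<le> C" and q: "\<And>x. \<bar>q x\<bar> \<le> C + d" and d: "0 \<le> d"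
    and near: "\<And>x. norm x \<le> R \<Longrightarrow> \<bar>f x - q x\<bar> \<le> d"
  shows "\<bar>(LINT \<omega>|M. f (X \<omega>)) - (LINT \<omega>|M. q (X \<omega>))\<bar>
    \<le> d + (2 * C + d) * prob {\<omega> \<in> space M. R < norm (X \<omega>)}"
proof -
  let ?A = "{\<omega> \<in> space M. R < norm (X \<omega>)}"
  have int: "integrable M (\<lambda>\<omega>. f (X \<omega>))" "integrable M (\<lambda>\<omega>. q (X \<omega>))"
    using f q by (intro integrable_bounded_real[where B=C] integrable_bounded_real[where B="C + d"]; simp)+
  have "\<bar>(LINT \<omega>|M. f (X \<omega>)) - (LINT \<omega>|M. q (X \<omega>))\<bar> = \<bar>LINT \<omega>|M. f (X \<omega>) - q (X \<omega>)\<bar>"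
    using int by simp
  also have "\<dots> \<le> (LINT \<omega>|M. \<bar>f (X \<omega>) - q (X \<omega>)\<bar>)"
    by (rule integral_abs_bound)
  also have "\<dots> \<le> (LINT \<omega>|M. d + (2 * C + d) * indicator ?A \<omega>)"
  proof (rule integral_mono)
    show "integrable M (\<lambda>\<omega>. d + (2 * C + d) * indicator ?A \<omega>)"
      by (intro Bochner_Integration.integrable_add integrable_const integrable_mult_right integrable_real_indicator)
         (auto simp: less_top[symmetric])
    show "integrable M (\<lambda>\<omega>. \<bar>f (X \<omega>) - q (X \<omega>)\<bar>)" using int by simp
    fix \<omega> assume "\<omega> \<in> space M"
    then show "\<bar>f (X \<omega>) - q (X \<omega>)\<bar> \<le> d + (2 * C + d) * indicator ?A \<omega>"
      using near[of "X \<omega>"] f[of "X \<omega>"] q[of "X \<omega>"] d by (auto simp: indicator_def)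
  qed
  also have "\<dots> = d + (2 * C + d) * prob ?A"
    by (subst Bochner_Integration.integral_add) (auto simp: prob_space less_top[symmetric])
  finally show ?thesis .
qed

text \<open>
  A bounded continuous function is replaced by a trigonometric polynomial that is close to it on a large ball and
  bounded everywhere; by tightness the mass outside the ball does not matter.
\<close>
theorem levy_continuity_euclidean:
  fixes X :: "nat \<Rightarrow> 'w \<Rightarrow> 'b::euclidean_space"
  assumes M: "prob_space M" and N: "prob_space N" and sets_N: "sets N = sets borel"
    and X: "\<And>n. X n \<in> borel_measurable M"
    and conv: "\<And>a. (\<lambda>n. CLINT \<omega>|M. iexp (a \<bullet> X n \<omega>)) \<longlonglongrightarrow> (CLINT x|N. iexp (a \<bullet> x))"
  shows "converges_in_distribution M X N"
  unfolding converges_in_distribution_def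
proof (intro conjI allI impI)
  show "X n \<in> borel_measurable M" for n by (fact X)
  fix f :: "'b \<Rightarrow> real"
  assume f: "continuous_on UNIV f" "bounded (range f)"
  interpret M: prob_space M by fact
  interpret N: prob_space N by fact
  note [measurable] = X
  have [measurable_cong]: "sets N = sets borel" by (fact sets_N)
  have [measurable]: "f \<in> borel_measurable borel"
    using f(1) by (rule borel_measurable_continuous_onI)
  obtain C where C: "\<And>x. \<bar>f x\<bar> \<le> C"
    using f(2) by (auto simp: bounded_iff)
  then have "C \<ge> 0" by (meson abs_ge_zero order_trans)
  show "(\<lambda>n. LINT \<omega>|M. f (X n \<omega>)) \<longlonglongrightarrow> (LINT x|N. f x)"
  proof (rule LIMSEQ_I)
    fix e :: real assume "0 < e"
    \<comment> \<open>The cap at 1 keeps the factor \<open>2 C + d\<close> of the tail mass bounded by \<open>2 C + 1\<close>.\<close>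
    define d where "d = min 1 (e / 8)"
    define p where "p = e / (8 * (2 * C + 1))"
    have d: "0 < d" "d \<le> 1" "d \<le> e / 8" using \<open>0 < e\<close> by (auto simp: d_def)
    have p: "0 < p" using \<open>0 < e\<close> \<open>C \<ge> 0\<close> by (simp add: p_def)
    have dp: "(2 * C + d) * r \<le> e / 8" if "0 \<le> r" "r < p" for r
    proof -
      have "(2 * C + d) * r \<le> (2 * C + 1) * p"
        using that d \<open>C \<ge> 0\<close> by (intro mult_mono) auto
      also have "\<dots> = e / 8"
        using \<open>C \<ge> 0\<close> by (simp add: p_def divide_simps)
      finally show ?thesis .
    qed
    obtain R1 where R1: "\<forall>\<^sub>F n in sequentially. measure M {\<omega> \<in> space M. R1 < norm (X n \<omega>)} < p"
      using char_conv_tight[OF M N sets_N X conv p] by blast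
    obtain R2 where R2: "\<forall>\<^sub>F n::nat in sequentially. measure N {x \<in> space N. R2 < norm (id x)} < p"
      using char_conv_tight[OF N N sets_N _ _ p, of "\<lambda>n. id"] sets_N
        by (auto simp: measurable_ident_sets)
    define R where "R = max R1 R2"
    obtain q where q: "trig_polynomial q" "\<And>x. x \<in> cball 0 R \<Longrightarrow> \<bar>f x - q x\<bar> < d"
        "\<And>x. \<bar>q x\<bar> \<le> C + d"
      using trig_polynomial_approximation[OF f(1) C compact_cball d(1)] by metis
    have [measurable]: "q \<in> borel_measurable borel"
      by (rule borel_measurable_continuous_onI[OF trig_polynomial_continuous[OF q(1)]])
    have near: "norm x \<le> R \<Longrightarrow> \<bar>f x - q x\<bar> \<le> d" for x
      using q(2)[of x] by (simp add: less_imp_le)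
    have "\<bar>(LINT x|N. f x) - (LINT x|N. q x)\<bar> \<le> d + (2 * C + d) * measure N {x \<in> space N. R < norm x}"
      using d C q(3) near by (intro N.integral_approximation_off_ball[where X="\<lambda>x. x"]) auto
    also have "measure N {x \<in> space N. R < norm x} \<le> measure N {x \<in> space N. R2 < norm x}"
      by (intro N.finite_measure_mono) (auto simp: R_def)
    then have "(2 * C + d) * measure N {x \<in> space N. R < norm x} \<le> e / 8"
      using R2 by (intro dp) auto
    finally have fN: "\<bar>(LINT x|N. f x) - (LINT x|N. q x)\<bar> \<le> e / 4" using d by simp
    have "(\<lambda>n. LINT \<omega>|M. q (X n \<omega>)) \<longlonglongrightarrow> (LINT x|N. q x)"
      using M N sets_N X conv q(1) by (rule trig_polynomial_integral_conv)
    then have "\<forall>\<^sub>F n in sequentially. dist (LINT \<omega>|M. q (X n \<omega>)) (LINT x|N. q x) < e / 4"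
      using \<open>0 < e\<close> by (intro tendstoD) auto
    with R1 have "\<forall>\<^sub>F n in sequentially. norm ((LINT \<omega>|M. f (X n \<omega>)) - (LINT x|N. f x)) < e"
    proof eventually_elim
      case (elim n)
      have "\<bar>(LINT \<omega>|M. f (X n \<omega>)) - (LINT \<omega>|M. q (X n \<omega>))\<bar>
          \<le> d + (2 * C + d) * measure M {\<omega> \<in> space M. R < norm (X n \<omega>)}"
        using d C q(3) near by (intro M.integral_approximation_off_ball) auto
      also have "measure M {\<omega> \<in> space M. R < norm (X n \<omega>)} \<le> measure M {\<omega> \<in> space M. R1 < norm (X n \<omega>)}"
        by (intro M.finite_measure_mono) (auto simp: R_def)
      then have "(2 * C + d) * measure M {\<omega> \<in> space M. R < norm (X n \<omega>)} \<le> e / 8"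
        using elim by (intro dp) auto
      finally have "\<bar>(LINT \<omega>|M. f (X n \<omega>)) - (LINT \<omega>|M. q (X n \<omega>))\<bar> \<le> e / 4" using d by simp
      with fN elim \<open>0 < e\<close> show ?case
        unfolding dist_real_def real_norm_def by linarith
    qed
    then show "\<exists>no. \<forall>n\<ge>no. norm ((LINT \<omega>|M. f (X n \<omega>)) - (LINT x|N. f x)) < e"
      by (simp add: eventually_sequentially)
  qed
qed

section \<open>Bounds with high probability and Slutsky's theorem\<close>

text \<open>
  With probability tending to one. Containment of the exceptional events in measurable ones spares a proof of
  measurability for events such as a zero of the score at the estimator.
\<close>
definition whp :: "'w measure \<Rightarrow> (nat \<Rightarrow> 'w \<Rightarrow> bool) \<Rightarrow> bool" where
  "whp M P \<longleftrightarrow> (\<exists>A. (\<forall>n. A n \<in> sets M) \<and> (\<lambda>n. measure M (A n)) \<longlonglongrightarrow> 0 \<and>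
     (\<forall>n. \<forall>\<omega>\<in>space M - A n. P n \<omega>))"

lemma whpI:
  assumes "\<And>n. A n \<in> sets M" "(\<lambda>n. measure M (A n)) \<longlonglongrightarrow> 0"
    "\<And>n \<omega>. \<omega> \<in> space M \<Longrightarrow> \<omega> \<notin> A n \<Longrightarrow> P n \<omega>"
  shows "whp M P"
  unfolding whp_def using assms by (intro exI[of _ A]) auto

lemma whp_mono:
  assumes "whp M P" "\<And>n \<omega>. \<omega> \<in> space M \<Longrightarrow> P n \<omega> \<Longrightarrow> Q n \<omega>"
  shows "whp M Q"
  using assms unfolding whp_def by (metis DiffD1)

context prob_space
begin

lemma whp_conj:
  assumes "whp M P" "whp M Q"
  shows "whp M (\<lambda>n \<omega>. P n \<omega> \<and> Q n \<omega>)"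
proof -
  obtain A where A [measurable]: "\<And>n. A n \<in> sets M" and A': "(\<lambda>n. prob (A n)) \<longlonglongrightarrow> 0"
      "\<And>n \<omega>. \<omega> \<in> space M - A n \<Longrightarrow> P n \<omega>"
    using assms(1) unfolding whp_def by metis
  obtain B where B [measurable]: "\<And>n. B n \<in> sets M" and B': "(\<lambda>n. prob (B n)) \<longlonglongrightarrow> 0"
      "\<And>n \<omega>. \<omega> \<in> space M - B n \<Longrightarrow> Q n \<omega>"
    using assms(2) unfolding whp_def by metis
  show ?thesis
  proof (rule whpI[of "\<lambda>n. A n \<union> B n"])
    have "(\<lambda>n. prob (A n) + prob (B n)) \<longlonglongrightarrow> 0"
      using tendsto_add[OF A'(1) B'(1)] by simp
    then show "(\<lambda>n. prob (A n \<union> B n)) \<longlonglongrightarrow> 0"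
      by (rule tendsto_sandwich[of "\<lambda>_. 0", rotated 3]) (auto intro!: always_eventually measure_Un_le)
  qed (use A' B' in auto)
qed

lemma whp_ball_finite:
  assumes "finite I" "\<And>i. i \<in> I \<Longrightarrow> whp M (P i)"
  shows "whp M (\<lambda>n \<omega>. \<forall>i\<in>I. P i n \<omega>)"
  using assms
proof (induction I)
  case empty
  show ?case by (rule whpI[of "\<lambda>_. {}"]) auto
next
  case (insert i I)
  then have "whp M (\<lambda>n \<omega>. P i n \<omega> \<and> (\<forall>i\<in>I. P i n \<omega>))" by (intro whp_conj) auto
  then show ?case by (rule whp_mono) auto
qed

lemma whp_eventually:
  assumes "\<forall>\<^sub>F n in sequentially. \<forall>\<omega>\<in>space M. P n \<omega>"
  shows "whp M P"
proof (rule whpI[of "\<lambda>n. if \<forall>\<omega>\<in>space M. P n \<omega> then {} else space M"])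
  show "(\<lambda>n. prob (if \<forall>\<omega>\<in>space M. P n \<omega> then {} else space M)) \<longlonglongrightarrow> 0"
    by (rule tendsto_eventually) (rule eventually_mono[OF assms], simp)
qed (auto split: if_splits)

text \<open>
  The measure of a non-measurable set is 0, hence the events of the hypothesis are measurable for all but finitely
  many \<open>n\<close>; for the others the whole space serves as the exceptional event.
\<close>
lemma whp_of_prob_tendsto_1:
  assumes "(\<lambda>n. prob {\<omega> \<in> space M. P n \<omega>}) \<longlonglongrightarrow> 1"
  shows "whp M P"
proof -
  let ?G = "\<lambda>n. {\<omega> \<in> space M. P n \<omega>}"
  let ?A = "\<lambda>n. if ?G n \<in> sets M then space M - ?G n else space M"
  show ?thesis
  proof (rule whpI[of ?A])
    have "prob (?A n) = 1 - prob (?G n)" for n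
      using prob_compl[of "?G n"] by (auto simp: measure_notin_sets prob_space)
    moreover have "(\<lambda>n. 1 - prob (?G n)) \<longlonglongrightarrow> 1 - 1"
      by (intro tendsto_intros assms)
    ultimately show "(\<lambda>n. prob (?A n)) \<longlonglongrightarrow> 0" by simp
  qed (auto split: if_splits)
qed

lemma iexp_lipschitz: "cmod (iexp s - iexp t) \<le> \<bar>s - t\<bar>"
proof -
  have "iexp s - iexp t = iexp t * (iexp (s - t) - 1)"
    by (simp add: ring_distribs flip: exp_add)
  then have "cmod (iexp s - iexp t) = cmod (iexp (s - t) - 1)"
    by (simp add: norm_mult)
  also have "\<dots> \<le> \<bar>s - t\<bar>"
    using iexp_approx1[of "s - t" 0] by simp
  finally show ?thesis .
qed

text \<open>
  Characters are Lipschitz, so a perturbation that vanishes in probability does not change the limit of the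
  characteristic functions.
\<close>
lemma slutsky_char:
  fixes X Z :: "nat \<Rightarrow> 'a \<Rightarrow> 'b::euclidean_space"
  assumes X [measurable]: "\<And>n. X n \<in> borel_measurable M" and Z [measurable]: "\<And>n. Z n \<in> borel_measurable M"
    and conv: "(\<lambda>n. CLINT \<omega>|M. iexp (a \<bullet> X n \<omega>)) \<longlonglongrightarrow> L"
    and near: "whp M (\<lambda>n \<omega>. norm (Z n \<omega> - X n \<omega>) \<le> e n)" and e: "e \<longlonglongrightarrow> 0"
  shows "(\<lambda>n. CLINT \<omega>|M. iexp (a \<bullet> Z n \<omega>)) \<longlonglongrightarrow> L"
proof -
  obtain A where A [measurable]: "\<And>n. A n \<in> sets M" and A': "(\<lambda>n. prob (A n)) \<longlonglongrightarrow> 0"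
      "\<And>n \<omega>. \<omega> \<in> space M - A n \<Longrightarrow> norm (Z n \<omega> - X n \<omega>) \<le> e n"
    using near unfolding whp_def by metis
  have int: "integrable M (\<lambda>\<omega>. iexp (a \<bullet> X n \<omega>))" "integrable M (\<lambda>\<omega>. iexp (a \<bullet> Z n \<omega>))" for n
    by (rule integrable_const_bound[where B=1]; auto)+
  have bound: "cmod ((CLINT \<omega>|M. iexp (a \<bullet> Z n \<omega>)) - (CLINT \<omega>|M. iexp (a \<bullet> X n \<omega>)))
     \<le> norm a * \<bar>e n\<bar> + 2 * prob (A n)" for n
  proof -
    have "cmod ((CLINT \<omega>|M. iexp (a \<bullet> Z n \<omega>)) - (CLINT \<omega>|M. iexp (a \<bullet> X n \<omega>)))
       = cmod (CLINT \<omega>|M. iexp (a \<bullet> Z n \<omega>) - iexp (a \<bullet> X n \<omega>))"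
      using int by simp
    also have "\<dots> \<le> (LINT \<omega>|M. cmod (iexp (a \<bullet> Z n \<omega>) - iexp (a \<bullet> X n \<omega>)))"
      by (rule integral_norm_bound)
    also have "\<dots> \<le> (LINT \<omega>|M. norm a * \<bar>e n\<bar> + 2 * indicator (A n) \<omega>)"
    proof (rule integral_mono)
      show "integrable M (\<lambda>\<omega>. cmod (iexp (a \<bullet> Z n \<omega>) - iexp (a \<bullet> X n \<omega>)))"
        using int by simp
      fix \<omega> assume \<omega>: "\<omega> \<in> space M"
      show "cmod (iexp (a \<bullet> Z n \<omega>) - iexp (a \<bullet> X n \<omega>)) \<le> norm a * \<bar>e n\<bar> + 2 * indicator (A n) \<omega>"
      proof (cases "\<omega> \<in> A n")
        case True
        have "cmod (iexp (a \<bullet> Z n \<omega>) - iexp (a \<bullet> X n \<omega>)) \<le> 2"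
          using norm_triangle_ineq4[of "iexp (a \<bullet> Z n \<omega>)" "iexp (a \<bullet> X n \<omega>)"] by simp
        moreover have "0 \<le> norm a * \<bar>e n\<bar>" by simp
        ultimately show ?thesis using True by (simp del: mult_nonneg_nonneg)
      next
        case False
        have "cmod (iexp (a \<bullet> Z n \<omega>) - iexp (a \<bullet> X n \<omega>)) \<le> \<bar>a \<bullet> (Z n \<omega> - X n \<omega>)\<bar>"
          using iexp_lipschitz by (simp add: inner_diff_right)
        also have "\<dots> \<le> norm a * norm (Z n \<omega> - X n \<omega>)" by (rule Cauchy_Schwarz_ineq2)
        also have "\<dots> \<le> norm a * \<bar>e n\<bar>"
          using A'(2)[of \<omega> n] False \<omega> by (intro mult_left_mono) auto
        finally show ?thesis using False by simp
      qed
    qed (use A in \<open>auto intro!: Bochner_Integration.integrable_add integrable_mult_right integrable_real_indicator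
          simp: less_top[symmetric]\<close>)
    also have "\<dots> = norm a * \<bar>e n\<bar> + 2 * prob (A n)"
      using A by (subst Bochner_Integration.integral_add) (auto simp: prob_space less_top[symmetric])
    finally show ?thesis .
  qed
  have "(\<lambda>n. norm a * \<bar>e n\<bar> + 2 * prob (A n)) \<longlonglongrightarrow> norm a * \<bar>0\<bar> + 2 * 0"
    by (intro tendsto_intros e A')
  then have lim: "(\<lambda>n. norm a * \<bar>e n\<bar> + 2 * prob (A n)) \<longlonglongrightarrow> 0" by simp
  have "(\<lambda>n. (CLINT \<omega>|M. iexp (a \<bullet> Z n \<omega>)) - (CLINT \<omega>|M. iexp (a \<bullet> X n \<omega>))) \<longlonglongrightarrow> 0"
    by (rule Lim_null_comparison[OF _ lim]) (rule always_eventually, rule allI, rule bound)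
  from tendsto_add[OF this conv] show ?thesis by (simp only: diff_add_cancel add_0_left)
qed

end

section \<open>Multivariate normal laws\<close>

lemma quadratic_form_sum: "x \<bullet> (A *v x) = (\<Sum>i\<in>UNIV. \<Sum>j\<in>UNIV. x $ i * A $ i $ j * x $ j)"
  for A :: "real^'n^'n"
  by (simp add: inner_vec_def matrix_vector_mult_def sum_distrib_left mult.assoc)

text \<open>
  Cholesky decomposition by induction on the set \<open>I\<close> of rows and columns that may be nonzero. If the pivot
  \<open>A\<^sub>p\<^sub>p\<close> is positive, subtracting the rank-one matrix \<open>A e\<^sub>p (A e\<^sub>p)\<^sup>T / A\<^sub>p\<^sub>p\<close> clears row and column \<open>p\<close> and keeps
  the form nonnegative, since the new form at \<open>x\<close> is the old one at its minimum over the line \<open>x + t e\<^sub>p\<close>. If the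
  pivot is 0, nonnegativity along that line forces the whole row to be 0.
\<close>
lemma psd_sum_of_rank_one_aux:
  fixes A :: "real^'n^'n"
  assumes "finite I" "transpose A = A" "\<And>x. 0 \<le> x \<bullet> (A *v x)"
    and "\<And>i j. A $ i $ j \<noteq> 0 \<Longrightarrow> i \<in> I \<and> j \<in> I"
  shows "\<exists>w. \<forall>i j. A $ i $ j = (\<Sum>k\<in>I. w k $ i * w k $ j :: real)"
  using assms
proof (induction I arbitrary: A)
  case empty
  then show ?case by auto
next
  case (insert p I)
  have sym: "A $ i $ j = A $ j $ i" for i j
    using insert.prems(1) by (metis transpose_def vec_lambda_beta)
  have form: "x \<bullet> (A *v axis p 1) = (\<Sum>i\<in>UNIV. x $ i * A $ i $ p)" for x
    by (simp add: matrix_vector_mult_basis column_def inner_vec_def)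
  have App: "axis p 1 \<bullet> (A *v axis p 1) = A $ p $ p"
    by (simp add: matrix_vector_mult_basis column_def inner_axis')
  have quad: "(x + t *\<^sub>R axis p 1) \<bullet> (A *v (x + t *\<^sub>R axis p 1))
      = x \<bullet> (A *v x) + 2 * t * (x \<bullet> (A *v axis p 1)) + t\<^sup>2 * A $ p $ p" for x t
  proof -
    have "axis p 1 \<bullet> (A *v x) = x \<bullet> (A *v axis p 1)"
      by (metis dot_lmul_matrix inner_commute insert.prems(1) vector_transpose_matrix)
    then show ?thesis
      by (simp add: matrix_vector_right_distrib matrix_vector_mult_scaleR inner_add_left inner_add_right
          App algebra_simps power2_eq_square)
  qed
  have App0: "0 \<le> A $ p $ p" using insert.prems(2)[of "axis p 1"] App by simp
  show ?case
  proof (cases "A $ p $ p = 0")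
    case True
    have "A $ i $ p = 0" for i
    proof -
      define y where "y = A $ i $ p"
      define q where "q = axis i 1 \<bullet> (A *v axis i (1::real))"
      have "axis i 1 \<bullet> (A *v axis p 1) = y"
        by (simp add: matrix_vector_mult_basis column_def inner_axis' y_def)
      then have "0 \<le> q + 2 * t * y" for t
        using quad[of "axis i 1" t] insert.prems(2)[of "axis i 1 + t *\<^sub>R axis p 1"] True
        by (simp add: q_def)
      \<comment> \<open>At this argument the affine function would take the value \<open>- 1\<close> if \<open>y\<close> were nonzero.\<close>
      from this[of "- (q + 1) / (2 * y)"] show ?thesis
        unfolding y_def[symmetric] by (cases "y = 0") (auto simp: field_simps)
    qed
    then have "A $ i $ j \<noteq> 0 \<Longrightarrow> i \<in> I \<and> j \<in> I" for i j
      using insert.prems(3)[of i j] sym by (metis insertE)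
    then obtain w where w: "\<And>i j. A $ i $ j = (\<Sum>k\<in>I. w k $ i * w k $ j)"
      using insert.IH[OF insert.prems(1,2)] by metis
    have "A $ i $ j = (\<Sum>k\<in>insert p I. (w(p := 0)) k $ i * (w(p := 0)) k $ j)" for i j
      using insert.hyps w[of i j] by (auto intro!: sum.cong)
    then show ?thesis by blast
  next
    case False
    then have pos: "0 < A $ p $ p" using App0 by simp
    define c where "c = (\<chi> i. A $ i $ p / sqrt (A $ p $ p))"
    define B where "B = (\<chi> i j. A $ i $ j - c $ i * c $ j)"
    have cc: "c $ i * c $ j = A $ i $ p * A $ j $ p / A $ p $ p" for i j
      using pos by (simp add: c_def)
    have "transpose B = B"
      by (simp add: B_def transpose_def vec_eq_iff sym mult.commute)
    moreover have "0 \<le> x \<bullet> (B *v x)" for x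
    proof -
      define y where "y = x \<bullet> (A *v axis p 1)"
      have "x \<bullet> (B *v x) = x \<bullet> (A *v x) - (x \<bullet> c)\<^sup>2"
      proof -
        have "(x \<bullet> c)\<^sup>2 = (\<Sum>i\<in>UNIV. \<Sum>j\<in>UNIV. x $ i * (c $ i * c $ j) * x $ j)"
          by (simp add: inner_vec_def power2_eq_square sum_product mult_ac)
        then show ?thesis
          unfolding quadratic_form_sum
          by (simp add: B_def sum_subtractf left_diff_distrib right_diff_distrib)
      qed
      also have "x \<bullet> c = y / sqrt (A $ p $ p)"
        unfolding y_def form c_def by (simp add: inner_vec_def sum_divide_distrib)
      also have "x \<bullet> (A *v x) - (y / sqrt (A $ p $ p))\<^sup>2 =
          (x + (- y / A $ p $ p) *\<^sub>R axis p 1) \<bullet> (A *v (x + (- y / A $ p $ p) *\<^sub>R axis p 1))"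
        using pos unfolding quad y_def[symmetric] by (simp add: power_divide power2_eq_square field_simps)
      finally show ?thesis using insert.prems(2) by simp
    qed
    moreover have "i \<in> I \<and> j \<in> I" if "B $ i $ j \<noteq> 0" for i j
    proof -
      have "B $ p $ j = 0" "B $ i $ p = 0"
        using pos sym[of p j] by (simp_all add: B_def cc)
      with that have "i \<noteq> p" "j \<noteq> p" by auto
      moreover have "A $ i $ j \<noteq> 0 \<or> A $ i $ p * A $ j $ p \<noteq> 0"
        using that by (auto simp: B_def cc)
      ultimately show ?thesis using insert.prems(3)[of i j] insert.prems(3)[of i p] insert.prems(3)[of j p] by auto
    qed
    ultimately have "\<exists>w. \<forall>i j. B $ i $ j = (\<Sum>k\<in>I. w k $ i * w k $ j)"
      by (rule insert.IH)
    then obtain w where w: "\<And>i j. B $ i $ j = (\<Sum>k\<in>I. w k $ i * w k $ j)" by blast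
    have "A $ i $ j = (\<Sum>k\<in>insert p I. (w(p := c)) k $ i * (w(p := c)) k $ j)" for i j
    proof -
      have "(\<Sum>k\<in>I. (w(p := c)) k $ i * (w(p := c)) k $ j) = (\<Sum>k\<in>I. w k $ i * w k $ j)"
        using insert.hyps by (intro sum.cong) auto
      then show ?thesis
        using insert.hyps w[of i j] by (simp add: B_def)
    qed
    then show ?thesis by blast
  qed
qed

lemma psd_sum_of_rank_one:
  fixes A :: "real^'n^'n"
  assumes "transpose A = A" "\<And>x. 0 \<le> x \<bullet> (A *v x)"
  obtains w :: "'n \<Rightarrow> real^'n" where "\<And>x. x \<bullet> (A *v x) = (\<Sum>k\<in>UNIV. (x \<bullet> w k)\<^sup>2)"
proof -
  obtain w :: "'n \<Rightarrow> real^'n" where w: "\<And>i j. A $ i $ j = (\<Sum>k\<in>UNIV. w k $ i * w k $ j)"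
    using psd_sum_of_rank_one_aux[of UNIV A] assms by auto
  have "x \<bullet> (A *v x) = (\<Sum>k\<in>UNIV. (x \<bullet> w k)\<^sup>2)" for x
  proof -
    have "x \<bullet> (A *v x) = (\<Sum>i\<in>UNIV. \<Sum>j\<in>UNIV. \<Sum>k\<in>UNIV. (x $ i * w k $ i) * (x $ j * w k $ j))"
      by (simp add: quadratic_form_sum w sum_distrib_left sum_distrib_right mult_ac)
    also have "\<dots> = (\<Sum>i\<in>UNIV. \<Sum>k\<in>UNIV. \<Sum>j\<in>UNIV. (x $ i * w k $ i) * (x $ j * w k $ j))"
      by (intro sum.cong refl sum.swap)
    also have "\<dots> = (\<Sum>k\<in>UNIV. \<Sum>i\<in>UNIV. \<Sum>j\<in>UNIV. (x $ i * w k $ i) * (x $ j * w k $ j))"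
      by (rule sum.swap)
    also have "\<dots> = (\<Sum>k\<in>UNIV. (x \<bullet> w k)\<^sup>2)"
      by (simp add: inner_vec_def power2_eq_square sum_product)
    finally show ?thesis .
  qed
  with that show thesis by blast
qed

lemma char_normal_density:
  assumes "0 < v"
  shows "char (density lborel (\<lambda>x. ennreal (normal_density 0 (sqrt v) x))) t = exp (- v * t\<^sup>2 / 2)"
proof -
  let ?N = "density lborel (\<lambda>x. ennreal (normal_density 0 (sqrt v) x))"
  interpret S: real_distribution std_normal_distribution by (rule real_dist_normal_dist)
  have "distributed std_normal_distribution lborel (\<lambda>x. x) std_normal_density"
    by (auto simp: distributed_def intro!: distr_id2)
  then have "distributed std_normal_distribution lborel (\<lambda>x. 0 + sqrt v * x)
     (normal_density (0 + sqrt v * 0) (\<bar>sqrt v\<bar> * 1))"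
    using assms by (intro S.normal_density_affine) auto
  then have "distr std_normal_distribution lborel (\<lambda>x. sqrt v * x) = ?N"
    using assms by (simp add: distributed_def)
  moreover have "distr std_normal_distribution lborel (\<lambda>x. sqrt v * x) =
      distr std_normal_distribution borel (\<lambda>x. sqrt v * x)"
    by (rule distr_cong) auto
  ultimately have "char ?N t = char (distr std_normal_distribution borel (\<lambda>x. sqrt v * x)) t"
    by simp
  also have "\<dots> = char std_normal_distribution (sqrt v * t)"
    by (simp add: char_def integral_distr mult_ac)
  also have "\<dots> = exp (- v * t\<^sup>2 / 2)"
    using assms by (simp add: char_std_normal_distribution power_mult_distrib)
  finally show ?thesis .
qed

lemma char_normal_law: "normal_law 0 v N \<Longrightarrow> char N t = exp (- v * t\<^sup>2 / 2)"
  by (auto simp: normal_law_def char_normal_density) (simp add: char_def integral_return)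

text \<open>
  The law of \<open>\<Sum>k. \<xi>\<^sub>k w\<^sub>k\<close> with independent standard normal \<open>\<xi>\<^sub>k\<close> and \<open>A = \<Sum>k. w\<^sub>k w\<^sub>k\<^sup>T\<close>. A projection onto
  \<open>a\<close> is a sum of independent normal variables, after dropping those with \<open>a \<bullet> w\<^sub>k = 0\<close>, which have no density.
\<close>
lemma mv_normal_law_exists:
  fixes A :: "real^'n^'n"
  assumes A: "transpose A = A" "\<And>x. 0 \<le> x \<bullet> (A *v x)"
  obtains N where "mv_normal_law 0 A N"
proof -
  obtain w :: "'n \<Rightarrow> real^'n" where w: "\<And>x. x \<bullet> (A *v x) = (\<Sum>k\<in>UNIV. (x \<bullet> w k)\<^sup>2)"
    using psd_sum_of_rank_one[OF A] by blast
  define P where "P = (\<Pi>\<^sub>M k\<in>(UNIV::'n set). std_normal_distribution)"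
  interpret S: real_distribution std_normal_distribution by (rule real_dist_normal_dist)
  interpret PP: product_prob_space "\<lambda>_. std_normal_distribution" "UNIV :: 'n set" ..
  interpret P: prob_space P unfolding P_def by (rule PP.prob_space_axioms)
  have P_meas [measurable]: "(\<lambda>\<omega>. \<omega> k) \<in> borel_measurable P" for k
    unfolding P_def using measurable_component_singleton[of k UNIV "\<lambda>_. std_normal_distribution"] by simp
  have distr_comp: "distr P borel (\<lambda>\<omega>. \<omega> k) = std_normal_distribution" for k
  proof -
    have "distr P std_normal_distribution (\<lambda>\<omega>. \<omega> k) = std_normal_distribution"
      unfolding P_def by (rule PP.PiM_component) simp
    moreover have "distr P std_normal_distribution (\<lambda>\<omega>. \<omega> k) = distr P borel (\<lambda>\<omega>. \<omega> k)"
      by (rule distr_cong) auto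
    ultimately show ?thesis by simp
  qed
  have indep: "P.indep_vars (\<lambda>_. borel) (\<lambda>k \<omega>. \<omega> k) UNIV"
  proof (subst P.indep_vars_iff_distr_eq_PiM)
    have "distr P (Pi\<^sub>M UNIV (\<lambda>_. borel)) (\<lambda>x. \<lambda>k\<in>UNIV. x k) = distr P P (\<lambda>x. x)"
      unfolding P_def by (rule distr_cong) (auto intro!: sets_PiM_cong)
    also have "\<dots> = P" by (rule distr_id)
    finally show "distr P (Pi\<^sub>M UNIV (\<lambda>_. borel)) (\<lambda>x. \<lambda>k\<in>UNIV. x k) =
        Pi\<^sub>M UNIV (\<lambda>k. distr P borel (\<lambda>\<omega>. \<omega> k))"
      by (simp only: distr_comp) (simp add: P_def)
  qed auto
  define F where "F \<omega> = (\<Sum>k\<in>UNIV. \<omega> k *\<^sub>R w k)" for \<omega> :: "'n \<Rightarrow> real"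
  have [measurable]: "F \<in> borel_measurable P" unfolding F_def by measurable
  define N where "N = distr P borel F"
  have "normal_law (a \<bullet> 0) (a \<bullet> (A *v a)) (distr N borel (\<lambda>x. a \<bullet> x))" for a
  proof -
    have *: "distr N borel (\<lambda>x. a \<bullet> x) = distr P borel (\<lambda>\<omega>. \<Sum>k\<in>UNIV. (a \<bullet> w k) * \<omega> k)"
      unfolding N_def by (subst distr_distr) (auto simp: comp_def F_def inner_sum_right mult.commute)
    define K where "K = {k. a \<bullet> w k \<noteq> 0}"
    have sumK: "(\<Sum>k\<in>UNIV. (a \<bullet> w k) * \<omega> k) = (\<Sum>k\<in>K. (a \<bullet> w k) * \<omega> k)" for \<omega>
      by (rule sum.mono_neutral_right) (auto simp: K_def)
    have qK: "a \<bullet> (A *v a) = (\<Sum>k\<in>K. (a \<bullet> w k)\<^sup>2)"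
      unfolding w by (rule sum.mono_neutral_right) (auto simp: K_def)
    show ?thesis
    proof (cases "K = {}")
      case True
      then have "distr N borel (\<lambda>x. a \<bullet> x) = return borel 0"
        unfolding * sumK by (simp add: P.distr_const)
      then show ?thesis using True by (simp add: normal_law_def qK)
    next
      case False
      have "P.indep_vars (\<lambda>_. borel) (\<lambda>k \<omega>. (a \<bullet> w k) * \<omega> k) K"
        by (rule P.indep_vars_compose2[OF P.indep_vars_subset[OF indep]]) auto
      moreover have "distributed P lborel (\<lambda>\<omega>. (a \<bullet> w k) * \<omega> k) (normal_density 0 \<bar>a \<bullet> w k\<bar>)" if "k \<in> K" for k
      proof -
        have "distr P lborel (\<lambda>\<omega>. \<omega> k) = std_normal_distribution"
          unfolding distr_comp[of k, symmetric] by (rule distr_cong) auto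
        then have "distributed P lborel (\<lambda>\<omega>. \<omega> k) std_normal_density"
          by (simp add: distributed_def)
        then have "distributed P lborel (\<lambda>\<omega>. 0 + (a \<bullet> w k) * \<omega> k)
            (normal_density (0 + (a \<bullet> w k) * 0) (\<bar>a \<bullet> w k\<bar> * 1))"
          using that by (intro P.normal_density_affine) (auto simp: K_def)
        then show ?thesis by simp
      qed
      ultimately have "distributed P lborel (\<lambda>\<omega>. \<Sum>k\<in>K. (a \<bullet> w k) * \<omega> k)
         (normal_density (\<Sum>k\<in>K. 0) (sqrt (\<Sum>k\<in>K. \<bar>a \<bullet> w k\<bar>\<^sup>2)))"
        using False by (intro P.sum_indep_normal) (auto simp: K_def)
      then have "distr P lborel (\<lambda>\<omega>. \<Sum>k\<in>K. (a \<bullet> w k) * \<omega> k) =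
          density lborel (normal_density 0 (sqrt (a \<bullet> (A *v a))))"
        by (simp add: distributed_def qK)
      moreover have "distr P lborel (\<lambda>\<omega>. \<Sum>k\<in>K. (a \<bullet> w k) * \<omega> k) = distr N borel (\<lambda>x. a \<bullet> x)"
        unfolding * sumK by (rule distr_cong) auto
      moreover have "0 < a \<bullet> (A *v a)"
        unfolding qK using False by (intro sum_pos) (auto simp: K_def)
      ultimately show ?thesis by (simp add: normal_law_def)
    qed
  qed
  then have "mv_normal_law 0 A N"
    using A by (simp add: mv_normal_law_def N_def P.prob_space_distr)
  then show thesis by (rule that)
qed

lemma iexp_integral_mv_normal_law:
  assumes "mv_normal_law 0 A N"
  shows "(CLINT x|N. iexp (a \<bullet> x)) = exp (- (a \<bullet> (A *v a)) / 2)"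
proof -
  have [measurable_cong]: "sets N = sets borel"
    using assms by (simp add: mv_normal_law_def)
  have "normal_law 0 (a \<bullet> (A *v a)) (distr N borel (\<lambda>x. a \<bullet> x))"
    using assms by (auto simp: mv_normal_law_def)
  from char_normal_law[OF this, of 1] show ?thesis
    by (simp add: char_def integral_distr)
qed

section \<open>Campbell formulas for one and two points\<close>

lemma space_config_space: "space (config_space S) = {C. set_mset C \<subseteq> S}"
  unfolding config_space_def by (rule space_measure_of) auto

lemma measurable_count:
  assumes "B \<in> sets borel"
  shows "(\<lambda>C. size (filter_mset (\<lambda>x. x \<in> B) C)) \<in> measurable (config_space S) (count_space UNIV)"
proof (subst measurable_count_space_eq2_countable, intro conjI ballI)
  fix k :: nat
  have "{C. set_mset C \<subseteq> S \<and> size (filter_mset (\<lambda>x. x \<in> B) C) = k} \<in> sets (config_space S)"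
    unfolding config_space_def using assms by (subst sets_measure_of) auto
  then show "(\<lambda>C. size (filter_mset (\<lambda>x. x \<in> B) C)) -` {k} \<inter> space (config_space S)
      \<in> sets (config_space S)"
    by (simp add: space_config_space vimage_def Int_def conj_commute)
qed auto

lemma sum_mset_indicator:
  "(\<Sum>x\<in>#C. indicator B x :: ennreal) = of_nat (size (filter_mset (\<lambda>x. x \<in> B) C))"
  by (induction C) auto

lemma incseq_sum_mset:
  fixes U :: "nat \<Rightarrow> 'a \<Rightarrow> ennreal"
  assumes "incseq U"
  shows "incseq (\<lambda>i. \<Sum>x\<in>#C. U i x)"
  using assms by (induction C) (auto simp: incseq_def le_fun_def intro!: add_mono)

lemma sum_mset_SUP:
  fixes U :: "nat \<Rightarrow> 'a \<Rightarrow> ennreal"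
  assumes "incseq U"
  shows "(\<Sum>x\<in>#C. (SUP i. U i x)) = (SUP i. \<Sum>x\<in>#C. U i x)"
proof (induction C)
  case (add y C)
  have "incseq (\<lambda>i. U i y)" using assms by (auto simp: incseq_def le_fun_def)
  then show ?case
    using add incseq_sum_mset[OF assms, of C] by (simp add: ennreal_SUP_add)
qed simp

text \<open>
  Counts are measurable by definition of the configuration space, and sums of indicators are counts.
\<close>
lemma measurable_sum_mset_nn [measurable]:
  fixes f :: "'a::euclidean_space \<Rightarrow> ennreal"
  assumes "f \<in> borel_measurable borel"
  shows "(\<lambda>C. \<Sum>x\<in>#C. f x) \<in> borel_measurable (config_space S)"
  using assms
proof (induction rule: borel_measurable_induct)
  case (cong f g)
  then have "f = g" by auto
  with cong show ?case by simp
next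
  case (set A)
  have "(\<lambda>C. of_nat (size (filter_mset (\<lambda>x. x \<in> A) C)) :: ennreal) \<in> borel_measurable (config_space S)"
    by (rule measurable_compose[OF measurable_count]) (use set in auto)
  then show ?case by (simp add: sum_mset_indicator)
next
  case (mult u c)
  then show ?case by (simp add: sum_mset_distrib_left[symmetric])
next
  case (add u v)
  then show ?case by (simp add: sum_mset.distrib)
next
  case (seq U)
  have "(\<lambda>C. \<Sum>x\<in>#C. (SUP i. U i) x) = (\<lambda>C. SUP i. \<Sum>x\<in>#C. U i x)"
    using sum_mset_SUP[OF \<open>incseq U\<close>] by (auto simp: fun_eq_iff image_comp)
  then show ?case using seq by simp
qed

lemma sum_mset_diff: "(\<Sum>x\<in>#C. f x - g x :: 'b::ab_group_add) = (\<Sum>x\<in>#C. f x) - (\<Sum>x\<in>#C. g x)"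
  by (induction C) auto

lemma sum_mset_ennreal:
  assumes "\<And>x. 0 \<le> f x"
  shows "(\<Sum>x\<in>#C. ennreal (f x)) = ennreal (\<Sum>x\<in>#C. f x)"
    and "0 \<le> (\<Sum>x\<in>#C. f x)"
proof -
  have "(\<Sum>x\<in>#C. ennreal (f x)) = ennreal (\<Sum>x\<in>#C. f x) \<and> 0 \<le> (\<Sum>x\<in>#C. f x)"
    using assms by (induction C) auto
  then show "(\<Sum>x\<in>#C. ennreal (f x)) = ennreal (\<Sum>x\<in>#C. f x)" "0 \<le> (\<Sum>x\<in>#C. f x)" by auto
qed

lemma measurable_sum_mset [measurable]:
  fixes f :: "'a::euclidean_space \<Rightarrow> real"
  assumes [measurable]: "f \<in> borel_measurable borel"
  shows "(\<lambda>C. \<Sum>x\<in>#C. f x) \<in> borel_measurable (config_space S)"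
proof -
  have "(\<Sum>x\<in>#C. f x) = enn2real (\<Sum>x\<in>#C. ennreal (max 0 (f x))) - enn2real (\<Sum>x\<in>#C. ennreal (max 0 (- f x)))" for C
    by (subst (1 2) sum_mset_ennreal)
       (auto simp: sum_mset_ennreal sum_mset_diff[symmetric] max_def
             intro!: arg_cong[where f=sum_mset] image_mset_cong)
  then show ?thesis by simp
qed

text \<open>
  Both sides are integrals of \<open>f\<close> against a fixed measure, so equality on indicators suffices. The weight \<open>G\<close>
  allows the extension to be used twice, once in each argument of a product of two sums.
\<close>
lemma sum_mset_nn_integral_extend:
  fixes f :: "'a::euclidean_space \<Rightarrow> ennreal"
  assumes Z [measurable]: "Z \<in> measurable M (config_space S)"
    and G [measurable]: "G \<in> borel_measurable M" and h [measurable]: "h \<in> borel_measurable borel"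
    and ind: "\<And>B. B \<in> sets borel \<Longrightarrow>
      (\<integral>\<^sup>+\<omega>. (\<Sum>x\<in>#Z \<omega>. indicator B x) * G \<omega> \<partial>M) = (\<integral>\<^sup>+u. indicator B u * h u \<partial>lborel)"
    and f: "f \<in> borel_measurable borel"
  shows "(\<integral>\<^sup>+\<omega>. (\<Sum>x\<in>#Z \<omega>. f x) * G \<omega> \<partial>M) = (\<integral>\<^sup>+u. f u * h u \<partial>lborel)"
  using f
proof (induction rule: borel_measurable_induct)
  case (cong f g)
  then have "f = g" by auto
  with cong show ?case by simp
next
  case (set A)
  then show ?case using ind by simp
next
  case (mult u c)
  note [measurable] = \<open>u \<in> borel_measurable borel\<close>
  show ?case
    using mult by (simp add: sum_mset_distrib_left[symmetric] mult.assoc nn_integral_cmult)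
next
  case (add u v)
  note [measurable] = \<open>u \<in> borel_measurable borel\<close> \<open>v \<in> borel_measurable borel\<close>
  show ?case
    using add by (simp add: sum_mset.distrib distrib_right nn_integral_add)
next
  case (seq U)
  note [measurable] = \<open>\<And>i. U i \<in> borel_measurable borel\<close>
  have "(\<integral>\<^sup>+\<omega>. (\<Sum>x\<in>#Z \<omega>. (SUP i. U i) x) * G \<omega> \<partial>M)
      = (\<integral>\<^sup>+\<omega>. (SUP i. (\<Sum>x\<in>#Z \<omega>. U i x) * G \<omega>) \<partial>M)"
    using sum_mset_SUP[OF \<open>incseq U\<close>] by (simp add: image_comp SUP_mult_right_ennreal)
  also have "\<dots> = (SUP i. \<integral>\<^sup>+\<omega>. (\<Sum>x\<in>#Z \<omega>. U i x) * G \<omega> \<partial>M)"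
    by (rule nn_integral_monotone_convergence_SUP)
       (use incseq_sum_mset[OF \<open>incseq U\<close>] in \<open>auto simp: incseq_def le_fun_def intro!: mult_right_mono\<close>)
  also have "\<dots> = (SUP i. \<integral>\<^sup>+u. U i u * h u \<partial>lborel)"
    using seq by simp
  also have "\<dots> = (\<integral>\<^sup>+u. (SUP i. U i u * h u) \<partial>lborel)"
    by (rule nn_integral_monotone_convergence_SUP[symmetric])
       (use \<open>incseq U\<close> in \<open>auto simp: incseq_def le_fun_def intro!: mult_right_mono\<close>)
  also have "\<dots> = (\<integral>\<^sup>+u. (SUP i. U i) u * h u \<partial>lborel)"
    by (simp add: image_comp SUP_mult_right_ennreal)
  finally show ?case .
qed

text \<open>
  The pairs of a point with itself contribute the points in \<open>A \<inter> B\<close>; all other pairs are pairs of distinct points.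
\<close>
lemma pair_sum_rectangle:
  "(\<Sum>x\<in>#C. indicator A x) * (\<Sum>y\<in>#C. indicator B y) =
     (\<Sum>x\<in>#C. indicator (A \<inter> B) x) + pair_sum C (A \<times> B)"
proof -
  have "(\<Sum>x\<in>#C. indicator A x) * (\<Sum>y\<in>#C. indicator B y) =
      (\<Sum>x\<in>#C. indicator A x * (\<Sum>y\<in>#C. indicator B y) :: ennreal)"
    by (simp add: sum_mset_distrib_right)
  also have "\<dots> = (\<Sum>x\<in>#C. indicator (A \<inter> B) x + (\<Sum>y\<in>#(C - {#x#}). indicator (A \<times> B) (x, y)))"
  proof (intro arg_cong[where f=sum_mset] image_mset_cong)
    fix x assume "x \<in># C"
    then have "(\<Sum>y\<in>#C. indicator B y :: ennreal) = indicator B x + (\<Sum>y\<in>#(C - {#x#}). indicator B y)"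
      by (metis image_mset_add_mset insert_DiffM sum_mset.add_mset)
    then show "indicator A x * (\<Sum>y\<in>#C. indicator B y :: ennreal) =
        indicator (A \<inter> B) x + (\<Sum>y\<in>#(C - {#x#}). indicator (A \<times> B) (x, y))"
      by (simp add: distrib_left sum_mset_distrib_left indicator_inter_arith indicator_times)
  qed
  finally show ?thesis by (simp add: pair_sum_def sum_mset.distrib)
qed

lemma sum_mset_indicator_restrict:
  "set_mset C \<subseteq> S \<Longrightarrow> (\<Sum>x\<in>#C. indicator B x) = (\<Sum>x\<in>#C. indicator (B \<inter> S) x :: ennreal)"
  by (intro arg_cong[where f=sum_mset] image_mset_cong) (auto simp: indicator_def)

lemma integrable_bounded_mult:
  fixes f w :: "'a \<Rightarrow> real"
  assumes w: "integrable M w" and [measurable]: "f \<in> borel_measurable M" and f: "\<And>x. \<bar>f x\<bar> \<le> B"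
  shows "integrable M (\<lambda>x. f x * w x)"
proof (rule Bochner_Integration.integrable_bound)
  have [measurable]: "w \<in> borel_measurable M" using w by simp
  show "(\<lambda>x. f x * w x) \<in> borel_measurable M" by measurable
  show "integrable M (\<lambda>x. B * w x)" using w by simp
  show "AE x in M. norm (f x * w x) \<le> norm (B * w x)"
    using f by (auto simp: abs_mult intro!: mult_right_mono always_eventually) (metis abs_ge_self order_trans)
qed

text \<open>
  The functions whose sums over a pattern have all the moments needed below.
\<close>
definition bounded_borel :: "('a::euclidean_space \<Rightarrow> real) \<Rightarrow> bool" where
  "bounded_borel f \<longleftrightarrow> f \<in> borel_measurable borel \<and> (\<exists>B. \<forall>x. \<bar>f x\<bar> \<le> B)"

lemma bounded_borel_mult: "bounded_borel f \<Longrightarrow> bounded_borel g \<Longrightarrow> bounded_borel (\<lambda>x. f x * g x)"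
  unfolding bounded_borel_def by (auto simp: abs_mult) (meson abs_ge_zero mult_mono order_trans)

lemma bounded_borel_parts:
  assumes "bounded_borel f"
  shows "bounded_borel (\<lambda>x. max 0 (f x))" "bounded_borel (\<lambda>x. max 0 (- f x))"
proof -
  obtain B where B: "\<And>x. \<bar>f x\<bar> \<le> B" using assms by (auto simp: bounded_borel_def)
  have "\<bar>max 0 (f x)\<bar> \<le> B" "\<bar>max 0 (- f x)\<bar> \<le> B" for x
    using B[of x] by auto
  then show "bounded_borel (\<lambda>x. max 0 (f x))" "bounded_borel (\<lambda>x. max 0 (- f x))"
    using assms unfolding bounded_borel_def by auto
qed

text \<open>
  A point process with finite second moment: an integrable intensity and a pair correlation function bounded by
  \<open>G\<close>.
\<close>
locale correlated_process = prob_space M for M :: "'w measure" +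
  fixes S :: "'a::euclidean_space set" and Z :: "'w \<Rightarrow> 'a multiset"
    and \<kappa> :: "'a \<Rightarrow> real" and g :: "'a \<Rightarrow> 'a \<Rightarrow> real" and G :: real
  assumes S [measurable]: "S \<in> sets borel"
    and pcf: "has_pair_correlation M S Z \<kappa> g"
    and \<kappa>_pos: "\<And>u. u \<in> S \<Longrightarrow> 0 < \<kappa> u"
    and \<kappa>_integrable: "set_integrable lborel S \<kappa>"
    and g_bounded: "\<And>u v. u \<in> S \<Longrightarrow> v \<in> S \<Longrightarrow> g u v \<le> G"
begin

definition ext_intensity :: "'a \<Rightarrow> real" where "ext_intensity u = \<kappa> u * indicator S u"

text \<open>
  The second-order product density extended by 0; it is expressed through the pair correlation so that it depends
  on the process only through \<open>\<kappa>\<close> and \<open>g\<close>.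
\<close>
definition ext_product_density :: "'a \<times> 'a \<Rightarrow> real" where
  "ext_product_density = (\<lambda>(u, v). g u v * (\<kappa> u * \<kappa> v) * indicator (S \<times> S) (u, v))"

lemma Z_measurable [measurable]: "Z \<in> measurable M (config_space S)"
  using pcf by (auto simp: has_pair_correlation_def has_intensity_def point_process_def)

lemma Z_subset: "\<omega> \<in> space M \<Longrightarrow> set_mset (Z \<omega>) \<subseteq> S"
  using measurable_space[OF Z_measurable] by (simp add: space_config_space)

lemma ext_intensity_nonneg: "0 \<le> ext_intensity u"
  using \<kappa>_pos[of u] by (auto simp: ext_intensity_def indicator_def)

lemma ext_intensity_measurable [measurable]: "ext_intensity \<in> borel_measurable borel"
  using pcf by (auto simp: has_pair_correlation_def has_intensity_def ext_intensity_def[abs_def]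
      borel_measurable_restrict_space_iff mult.commute)

lemma ext_intensity_integrable: "integrable lborel ext_intensity"
  using \<kappa>_integrable by (simp add: set_integrable_def ext_intensity_def[abs_def] mult.commute)

lemma pcf_density:
  obtains \<kappa>2 where "has_product_density M S Z \<kappa>2"
    "\<And>u v. u \<in> S \<Longrightarrow> v \<in> S \<Longrightarrow> \<kappa>2 u v = g u v * (\<kappa> u * \<kappa> v)"
proof -
  obtain \<kappa>2 where \<kappa>2: "has_product_density M S Z \<kappa>2" "\<forall>u\<in>S. \<forall>v\<in>S. g u v = \<kappa>2 u v / (\<kappa> u * \<kappa> v)"
    using pcf by (auto simp: has_pair_correlation_def)
  have "\<kappa>2 u v = g u v * (\<kappa> u * \<kappa> v)" if "u \<in> S" "v \<in> S" for u v
    using \<kappa>2(2) that \<kappa>_pos[of u] \<kappa>_pos[of v] by auto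
  with \<kappa>2(1) that show thesis by blast
qed

lemma ext_product_density_nonneg: "0 \<le> ext_product_density p"
proof -
  obtain \<kappa>2 where \<kappa>2: "has_product_density M S Z \<kappa>2"
    "\<And>u v. u \<in> S \<Longrightarrow> v \<in> S \<Longrightarrow> \<kappa>2 u v = g u v * (\<kappa> u * \<kappa> v)"
    using pcf_density by blast
  then have "0 \<le> g u v * (\<kappa> u * \<kappa> v)" if "u \<in> S" "v \<in> S" for u v
    using that unfolding has_product_density_def by metis
  then show ?thesis by (auto simp: ext_product_density_def indicator_def split: prod.split)
qed

lemma ext_product_density_measurable [measurable]: "ext_product_density \<in> borel_measurable (borel \<Otimes>\<^sub>M borel)"
proof -
  obtain \<kappa>2 where \<kappa>2: "has_product_density M S Z \<kappa>2"
    "\<And>u v. u \<in> S \<Longrightarrow> v \<in> S \<Longrightarrow> \<kappa>2 u v = g u v * (\<kappa> u * \<kappa> v)"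
    using pcf_density by blast
  have "S \<times> S \<in> sets (borel :: ('a \<times> 'a) measure)"
    unfolding borel_prod[symmetric] by measurable
  then have "(\<lambda>p. (case p of (u, v) \<Rightarrow> \<kappa>2 u v) * indicator (S \<times> S) p) \<in> borel_measurable borel"
    using \<kappa>2(1) by (auto simp: has_product_density_def borel_measurable_restrict_space_iff mult.commute)
  also have "(\<lambda>p. (case p of (u, v) \<Rightarrow> \<kappa>2 u v) * indicator (S \<times> S) p) = ext_product_density"
    using \<kappa>2(2) by (auto simp: ext_product_density_def fun_eq_iff indicator_def)
  finally show ?thesis by (simp add: borel_prod)
qed

lemma ext_intensity_prod_integrable: "integrable (lborel \<Otimes>\<^sub>M lborel) (\<lambda>p. ext_intensity (fst p) * ext_intensity (snd p))"
proof -
  show ?thesis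
  proof (rule lborel_pair.Fubini_integrable)
    show "AE x in lborel. integrable lborel (\<lambda>y. ext_intensity (fst (x, y)) * ext_intensity (snd (x, y)))"
      using ext_intensity_integrable by simp
    show "integrable lborel (\<lambda>x. LINT y|lborel. norm (ext_intensity (fst (x, y)) * ext_intensity (snd (x, y))))"
      using ext_intensity_integrable ext_intensity_nonneg by (simp add: abs_mult)
  qed simp
qed

lemma ext_product_density_integrable: "integrable (lborel \<Otimes>\<^sub>M lborel) ext_product_density"
proof (rule Bochner_Integration.integrable_bound)
  show "integrable (lborel \<Otimes>\<^sub>M lborel) (\<lambda>p. G * (ext_intensity (fst p) * ext_intensity (snd p)))"
    using ext_intensity_prod_integrable by simp
  have "ext_product_density p \<le> G * (ext_intensity (fst p) * ext_intensity (snd p))" for p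
    using g_bounded \<kappa>_pos by (auto simp: ext_product_density_def ext_intensity_def indicator_def intro!: mult_right_mono mult_nonneg_nonneg less_imp_le
        split: prod.split)
  then have "norm (ext_product_density p) \<le> norm (G * (ext_intensity (fst p) * ext_intensity (snd p)))" for p
    using ext_product_density_nonneg[of p] by (metis abs_ge_self abs_of_nonneg order_trans real_norm_def)
  then show "AE p in lborel \<Otimes>\<^sub>M lborel. norm (ext_product_density p) \<le> norm (G * (ext_intensity (fst p) * ext_intensity (snd p)))"
    by simp
qed simp

lemma campbell_nn:
  fixes f :: "'a \<Rightarrow> ennreal"
  assumes "f \<in> borel_measurable borel"
  shows "(\<integral>\<^sup>+\<omega>. (\<Sum>x\<in>#Z \<omega>. f x) \<partial>M) = (\<integral>\<^sup>+u. f u * ennreal (ext_intensity u) \<partial>lborel)"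
proof -
  have "(\<integral>\<^sup>+\<omega>. (\<Sum>x\<in>#Z \<omega>. f x) * 1 \<partial>M) = (\<integral>\<^sup>+u. f u * ennreal (ext_intensity u) \<partial>lborel)"
  proof (rule sum_mset_nn_integral_extend[OF Z_measurable])
    fix B :: "'a set" assume [measurable]: "B \<in> sets borel"
    have "(\<integral>\<^sup>+\<omega>. (\<Sum>x\<in>#Z \<omega>. indicator B x) * 1 \<partial>M) = (\<integral>\<^sup>+\<omega>. (\<Sum>x\<in>#Z \<omega>. indicator (B \<inter> S) x) \<partial>M)"
      using Z_subset by (intro nn_integral_cong) (simp add: sum_mset_indicator_restrict[of _ S B])
    also have "\<dots> = (\<integral>\<^sup>+u\<in>B \<inter> S. ennreal (\<kappa> u) \<partial>lborel)"
      using pcf by (auto simp: has_pair_correlation_def has_intensity_def)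
    also have "\<dots> = (\<integral>\<^sup>+u. indicator B u * ennreal (ext_intensity u) \<partial>lborel)"
      by (intro nn_integral_cong) (auto simp: ext_intensity_def indicator_def)
    finally show "(\<integral>\<^sup>+\<omega>. (\<Sum>x\<in>#Z \<omega>. indicator B x) * 1 \<partial>M) = (\<integral>\<^sup>+u. indicator B u * ennreal (ext_intensity u) \<partial>lborel)" .
  qed (use assms in auto)
  then show ?thesis by simp
qed

lemma campbell_rectangle:
  assumes [measurable]: "A \<in> sets borel" "B \<in> sets borel"
  shows "(\<integral>\<^sup>+\<omega>. (\<Sum>x\<in>#Z \<omega>. indicator A x) * (\<Sum>x\<in>#Z \<omega>. indicator B x) \<partial>M) =
    (\<integral>\<^sup>+u. indicator A u * (indicator B u * ennreal (ext_intensity u) + (\<integral>\<^sup>+v. indicator B v * ennreal (ext_product_density (u, v)) \<partial>lborel)) \<partial>lborel)"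
proof -
  obtain \<kappa>2 where \<kappa>2: "has_product_density M S Z \<kappa>2"
    "\<And>u v. u \<in> S \<Longrightarrow> v \<in> S \<Longrightarrow> \<kappa>2 u v = g u v * (\<kappa> u * \<kappa> v)"
    using pcf_density by blast
  have rest: "pair_sum C (A \<times> B) = pair_sum C ((A \<inter> S) \<times> (B \<inter> S))" if "set_mset C \<subseteq> S" for C
    unfolding pair_sum_def using that
    by (intro arg_cong[where f=sum_mset] image_mset_cong) (auto simp: indicator_def dest: in_diffD)
  have "pair_sum C (A \<times> B) =
      (\<Sum>x\<in>#C. indicator A x) * (\<Sum>x\<in>#C. indicator B x) - (\<Sum>x\<in>#C. indicator (A \<inter> B) x)" for C
    unfolding pair_sum_rectangle by (simp add: sum_mset_indicator)
  then have [measurable]: "(\<lambda>\<omega>. pair_sum (Z \<omega>) (A \<times> B)) \<in> borel_measurable M" by simp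
  have "(\<integral>\<^sup>+\<omega>. pair_sum (Z \<omega>) (A \<times> B) \<partial>M) = (\<integral>\<^sup>+\<omega>. pair_sum (Z \<omega>) ((A \<inter> S) \<times> (B \<inter> S)) \<partial>M)"
    using Z_subset rest by (intro nn_integral_cong) simp
  also have "\<dots> = (\<integral>\<^sup>+u\<in>A \<inter> S. (\<integral>\<^sup>+v\<in>B \<inter> S. ennreal (\<kappa>2 u v) \<partial>lborel) \<partial>lborel)"
    using \<kappa>2(1) by (auto simp: has_product_density_def)
  also have "\<dots> = (\<integral>\<^sup>+u. indicator A u * (\<integral>\<^sup>+v. indicator B v * ennreal (ext_product_density (u, v)) \<partial>lborel) \<partial>lborel)"
  proof (intro nn_integral_cong)
    fix u
    have "(\<integral>\<^sup>+v\<in>B \<inter> S. ennreal (\<kappa>2 u v) \<partial>lborel) = (\<integral>\<^sup>+v. indicator B v * ennreal (ext_product_density (u, v)) \<partial>lborel)" if "u \<in> S"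
      using that \<kappa>2(2) by (intro nn_integral_cong) (auto simp: ext_product_density_def indicator_def)
    moreover have "ext_product_density (u, v) = 0" if "u \<notin> S" for v using that by (simp add: ext_product_density_def)
    ultimately show "(\<integral>\<^sup>+v\<in>B \<inter> S. ennreal (\<kappa>2 u v) \<partial>lborel) * indicator (A \<inter> S) u =
        indicator A u * (\<integral>\<^sup>+v. indicator B v * ennreal (ext_product_density (u, v)) \<partial>lborel)"
      by (cases "u \<in> S") (auto simp: indicator_def)
  qed
  finally have pair: "(\<integral>\<^sup>+\<omega>. pair_sum (Z \<omega>) (A \<times> B) \<partial>M) =
    (\<integral>\<^sup>+u. indicator A u * (\<integral>\<^sup>+v. indicator B v * ennreal (ext_product_density (u, v)) \<partial>lborel) \<partial>lborel)" .
  have "(\<integral>\<^sup>+\<omega>. (\<Sum>x\<in>#Z \<omega>. indicator A x) * (\<Sum>x\<in>#Z \<omega>. indicator B x) \<partial>M) =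
      (\<integral>\<^sup>+\<omega>. (\<Sum>x\<in>#Z \<omega>. indicator (A \<inter> B) x) \<partial>M) + (\<integral>\<^sup>+\<omega>. pair_sum (Z \<omega>) (A \<times> B) \<partial>M)"
    unfolding pair_sum_rectangle by (rule nn_integral_add) simp_all
  also have "\<dots> = (\<integral>\<^sup>+u. indicator (A \<inter> B) u * ennreal (ext_intensity u) +
     indicator A u * (\<integral>\<^sup>+v. indicator B v * ennreal (ext_product_density (u, v)) \<partial>lborel) \<partial>lborel)"
    unfolding pair by (simp add: campbell_nn nn_integral_add)
  also have "\<dots> = (\<integral>\<^sup>+u. indicator A u * (indicator B u * ennreal (ext_intensity u) + (\<integral>\<^sup>+v. indicator B v * ennreal (ext_product_density (u, v)) \<partial>lborel)) \<partial>lborel)"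
    by (intro nn_integral_cong) (auto simp: indicator_def)
  finally show ?thesis .
qed

text \<open>
  Extend the formula for two indicators first in one function, then, after exchanging the order of integration, in
  the other.
\<close>
lemma campbell_pair_nn:
  fixes f f' :: "'a \<Rightarrow> ennreal"
  assumes [measurable]: "f \<in> borel_measurable borel" "f' \<in> borel_measurable borel"
  shows "(\<integral>\<^sup>+\<omega>. (\<Sum>x\<in>#Z \<omega>. f x) * (\<Sum>x\<in>#Z \<omega>. f' x) \<partial>M) =
    (\<integral>\<^sup>+u. f u * f' u * ennreal (ext_intensity u) \<partial>lborel) +
    (\<integral>\<^sup>+p. f (fst p) * f' (snd p) * ennreal (ext_product_density p) \<partial>(lborel \<Otimes>\<^sub>M lborel))"
proof -
  have half: "(\<integral>\<^sup>+\<omega>. (\<Sum>x\<in>#Z \<omega>. f x) * (\<Sum>x\<in>#Z \<omega>. indicator B x) \<partial>M) =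
    (\<integral>\<^sup>+u. f u * (indicator B u * ennreal (ext_intensity u) + (\<integral>\<^sup>+v. indicator B v * ennreal (ext_product_density (u, v)) \<partial>lborel)) \<partial>lborel)"
    if [measurable]: "B \<in> sets borel" for B
    by (rule sum_mset_nn_integral_extend[OF Z_measurable]) (auto simp: campbell_rectangle)
  have "(\<integral>\<^sup>+\<omega>. (\<Sum>x\<in>#Z \<omega>. f' x) * (\<Sum>x\<in>#Z \<omega>. f x) \<partial>M) =
    (\<integral>\<^sup>+v. f' v * (f v * ennreal (ext_intensity v) + (\<integral>\<^sup>+u. f u * ennreal (ext_product_density (u, v)) \<partial>lborel)) \<partial>lborel)"
  proof (rule sum_mset_nn_integral_extend[OF Z_measurable])
    fix B :: "'a set" assume [measurable]: "B \<in> sets borel"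
    have "(\<integral>\<^sup>+u. (\<integral>\<^sup>+v. f u * indicator B v * ennreal (ext_product_density (u, v)) \<partial>lborel) \<partial>lborel) =
       (\<integral>\<^sup>+v. (\<integral>\<^sup>+u. f u * indicator B v * ennreal (ext_product_density (u, v)) \<partial>lborel) \<partial>lborel)"
      by (rule lborel_pair.Fubini'[symmetric]) simp
    then have swap: "(\<integral>\<^sup>+u. f u * (\<integral>\<^sup>+v. indicator B v * ennreal (ext_product_density (u, v)) \<partial>lborel) \<partial>lborel) =
       (\<integral>\<^sup>+v. indicator B v * (\<integral>\<^sup>+u. f u * ennreal (ext_product_density (u, v)) \<partial>lborel) \<partial>lborel)"
      by (simp add: nn_integral_cmult[symmetric] mult_ac)
    have "(\<integral>\<^sup>+\<omega>. (\<Sum>x\<in>#Z \<omega>. indicator B x) * (\<Sum>x\<in>#Z \<omega>. f x) \<partial>M) =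
      (\<integral>\<^sup>+u. f u * indicator B u * ennreal (ext_intensity u) \<partial>lborel) +
      (\<integral>\<^sup>+u. f u * (\<integral>\<^sup>+v. indicator B v * ennreal (ext_product_density (u, v)) \<partial>lborel) \<partial>lborel)"
      using half[of B] by (simp add: mult.commute[of "\<Sum>x\<in>#Z _. f x"] distrib_left nn_integral_add mult.assoc)
    also have "\<dots> = (\<integral>\<^sup>+v. indicator B v * (f v * ennreal (ext_intensity v) + (\<integral>\<^sup>+u. f u * ennreal (ext_product_density (u, v)) \<partial>lborel)) \<partial>lborel)"
      unfolding swap by (simp add: nn_integral_add[symmetric] distrib_left mult_ac)
    finally show "(\<integral>\<^sup>+\<omega>. (\<Sum>x\<in>#Z \<omega>. indicator B x) * (\<Sum>x\<in>#Z \<omega>. f x) \<partial>M) = \<dots>" .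
  qed auto
  also have "\<dots> = (\<integral>\<^sup>+u. f u * f' u * ennreal (ext_intensity u) \<partial>lborel) +
      (\<integral>\<^sup>+v. (\<integral>\<^sup>+u. f u * f' v * ennreal (ext_product_density (u, v)) \<partial>lborel) \<partial>lborel)"
    by (simp add: distrib_left nn_integral_add nn_integral_cmult[symmetric] mult_ac)
  also have "(\<integral>\<^sup>+v. (\<integral>\<^sup>+u. f u * f' v * ennreal (ext_product_density (u, v)) \<partial>lborel) \<partial>lborel) =
     (\<integral>\<^sup>+p. f (fst p) * f' (snd p) * ennreal (ext_product_density p) \<partial>(lborel \<Otimes>\<^sub>M lborel))"
    by (subst lborel_pair.nn_integral_snd[symmetric]) simp_all
  finally show ?thesis by (simp add: mult.commute)
qed

text \<open>
  The mixed second moment of the sums of \<open>f\<close> and \<open>f'\<close> over the process.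
\<close>
definition pair_moment :: "('a \<Rightarrow> real) \<Rightarrow> ('a \<Rightarrow> real) \<Rightarrow> real" where
  "pair_moment f f' = (LINT u|lborel. f u * f' u * ext_intensity u) +
     (LINT p|(lborel \<Otimes>\<^sub>M lborel). f (fst p) * f' (snd p) * ext_product_density p)"

lemma integrable_bounded_borel_intensity: "bounded_borel f \<Longrightarrow> integrable lborel (\<lambda>u. f u * ext_intensity u)"
  using integrable_bounded_mult[OF ext_intensity_integrable] by (auto simp: bounded_borel_def)

lemma integrable_bounded_borel_pair:
  assumes f: "bounded_borel f" and f': "bounded_borel f'" and q: "integrable (lborel \<Otimes>\<^sub>M lborel) q"
  shows "integrable (lborel \<Otimes>\<^sub>M lborel) (\<lambda>p. f (fst p) * f' (snd p) * q p)"
proof -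
  obtain B B' where B: "\<And>x. \<bar>f x\<bar> \<le> B" "\<And>x. \<bar>f' x\<bar> \<le> B'"
    using f f' by (auto simp: bounded_borel_def)
  have [measurable]: "f \<in> borel_measurable borel" "f' \<in> borel_measurable borel"
    using f f' by (auto simp: bounded_borel_def)
  show ?thesis
  proof (rule integrable_bounded_mult[OF q])
    show "\<bar>f (fst p) * f' (snd p)\<bar> \<le> B * B'" for p
      unfolding abs_mult using B by (intro mult_mono) (auto intro: order_trans[OF abs_ge_zero])
  qed simp
qed

lemma pair_moment_diff_left:
  assumes "bounded_borel f" "bounded_borel g'" "bounded_borel f'"
  shows "pair_moment (\<lambda>x. f x - g' x) f' = pair_moment f f' - pair_moment g' f'"
  using assms integrable_bounded_borel_intensity[OF bounded_borel_mult] integrable_bounded_borel_pair[OF _ _ ext_product_density_integrable]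
  by (simp add: pair_moment_def left_diff_distrib)

lemma pair_moment_diff_right:
  assumes "bounded_borel f" "bounded_borel g'" "bounded_borel f'"
  shows "pair_moment f' (\<lambda>x. f x - g' x) = pair_moment f' f - pair_moment f' g'"
  using assms integrable_bounded_borel_intensity[OF bounded_borel_mult] integrable_bounded_borel_pair[OF _ _ ext_product_density_integrable]
  by (simp add: pair_moment_def left_diff_distrib right_diff_distrib)

lemma campbell:
  assumes f: "bounded_borel f"
  shows "has_bochner_integral M (\<lambda>\<omega>. \<Sum>x\<in>#Z \<omega>. f x) (LINT u|lborel. f u * ext_intensity u)"
proof -
  have nn: "has_bochner_integral M (\<lambda>\<omega>. \<Sum>x\<in>#Z \<omega>. h x) (LINT u|lborel. h u * ext_intensity u)"
    if h: "bounded_borel h" "\<And>x. 0 \<le> h x" for h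
  proof (rule has_bochner_integral_nn_integral)
    have [measurable]: "h \<in> borel_measurable borel" using h by (simp add: bounded_borel_def)
    show "(\<lambda>\<omega>. \<Sum>x\<in>#Z \<omega>. h x) \<in> borel_measurable M" by measurable
    show "AE \<omega> in M. 0 \<le> (\<Sum>x\<in>#Z \<omega>. h x)" using sum_mset_ennreal(2)[of h, OF h(2)] by simp
    show "0 \<le> (LINT u|lborel. h u * ext_intensity u)" using h ext_intensity_nonneg by (intro integral_nonneg_AE) simp
    have "(\<integral>\<^sup>+\<omega>. ennreal (\<Sum>x\<in>#Z \<omega>. h x) \<partial>M) = (\<integral>\<^sup>+u. ennreal (h u) * ennreal (ext_intensity u) \<partial>lborel)"
      using h(2) by (subst campbell_nn[symmetric]) (simp_all add: sum_mset_ennreal)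
    also have "\<dots> = (\<integral>\<^sup>+u. ennreal (h u * ext_intensity u) \<partial>lborel)"
      using h(2) by (simp add: ennreal_mult' ext_intensity_nonneg)
    also have "\<dots> = ennreal (LINT u|lborel. h u * ext_intensity u)"
      using h(2) ext_intensity_nonneg by (intro nn_integral_eq_integral integrable_bounded_borel_intensity h) simp
    finally show "(\<integral>\<^sup>+\<omega>. ennreal (\<Sum>x\<in>#Z \<omega>. h x) \<partial>M) = ennreal (LINT u|lborel. h u * ext_intensity u)" .
  qed
  have split: "f x = max 0 (f x) - max 0 (- f x)" for x by simp
  have "has_bochner_integral M (\<lambda>\<omega>. (\<Sum>x\<in>#Z \<omega>. max 0 (f x)) - (\<Sum>x\<in>#Z \<omega>. max 0 (- f x)))
     ((LINT u|lborel. max 0 (f u) * ext_intensity u) - (LINT u|lborel. max 0 (- f u) * ext_intensity u))"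
    using bounded_borel_parts[OF f] by (intro has_bochner_integral_diff nn) auto
  also have "(\<lambda>\<omega>. (\<Sum>x\<in>#Z \<omega>. max 0 (f x)) - (\<Sum>x\<in>#Z \<omega>. max 0 (- f x))) = (\<lambda>\<omega>. \<Sum>x\<in>#Z \<omega>. f x)"
    unfolding sum_mset_diff[symmetric] split[symmetric] ..
  also have "(LINT u|lborel. max 0 (f u) * ext_intensity u) - (LINT u|lborel. max 0 (- f u) * ext_intensity u) = (LINT u|lborel. f u * ext_intensity u)"
    using bounded_borel_parts[OF f, THEN integrable_bounded_borel_intensity]
    by (simp flip: Bochner_Integration.integral_diff left_diff_distrib split)
  finally show ?thesis .
qed

lemma campbell_pair:
  assumes f: "bounded_borel f" and f': "bounded_borel f'"
  shows "has_bochner_integral M (\<lambda>\<omega>. (\<Sum>x\<in>#Z \<omega>. f x) * (\<Sum>x\<in>#Z \<omega>. f' x)) (pair_moment f f')"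
proof -
  have nn: "has_bochner_integral M (\<lambda>\<omega>. (\<Sum>x\<in>#Z \<omega>. h x) * (\<Sum>x\<in>#Z \<omega>. h' x)) (pair_moment h h')"
    if h: "bounded_borel h" "\<And>x. 0 \<le> h x" and h': "bounded_borel h'" "\<And>x. 0 \<le> h' x" for h h'
  proof (rule has_bochner_integral_nn_integral)
    have [measurable]: "h \<in> borel_measurable borel" "h' \<in> borel_measurable borel"
      using h h' by (simp_all add: bounded_borel_def)
    have int1: "integrable lborel (\<lambda>u. h u * h' u * ext_intensity u)"
      by (intro integrable_bounded_borel_intensity bounded_borel_mult h h')
    have int2: "integrable (lborel \<Otimes>\<^sub>M lborel) (\<lambda>p. h (fst p) * h' (snd p) * ext_product_density p)"
      by (intro integrable_bounded_borel_pair h h' ext_product_density_integrable)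
    have pos: "0 \<le> (LINT u|lborel. h u * h' u * ext_intensity u)" "0 \<le> (LINT p|(lborel \<Otimes>\<^sub>M lborel). h (fst p) * h' (snd p) * ext_product_density p)"
      using h h' ext_intensity_nonneg ext_product_density_nonneg by (auto intro!: integral_nonneg_AE)
    show "(\<lambda>\<omega>. (\<Sum>x\<in>#Z \<omega>. h x) * (\<Sum>x\<in>#Z \<omega>. h' x)) \<in> borel_measurable M" by measurable
    show "AE \<omega> in M. 0 \<le> (\<Sum>x\<in>#Z \<omega>. h x) * (\<Sum>x\<in>#Z \<omega>. h' x)"
      using sum_mset_ennreal(2)[of h, OF h(2)] sum_mset_ennreal(2)[of h', OF h'(2)] by simp
    show "0 \<le> pair_moment h h'" using pos by (simp add: pair_moment_def)
    have "(\<integral>\<^sup>+\<omega>. ennreal ((\<Sum>x\<in>#Z \<omega>. h x) * (\<Sum>x\<in>#Z \<omega>. h' x)) \<partial>M) =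
       (\<integral>\<^sup>+\<omega>. (\<Sum>x\<in>#Z \<omega>. ennreal (h x)) * (\<Sum>x\<in>#Z \<omega>. ennreal (h' x)) \<partial>M)"
      using h(2) h'(2) by (simp add: sum_mset_ennreal ennreal_mult)
    also have "\<dots> = (\<integral>\<^sup>+u. ennreal (h u) * ennreal (h' u) * ennreal (ext_intensity u) \<partial>lborel) +
        (\<integral>\<^sup>+p. ennreal (h (fst p)) * ennreal (h' (snd p)) * ennreal (ext_product_density p) \<partial>(lborel \<Otimes>\<^sub>M lborel))"
      by (rule campbell_pair_nn) simp_all
    also have "\<dots> = (\<integral>\<^sup>+u. ennreal (h u * h' u * ext_intensity u) \<partial>lborel) +
        (\<integral>\<^sup>+p. ennreal (h (fst p) * h' (snd p) * ext_product_density p) \<partial>(lborel \<Otimes>\<^sub>M lborel))"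
      using h(2) h'(2) by (simp add: ennreal_mult ext_intensity_nonneg ext_product_density_nonneg)
    also have "\<dots> = ennreal (LINT u|lborel. h u * h' u * ext_intensity u) + ennreal (LINT p|(lborel \<Otimes>\<^sub>M lborel). h (fst p) * h' (snd p) * ext_product_density p)"
      using h(2) h'(2) ext_intensity_nonneg ext_product_density_nonneg
      by (simp add: nn_integral_eq_integral[OF int1] nn_integral_eq_integral[OF int2])
    also have "\<dots> = ennreal (pair_moment h h')"
      using pos by (simp add: pair_moment_def)
    finally show "(\<integral>\<^sup>+\<omega>. ennreal ((\<Sum>x\<in>#Z \<omega>. h x) * (\<Sum>x\<in>#Z \<omega>. h' x)) \<partial>M) = ennreal (pair_moment h h')" .
  qed
  have half: "has_bochner_integral M (\<lambda>\<omega>. (\<Sum>x\<in>#Z \<omega>. f x) * (\<Sum>x\<in>#Z \<omega>. h x)) (pair_moment f h)"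
    if h: "bounded_borel h" "\<And>x. 0 \<le> h x" for h
  proof -
    have "has_bochner_integral M (\<lambda>\<omega>. (\<Sum>x\<in>#Z \<omega>. max 0 (f x)) * (\<Sum>x\<in>#Z \<omega>. h x) - (\<Sum>x\<in>#Z \<omega>. max 0 (- f x)) * (\<Sum>x\<in>#Z \<omega>. h x))
       (pair_moment (\<lambda>x. max 0 (f x)) h - pair_moment (\<lambda>x. max 0 (- f x)) h)"
      using bounded_borel_parts[OF f] h by (intro has_bochner_integral_diff nn) auto
    also have "pair_moment (\<lambda>x. max 0 (f x)) h - pair_moment (\<lambda>x. max 0 (- f x)) h = pair_moment (\<lambda>x. max 0 (f x) - max 0 (- f x)) h"
      using bounded_borel_parts[OF f] h by (intro pair_moment_diff_left[symmetric])
    also have "(\<lambda>x. max 0 (f x) - max 0 (- f x)) = f" by auto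
    also have "(\<lambda>\<omega>. (\<Sum>x\<in>#Z \<omega>. max 0 (f x)) * (\<Sum>x\<in>#Z \<omega>. h x) - (\<Sum>x\<in>#Z \<omega>. max 0 (- f x)) * (\<Sum>x\<in>#Z \<omega>. h x)) =
        (\<lambda>\<omega>. (\<Sum>x\<in>#Z \<omega>. max 0 (f x) - max 0 (- f x)) * (\<Sum>x\<in>#Z \<omega>. h x))"
      by (simp add: sum_mset_diff left_diff_distrib)
    also have "(\<lambda>x. max 0 (f x) - max 0 (- f x)) = f" by auto
    finally show ?thesis .
  qed
  have "has_bochner_integral M (\<lambda>\<omega>. (\<Sum>x\<in>#Z \<omega>. f x) * (\<Sum>x\<in>#Z \<omega>. max 0 (f' x)) - (\<Sum>x\<in>#Z \<omega>. f x) * (\<Sum>x\<in>#Z \<omega>. max 0 (- f' x)))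
     (pair_moment f (\<lambda>x. max 0 (f' x)) - pair_moment f (\<lambda>x. max 0 (- f' x)))"
    using bounded_borel_parts[OF f'] by (intro has_bochner_integral_diff half) auto
  also have "pair_moment f (\<lambda>x. max 0 (f' x)) - pair_moment f (\<lambda>x. max 0 (- f' x)) = pair_moment f (\<lambda>x. max 0 (f' x) - max 0 (- f' x))"
    using bounded_borel_parts[OF f'] f by (intro pair_moment_diff_right[symmetric])
  also have "(\<lambda>x. max 0 (f' x) - max 0 (- f' x)) = f'" by auto
  also have "(\<lambda>\<omega>. (\<Sum>x\<in>#Z \<omega>. f x) * (\<Sum>x\<in>#Z \<omega>. max 0 (f' x)) - (\<Sum>x\<in>#Z \<omega>. f x) * (\<Sum>x\<in>#Z \<omega>. max 0 (- f' x))) =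
      (\<lambda>\<omega>. (\<Sum>x\<in>#Z \<omega>. f x) * (\<Sum>x\<in>#Z \<omega>. max 0 (f' x) - max 0 (- f' x)))"
    by (simp add: sum_mset_diff right_diff_distrib)
  also have "(\<lambda>x. max 0 (f' x) - max 0 (- f' x)) = f'" by auto
  finally show ?thesis .
qed

end

section \<open>Sums of independent square integrable variables\<close>

lemma (in prob_space) char_distr:
  "U \<in> borel_measurable M \<Longrightarrow> char (distr M borel U) t = (CLINT \<omega>|M. iexp (t * U \<omega>))"
  by (simp add: char_def integral_distr)

locale iid_square_integrable = prob_space M for M :: "'w measure" +
  fixes X :: "nat \<Rightarrow> 'w \<Rightarrow> real" and \<mu> q :: real
  assumes indep: "indep_vars (\<lambda>_. borel) X UNIV"
    and distr_eq: "\<And>i. distr M borel (X i) = distr M borel (X 0)"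
    and square_integrable: "\<And>i. integrable M (\<lambda>\<omega>. (X i \<omega>)\<^sup>2)"
    and mean: "\<And>i. expectation (X i) = \<mu>"
    and second_moment: "\<And>i. expectation (\<lambda>\<omega>. (X i \<omega>)\<^sup>2) = q"
begin

lemma X_measurable [measurable]: "X i \<in> borel_measurable M"
  using indep unfolding indep_vars_def2 by simp

lemma X_integrable: "integrable M (X i)"
  by (rule square_integrable_imp_integrable[OF _ square_integrable]) simp

lemma variance_X: "variance (X i) = q - \<mu>\<^sup>2"
  using X_integrable square_integrable mean second_moment by (subst variance_eq) auto

lemma variance_nonneg: "0 \<le> q - \<mu>\<^sup>2"
  using variance_X[of 0] variance_positive[of "X 0"] by simp

text \<open>
  The cross terms vanish, because each new summand is centered and independent of the preceding partial sum.
\<close>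
lemma centered_sum_second_moment:
  "has_bochner_integral M (\<lambda>\<omega>. ((\<Sum>i<n. X i \<omega>) - real n * \<mu>)\<^sup>2) (real n * (q - \<mu>\<^sup>2))"
proof -
  define Y where "Y i \<omega> = X i \<omega> - \<mu>" for i \<omega>
  have indY: "indep_vars (\<lambda>_. borel) Y UNIV"
    unfolding Y_def using indep by (rule indep_vars_compose2) auto
  have intY: "integrable M (Y i)" for i
    unfolding Y_def using X_integrable by simp
  have EY: "expectation (Y i) = 0" for i
    unfolding Y_def using X_integrable mean by (simp add: prob_space)
  have sqY: "has_bochner_integral M (\<lambda>\<omega>. (Y i \<omega>)\<^sup>2) (q - \<mu>\<^sup>2)" for i
    unfolding has_bochner_integral_iff
  proof
    show "integrable M (\<lambda>\<omega>. (Y i \<omega>)\<^sup>2)"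
      unfolding Y_def using X_integrable[of i] square_integrable[of i] by (simp add: power2_diff)
    show "expectation (\<lambda>\<omega>. (Y i \<omega>)\<^sup>2) = q - \<mu>\<^sup>2"
      using variance_X[of i] mean by (simp add: Y_def)
  qed
  have "has_bochner_integral M (\<lambda>\<omega>. (\<Sum>i<n. Y i \<omega>)\<^sup>2) (real n * (q - \<mu>\<^sup>2))"
  proof (induction n)
    case (Suc n)
    have "indep_var borel (Y n) borel (\<lambda>\<omega>. \<Sum>i\<in>{..<n}. Y i \<omega>)"
      by (rule indep_vars_sum) (auto intro: indep_vars_subset[OF indY])
    then have "has_bochner_integral M (\<lambda>\<omega>. Y n \<omega> * (\<Sum>i<n. Y i \<omega>)) 0"
      using intY EY by (auto simp: has_bochner_integral_iff indep_var_integrable indep_var_lebesgue_integral)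
    from has_bochner_integral_mult_right[OF this, of 2]
    have "has_bochner_integral M (\<lambda>\<omega>. 2 * (Y n \<omega> * (\<Sum>i<n. Y i \<omega>))) 0" by simp
    then have "has_bochner_integral M (\<lambda>\<omega>. (\<Sum>i<n. Y i \<omega>)\<^sup>2 + (2 * (Y n \<omega> * (\<Sum>i<n. Y i \<omega>)) + (Y n \<omega>)\<^sup>2))
        (real n * (q - \<mu>\<^sup>2) + (0 + (q - \<mu>\<^sup>2)))"
      by (intro has_bochner_integral_add Suc sqY)
    then show ?case
      by (simp add: power2_sum algebra_simps)
  qed (simp add: has_bochner_integral_zero)
  then show ?thesis by (simp add: Y_def sum_subtractf)
qed

text \<open>
  Chebyshev's inequality gives \<open>n v / n\<^bsup>5/4\<^esup>\<close>. Any exponent strictly between 1/2 and 3/4 would do: above 1/2 for this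
  probability to vanish, below 3/4 for the quadratic remainder of the score equation to be negligible against
  \<open>\<surd>n\<close>.
\<close>
lemma whp_centered_sum:
  "whp M (\<lambda>n \<omega>. \<bar>(\<Sum>i<n. X i \<omega>) - real n * \<mu>\<bar> \<le> real n powr (5/8))"
proof (rule whpI[of "\<lambda>n. {\<omega> \<in> space M. real n powr (5/8) < \<bar>(\<Sum>i<n. X i \<omega>) - real n * \<mu>\<bar>}"])
  have bound: "prob {\<omega> \<in> space M. real n powr (5/8) < \<bar>(\<Sum>i<n. X i \<omega>) - real n * \<mu>\<bar>}
      \<le> (q - \<mu>\<^sup>2) * real n powr (- 1/4)" if "n > 0" for n
  proof -
    have "prob {\<omega> \<in> space M. real n powr (5/8) < \<bar>(\<Sum>i<n. X i \<omega>) - real n * \<mu>\<bar>}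
       \<le> prob {\<omega> \<in> space M. real n powr (5/8) \<le> \<bar>(\<Sum>i<n. X i \<omega>) - real n * \<mu>\<bar>}"
      by (intro finite_measure_mono) auto
    also have "\<dots> \<le> expectation (\<lambda>\<omega>. ((\<Sum>i<n. X i \<omega>) - real n * \<mu>)\<^sup>2) / (real n powr (5/8))\<^sup>2"
      using centered_sum_second_moment[of n] that
      by (intro second_moment_method) (auto simp: has_bochner_integral_iff)
    also have "\<dots> = (real n * (q - \<mu>\<^sup>2)) / (real n powr (5/8))\<^sup>2"
      using centered_sum_second_moment[of n] by (simp add: has_bochner_integral_iff)
    also have "(real n powr (5/8))\<^sup>2 = real n powr (1 + 1/4)"
      by (simp add: power2_eq_square flip: powr_add)
    also have "(real n * (q - \<mu>\<^sup>2)) / real n powr (1 + 1/4) = (q - \<mu>\<^sup>2) * real n powr (- 1/4)"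
      using that unfolding powr_add by (simp add: powr_minus_divide)
    finally show ?thesis .
  qed
  have "(\<lambda>n. real n powr (- 1/4)) \<longlonglongrightarrow> 0" by real_asymp
  then have "(\<lambda>n. (q - \<mu>\<^sup>2) * real n powr (- 1/4)) \<longlonglongrightarrow> (q - \<mu>\<^sup>2) * 0"
    by (intro tendsto_intros)
  then have lim: "(\<lambda>n. (q - \<mu>\<^sup>2) * real n powr (- 1/4)) \<longlonglongrightarrow> 0" by simp
  show "(\<lambda>n. prob {\<omega> \<in> space M. real n powr (5/8) < \<bar>(\<Sum>i<n. X i \<omega>) - real n * \<mu>\<bar>}) \<longlonglongrightarrow> 0"
    by (rule tendsto_sandwich[OF _ _ tendsto_const lim])
       (use bound in \<open>auto intro: eventually_mono[OF eventually_gt_at_top[of 0]]\<close>)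
qed auto

text \<open>
  Stated for characteristic functions in order to include the degenerate case, in which the centered sums vanish
  almost surely and the normalization by the standard deviation is not available.
\<close>
lemma clt_char:
  "(\<lambda>n. char (distr M borel (\<lambda>\<omega>. ((\<Sum>i<n. X i \<omega>) - real n * \<mu>) / sqrt (real n))) t)
     \<longlonglongrightarrow> exp (- (q - \<mu>\<^sup>2) * t\<^sup>2 / 2)"
proof (cases "q - \<mu>\<^sup>2 = 0")
  case True
  have "char (distr M borel (\<lambda>\<omega>. ((\<Sum>i<n. X i \<omega>) - real n * \<mu>) / sqrt (real n))) t = 1" for n
  proof -
    have "AE \<omega> in M. ((\<Sum>i<n. X i \<omega>) - real n * \<mu>)\<^sup>2 = 0"
      using centered_sum_second_moment[of n] True
      by (subst integral_nonneg_eq_0_iff_AE[symmetric]) (auto simp: has_bochner_integral_iff)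
    then have "(CLINT \<omega>|M. iexp (t * (((\<Sum>i<n. X i \<omega>) - real n * \<mu>) / sqrt (real n)))) = (CLINT \<omega>|M. 1)"
    proof (intro integral_cong_AE)
      assume "AE \<omega> in M. ((\<Sum>i<n. X i \<omega>) - real n * \<mu>)\<^sup>2 = 0"
      then show "AE \<omega> in M. iexp (t * (((\<Sum>i<n. X i \<omega>) - real n * \<mu>) / sqrt (real n))) = 1"
      proof eventually_elim
        case (elim \<omega>)
        then have "(\<Sum>i<n. X i \<omega>) - real n * \<mu> = 0" by simp
        then show ?case by (simp only: div_0 mult_zero_right of_real_0 exp_zero)
      qed
    qed auto
    then show ?thesis by (simp add: char_def integral_distr prob_space)
  qed
  with True show ?thesis by simp
next
  case False
  define \<sigma> where "\<sigma> = sqrt (q - \<mu>\<^sup>2)"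
  have \<sigma>: "0 < \<sigma>" "\<sigma>\<^sup>2 = q - \<mu>\<^sup>2" using False variance_nonneg by (simp_all add: \<sigma>_def)
  have meas1: "(\<lambda>\<omega>. (\<Sum>i<n. X i \<omega> - \<mu>) / sqrt (real n * \<sigma>\<^sup>2)) \<in> borel_measurable M"
    and meas2: "(\<lambda>\<omega>. ((\<Sum>i<n. X i \<omega>) - real n * \<mu>) / sqrt (real n)) \<in> borel_measurable M" for n
    by simp_all
  have "weak_conv_m (\<lambda>n. distr M borel (\<lambda>\<omega>. (\<Sum>i<n. X i \<omega> - \<mu>) / sqrt (real n * \<sigma>\<^sup>2))) std_normal_distribution"
    by (rule central_limit_theorem[OF indep mean \<sigma>(1) square_integrable, where \<mu>="distr M borel (X 0)"])
       (use variance_X \<sigma>(2) distr_eq in auto)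
  then have "(\<lambda>n. char (distr M borel (\<lambda>\<omega>. (\<Sum>i<n. X i \<omega> - \<mu>) / sqrt (real n * \<sigma>\<^sup>2))) (\<sigma> * t))
      \<longlonglongrightarrow> char std_normal_distribution (\<sigma> * t)"
    by (rule levy_continuity1[rotated 2]) (auto simp: real_dist_normal_dist)
  moreover have "char (distr M borel (\<lambda>\<omega>. (\<Sum>i<n. X i \<omega> - \<mu>) / sqrt (real n * \<sigma>\<^sup>2))) (\<sigma> * t) =
      char (distr M borel (\<lambda>\<omega>. ((\<Sum>i<n. X i \<omega>) - real n * \<mu>) / sqrt (real n))) t" for n
  proof -
    have "\<sigma> * t * ((\<Sum>i<n. X i \<omega> - \<mu>) / sqrt (real n * \<sigma>\<^sup>2)) = t * (((\<Sum>i<n. X i \<omega>) - real n * \<mu>) / sqrt (real n))" for \<omega>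
      using \<sigma>(1) by (simp add: real_sqrt_mult sum_subtractf)
    then show ?thesis by (simp only: char_distr[OF meas1] char_distr[OF meas2])
  qed
  moreover have "char std_normal_distribution (\<sigma> * t) = exp (- (q - \<mu>\<^sup>2) * t\<^sup>2 / 2)"
    unfolding \<sigma>(2)[symmetric] by (simp add: char_std_normal_distribution power_mult_distrib)
  ultimately show ?thesis by simp
qed

end

lemma sum_mset_superposition:
  "(\<Sum>x\<in>#superposition Z n \<omega>. f x) = (\<Sum>i<n. \<Sum>x\<in>#Z i \<omega>. f x)"
  unfolding superposition_def by (induction n) simp_all

text \<open>
  Carries the theory of sums of random variables over to superpositions of point processes.
\<close>
lemma iid_point_process_sums:
  assumes iid: "iid_sequence M (config_space S) Z"
    and proc: "\<And>i. correlated_process M S (Z i) \<kappa> g G"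
    and f: "bounded_borel f"
  shows "iid_square_integrable M (\<lambda>i \<omega>. \<Sum>x\<in>#Z i \<omega>. f x)
    (LINT u|lborel. f u * correlated_process.ext_intensity S \<kappa> u) (correlated_process.pair_moment S \<kappa> g f f)"
proof -
  interpret correlated_process M S "Z i" \<kappa> g G for i by (rule proc)
  have [measurable]: "f \<in> borel_measurable borel" using f by (simp add: bounded_borel_def)
  show ?thesis
  proof
    show "indep_vars (\<lambda>_. borel) (\<lambda>i \<omega>. \<Sum>x\<in>#Z i \<omega>. f x) UNIV"
      using iid unfolding iid_sequence_def
      by (intro indep_vars_compose2[where Y="\<lambda>i C. \<Sum>x\<in>#C. f x" and M'="\<lambda>_. config_space S"]) auto
    have "distr M borel (\<lambda>\<omega>. \<Sum>x\<in>#Z i \<omega>. f x) = distr (distr M (config_space S) (Z i)) borel (\<lambda>C. \<Sum>x\<in>#C. f x)" for i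
      by (simp add: distr_distr comp_def)
    moreover have "distr M (config_space S) (Z i) = distr M (config_space S) (Z 0)" for i
      using iid unfolding iid_sequence_def by blast
    ultimately show "distr M borel (\<lambda>\<omega>. \<Sum>x\<in>#Z i \<omega>. f x) = distr M borel (\<lambda>\<omega>. \<Sum>x\<in>#Z 0 \<omega>. f x)" for i
      by metis
  qed (use campbell[OF f] campbell_pair[OF f f] in \<open>auto simp: has_bochner_integral_iff power2_eq_square\<close>)
qed

section \<open>The logistic score equation for a fixed pattern\<close>

text \<open>
  With \<open>l = \<lambda>(x; \<theta>0)\<close>, \<open>r = \<rho> x\<close> and \<open>s = (\<theta> - \<theta>0) \<bullet> z x\<close> this is \<open>\<lambda>(x; \<theta>) / (\<lambda>(x; \<theta>) + \<rho> x)\<close>, the conditional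
  probability that a point at \<open>x\<close> of the merged pattern belongs to the observed one.
\<close>
definition logistic :: "real \<Rightarrow> real \<Rightarrow> real \<Rightarrow> real" where
  "logistic l r s = l * exp s / (l * exp s + r)"

lemma logistic_DERIV:
  assumes "0 < l" "0 < r"
  shows "(logistic l r has_real_derivative logistic l r s * (1 - logistic l r s)) (at s)"
proof -
  have pos: "0 < l * exp s + r" for s using assms by (simp add: add_pos_pos)
  show ?thesis
    unfolding logistic_def[abs_def]
    by (rule derivative_eq_intros refl | use pos[of s] in \<open>simp add: field_simps\<close>)+
qed

lemma logistic_bounds: "0 < l \<Longrightarrow> 0 < r \<Longrightarrow> 0 < logistic l r s \<and> logistic l r s < 1"
  by (simp add: logistic_def add_pos_pos)

lemma logistic_mono:
  assumes "0 < l" "0 < r" "s \<le> t"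
  shows "logistic l r s \<le> logistic l r t"
  using assms(3)
proof (rule DERIV_nonneg_imp_nondecreasing)
  fix x show "\<exists>y. (logistic l r has_real_derivative y) (at x) \<and> 0 \<le> y"
    using logistic_DERIV[OF assms(1,2), of x] logistic_bounds[OF assms(1,2), of x]
    by (intro exI conjI) (auto intro: mult_nonneg_nonneg)
qed

lemma mean_value_bound:
  fixes f :: "real \<Rightarrow> real"
  assumes "\<And>x. \<bar>x\<bar> \<le> \<bar>s\<bar> \<Longrightarrow> (f has_real_derivative f' x) (at x)" "\<And>x. \<bar>x\<bar> \<le> \<bar>s\<bar> \<Longrightarrow> \<bar>f' x\<bar> \<le> B"
  shows "\<bar>f s - f 0\<bar> \<le> B * \<bar>s\<bar>"
proof -
  have "norm (f s - f 0) \<le> B * norm (s - 0)"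
  proof (rule field_differentiable_bound)
    show "convex {-\<bar>s\<bar>..\<bar>s\<bar>}" by simp
    fix x assume "x \<in> {-\<bar>s\<bar>..\<bar>s\<bar>}"
    then have x: "\<bar>x\<bar> \<le> \<bar>s\<bar>" by (simp add: abs_le_iff)
    show "(f has_field_derivative f' x) (at x within {-\<bar>s\<bar>..\<bar>s\<bar>})"
      by (rule has_field_derivative_at_within[OF assms(1)[OF x]])
    show "norm (f' x) \<le> B" using assms(2)[OF x] by simp
  qed auto
  then show ?thesis by simp
qed

text \<open>
  The first derivative is \<open>L (1 - L)\<close> and the second is \<open>L (1 - L) (1 - 2 L)\<close>, which is bounded by 1.
\<close>
lemma logistic_taylor:
  assumes "0 < l" "0 < r"
  shows "\<bar>logistic l r s - logistic l r 0 - logistic l r 0 * (1 - logistic l r 0) * s\<bar> \<le> s\<^sup>2"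
proof -
  let ?L = "logistic l r"
  let ?D = "\<lambda>s. ?L s * (1 - ?L s)"
  note d [derivative_intros] = logistic_DERIV[OF assms]
  note b = logistic_bounds[OF assms]
  have D: "(?D has_real_derivative ?D x * (1 - 2 * ?L x)) (at x)" for x
    by (rule derivative_eq_intros d refl)+ (simp add: algebra_simps)
  have "\<bar>?D x * (1 - 2 * ?L x)\<bar> \<le> 1" for x
  proof -
    have "\<bar>?L x\<bar> \<le> 1" "\<bar>1 - ?L x\<bar> \<le> 1" "\<bar>1 - 2 * ?L x\<bar> \<le> 1" using b[of x] by auto
    then have "\<bar>?L x\<bar> * \<bar>1 - ?L x\<bar> * \<bar>1 - 2 * ?L x\<bar> \<le> 1 * 1 * 1" by (intro mult_mono) auto
    then show ?thesis by (simp add: abs_mult)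
  qed
  then have D': "\<bar>?D x - ?D 0\<bar> \<le> \<bar>x\<bar>" for x
    using mean_value_bound[of x ?D "\<lambda>x. ?D x * (1 - 2 * ?L x)" 1] D by simp
  define h where "h x = ?L x - ?D 0 * x" for x
  have "\<bar>h s - h 0\<bar> \<le> \<bar>s\<bar> * \<bar>s\<bar>"
  proof (rule mean_value_bound)
    show "(h has_real_derivative ?D x - ?D 0) (at x)" for x
      unfolding h_def[abs_def] by (rule derivative_eq_intros d refl | simp)+
    show "\<bar>?D x - ?D 0\<bar> \<le> \<bar>s\<bar>" if "\<bar>x\<bar> \<le> \<bar>s\<bar>" for x
      using D'[of x] that by linarith
  qed
  then show ?thesis by (simp add: h_def power2_eq_square algebra_simps)
qed

lemma loglin_shift: "loglin b z \<theta> x = loglin b z \<theta>0 x * exp ((\<theta> - \<theta>0) \<bullet> z x)"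
  by (simp add: loglin_def mult.assoc inner_diff_left flip: exp_add)

lemma inner_sum_mset: "v \<bullet> (\<Sum>x\<in>#C. f x) = (\<Sum>x\<in>#C. v \<bullet> f x)"
  by (induction C) (auto simp: inner_add_right)

lemma norm_sum_mset: "norm (\<Sum>x\<in>#C. f x) \<le> (\<Sum>x\<in>#C. norm (f x))"
  by (induction C) (auto intro: norm_triangle_mono)

lemma sum_mset_const_mult: "(\<Sum>x\<in>#C. c * f x :: real) = c * (\<Sum>x\<in>#C. f x)"
  by (simp add: sum_mset_distrib_left)

text \<open>
  The weights of the two sums of the score add up to 1 at each point, so observed and dummy points contribute to
  the difference in the same way.
\<close>
lemma logistic_score_diff:
  assumes b: "\<And>x. x \<in># X + D \<Longrightarrow> 0 < loglin b z \<theta>0 x" and r: "\<And>x. x \<in># X + D \<Longrightarrow> 0 < \<rho> x"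
  shows "logistic_score b z \<rho> X D \<theta>0 - logistic_score b z \<rho> X D \<theta> =
    (\<Sum>x\<in>#X + D. (logistic (loglin b z \<theta>0 x) (\<rho> x) ((\<theta> - \<theta>0) \<bullet> z x) -
        logistic (loglin b z \<theta>0 x) (\<rho> x) 0) *\<^sub>R z x)"
proof -
  let ?L = "\<lambda>x. logistic (loglin b z \<theta>0 x) (\<rho> x)"
  have L: "loglin b z \<theta> x / (loglin b z \<theta> x + \<rho> x) = ?L x ((\<theta> - \<theta>0) \<bullet> z x)" for x
    by (simp add: logistic_def loglin_shift[of b z \<theta> x \<theta>0])
  have L0: "loglin b z \<theta>0 x / (loglin b z \<theta>0 x + \<rho> x) = ?L x 0" for x
    by (simp add: logistic_def)
  have pos: "0 < loglin b z \<theta> x + \<rho> x" if "x \<in># X + D" for x \<theta>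
    using b[OF that] r[OF that] by (simp add: add_pos_pos loglin_shift[of b z \<theta> x \<theta>0])
  have comp: "\<rho> x / (loglin b z \<theta> x + \<rho> x) = 1 - loglin b z \<theta> x / (loglin b z \<theta> x + \<rho> x)"
    if "x \<in># X + D" for x \<theta>
    using pos[OF that, of \<theta>] by (simp add: field_simps)
  have compL: "\<rho> x / (loglin b z \<theta> x + \<rho> x) = 1 - ?L x ((\<theta> - \<theta>0) \<bullet> z x)" if "x \<in># X + D" for x
    using comp[OF that] by (simp only: L)
  have compL0: "\<rho> x / (loglin b z \<theta>0 x + \<rho> x) = 1 - ?L x 0" if "x \<in># X + D" for x
    using comp[OF that] by (simp only: L0)
  have X: "(\<Sum>x\<in>#X. (\<rho> x / (loglin b z \<theta>0 x + \<rho> x)) *\<^sub>R z x) - (\<Sum>x\<in>#X. (\<rho> x / (loglin b z \<theta> x + \<rho> x)) *\<^sub>R z x)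
      = (\<Sum>x\<in>#X. (?L x ((\<theta> - \<theta>0) \<bullet> z x) - ?L x 0) *\<^sub>R z x)"
    unfolding sum_mset_diff[symmetric]
    by (intro arg_cong[where f=sum_mset] image_mset_cong) (simp add: compL compL0 scaleR_diff_left del: inner_diff_left)
  have D: "(\<Sum>x\<in>#D. (loglin b z \<theta> x / (loglin b z \<theta> x + \<rho> x)) *\<^sub>R z x) - (\<Sum>x\<in>#D. (loglin b z \<theta>0 x / (loglin b z \<theta>0 x + \<rho> x)) *\<^sub>R z x)
      = (\<Sum>x\<in>#D. (?L x ((\<theta> - \<theta>0) \<bullet> z x) - ?L x 0) *\<^sub>R z x)"
    unfolding sum_mset_diff[symmetric]
    by (intro arg_cong[where f=sum_mset] image_mset_cong) (simp only: L L0 scaleR_diff_left)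
  show ?thesis
    using arg_cong2[where f="(+)", OF X D] by (simp add: logistic_score_def algebra_simps)
qed

text \<open>
  Localization of the zeros of the score. The function \<open>L x\<close> is increasing, so for \<open>0 < a \<le> 1\<close> the product
  \<open>d \<bullet> s0\<close> is at least the corresponding expression with \<open>a d\<close> in the argument of \<open>L x\<close>. With \<open>a d\<close> in the ball of
  radius \<open>t\<close> the quadratic lower bound given by \<open>c\<close> dominates the cubic remainder. As \<open>s0\<close> is small compared with
  \<open>t c\<close>, the truncation of \<open>d\<close> to that ball cannot have been active.
\<close>
lemma logistic_zero_bounds:
  fixes z :: "'a \<Rightarrow> real^'m" and X D :: "'a multiset"
  defines "C \<equiv> X + D"
  assumes b: "\<And>x. x \<in># C \<Longrightarrow> 0 < loglin b z \<theta>0 x" and r: "\<And>x. x \<in># C \<Longrightarrow> 0 < \<rho> x"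
    and B: "\<And>x. x \<in># C \<Longrightarrow> norm (z x) \<le> B" "0 \<le> B"
    and zero: "logistic_score b z \<rho> X D \<theta> = 0"
  defines "s0 \<equiv> logistic_score b z \<rho> X D \<theta>0" and "d \<equiv> \<theta> - \<theta>0"
    and "w \<equiv> (\<lambda>x. logistic (loglin b z \<theta>0 x) (\<rho> x) 0 * (1 - logistic (loglin b z \<theta>0 x) (\<rho> x) 0))"
  assumes coercive: "\<And>v. c * (norm v)\<^sup>2 \<le> (\<Sum>x\<in>#C. w x * (v \<bullet> z x)\<^sup>2)"
    and radius: "0 < t" "B ^ 3 * real (size C) * t \<le> c / 2" and small: "norm s0 < t * c / 2"
  shows "norm (s0 - (\<Sum>x\<in>#C. (w x * (d \<bullet> z x)) *\<^sub>R z x)) \<le> B ^ 3 * real (size C) * (norm d)\<^sup>2"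
    and "c / 2 * norm d \<le> norm s0"
proof -
  define L where "L x = logistic (loglin b z \<theta>0 x) (\<rho> x)" for x
  have w: "w x = L x 0 * (1 - L x 0)" for x by (simp add: w_def L_def)
  have s0: "s0 = (\<Sum>x\<in>#C. (L x (d \<bullet> z x) - L x 0) *\<^sub>R z x)"
    using logistic_score_diff[of X D b z \<theta>0 \<rho> \<theta>] b r zero by (simp add: s0_def C_def d_def L_def)
  have rem: "\<bar>L x s - L x 0 - w x * s\<bar> \<le> s\<^sup>2" if "x \<in># C" for x s
    unfolding w unfolding L_def using that b r by (intro logistic_taylor) auto
  have dz: "\<bar>v \<bullet> z x\<bar> \<le> B * norm v" if "x \<in># C" for x v
    using Cauchy_Schwarz_ineq2[of v "z x"] mult_left_mono[OF B(1)[OF that] norm_ge_zero[of v]]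
    by (simp add: mult.commute)
  have size: "(\<Sum>x\<in>#C. K) = real (size C) * K" for K by simp
  have "norm (s0 - (\<Sum>x\<in>#C. (w x * (d \<bullet> z x)) *\<^sub>R z x)) =
      norm (\<Sum>x\<in>#C. (L x (d \<bullet> z x) - L x 0 - w x * (d \<bullet> z x)) *\<^sub>R z x)"
    unfolding s0 sum_mset_diff[symmetric] by (simp add: scaleR_diff_left)
  also have "\<dots> \<le> (\<Sum>x\<in>#C. norm ((L x (d \<bullet> z x) - L x 0 - w x * (d \<bullet> z x)) *\<^sub>R z x))"
    by (rule norm_sum_mset)
  also have "\<dots> \<le> (\<Sum>x\<in>#C. (B * norm d)\<^sup>2 * B)"
  proof (rule sum_mset_mono)
    fix x assume x: "x \<in># C"
    have "(d \<bullet> z x)\<^sup>2 \<le> (B * norm d)\<^sup>2"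
      using power_mono[OF dz[OF x, of d] abs_ge_zero, of 2] by simp
    with rem[OF x, of "d \<bullet> z x"] have "\<bar>L x (d \<bullet> z x) - L x 0 - w x * (d \<bullet> z x)\<bar> \<le> (B * norm d)\<^sup>2" by linarith
    then show "norm ((L x (d \<bullet> z x) - L x 0 - w x * (d \<bullet> z x)) *\<^sub>R z x) \<le> (B * norm d)\<^sup>2 * B"
      using B(1)[OF x] by (auto intro!: mult_mono)
  qed
  also have "\<dots> = B ^ 3 * real (size C) * (norm d)\<^sup>2"
    by (simp only: size) (simp add: power2_eq_square power3_eq_cube)
  finally show "norm (s0 - (\<Sum>x\<in>#C. (w x * (d \<bullet> z x)) *\<^sub>R z x)) \<le> B ^ 3 * real (size C) * (norm d)\<^sup>2" .
  show "c / 2 * norm d \<le> norm s0"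
  proof (cases "d = 0")
    case False
    then have d: "0 < norm d" by simp
    \<comment> \<open>The factor that brings \<open>d\<close> into the ball of radius \<open>t\<close>.\<close>
    define a where "a = min 1 (t / norm d)"
    have a: "0 < a" "a \<le> 1" using radius d by (auto simp: a_def)
    have ad: "a * norm d \<le> t" using d by (auto simp: a_def min_def field_simps)
    have step: "a * (w x * (d \<bullet> z x)\<^sup>2) - a\<^sup>2 * (B * norm d) ^ 3 \<le> d \<bullet> ((L x (d \<bullet> z x) - L x 0) *\<^sub>R z x)"
      if x: "x \<in># C" for x
    proof -
      define s where "s = d \<bullet> z x"
      have pos: "0 < loglin b z \<theta>0 x" "0 < \<rho> x" using b r x by auto
      have "(L x (a * s) - L x 0) * s \<le> (L x s - L x 0) * s"
      proof (cases "0 \<le> s")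
        case True
        then have "a * s \<le> s" using a by (simp add: mult_left_le_one_le)
        then show ?thesis using logistic_mono[OF pos] True unfolding L_def by (intro mult_right_mono) auto
      next
        case False
        then have "s \<le> a * s" using a by (simp add: mult_le_cancel_right1)
        then show ?thesis using logistic_mono[OF pos, of s "a * s"] False unfolding L_def by (intro mult_right_mono_neg) auto
      qed
      moreover have "\<bar>(L x (a * s) - L x 0) * s - w x * (a * s) * s\<bar> \<le> a\<^sup>2 * (B * norm d) ^ 3"
      proof -
        have "\<bar>(L x (a * s) - L x 0) * s - w x * (a * s) * s\<bar> = \<bar>L x (a * s) - L x 0 - w x * (a * s)\<bar> * \<bar>s\<bar>"
          by (simp add: left_diff_distrib flip: abs_mult)
        also have "\<dots> \<le> (a * s)\<^sup>2 * \<bar>s\<bar>"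
          by (intro mult_right_mono rem x) simp
        also have "\<dots> = a\<^sup>2 * \<bar>s\<bar> ^ 3"
          by (simp add: power_mult_distrib power3_eq_cube power2_eq_square)
        also have "\<dots> \<le> a\<^sup>2 * (B * norm d) ^ 3"
          using dz[OF x, of d] by (intro mult_left_mono power_mono) (auto simp: s_def)
        finally show ?thesis .
      qed
      ultimately have "a * (w x * s\<^sup>2) - a\<^sup>2 * (B * norm d) ^ 3 \<le> (L x s - L x 0) * s"
        by (simp add: power2_eq_square algebra_simps)
      then show ?thesis by (simp add: s_def)
    qed
    have "a * (c * (norm d)\<^sup>2) - a\<^sup>2 * (real (size C) * (B * norm d) ^ 3)
        \<le> a * (\<Sum>x\<in>#C. w x * (d \<bullet> z x)\<^sup>2) - a\<^sup>2 * (real (size C) * (B * norm d) ^ 3)"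
      using coercive[of d] a by (intro diff_right_mono mult_left_mono) auto
    also have "\<dots> = (\<Sum>x\<in>#C. a * (w x * (d \<bullet> z x)\<^sup>2) - a\<^sup>2 * (B * norm d) ^ 3)"
      by (simp add: sum_mset_diff sum_mset_const_mult)
    also have "\<dots> \<le> (\<Sum>x\<in>#C. d \<bullet> ((L x (d \<bullet> z x) - L x 0) *\<^sub>R z x))"
      by (intro sum_mset_mono step)
    also have "\<dots> = d \<bullet> s0" by (simp add: s0 inner_sum_mset)
    also have "\<dots> \<le> norm d * norm s0" by (rule norm_cauchy_schwarz)
    finally have main: "norm d * (a * norm d * c - a * norm d * (B ^ 3 * real (size C) * (a * norm d))) \<le> norm d * norm s0"
      by (simp add: power2_eq_square power3_eq_cube algebra_simps)
    then have "a * norm d * c - a * norm d * (B ^ 3 * real (size C) * (a * norm d)) \<le> norm s0"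
      using d by (simp add: mult_le_cancel_left)
    moreover have "B ^ 3 * real (size C) * (a * norm d) \<le> B ^ 3 * real (size C) * t"
      using ad B(2) by (intro mult_left_mono) auto
    then have "a * norm d * (B ^ 3 * real (size C) * (a * norm d)) \<le> a * norm d * (c / 2)"
      using radius(2) a d by (intro mult_left_mono) auto
    ultimately have lower: "a * norm d * c / 2 \<le> norm s0" by simp
    have "a = 1"
    proof (rule ccontr)
      assume "a \<noteq> 1"
      then have "a * norm d = t" using d by (auto simp: a_def min_def split: if_splits)
      with lower small show False by simp
    qed
    with lower show ?thesis by (simp add: mult.commute)
  qed simp
qed

lemma matrix_entry_bound:
  fixes A :: "real^'m^'m"
  assumes "\<And>k l. \<bar>A $ k $ l\<bar> \<le> e"
  shows "norm (A *v x) \<le> (real CARD('m))\<^sup>2 * e * norm x"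
proof -
  have "\<bar>(A *v x) $ k\<bar> \<le> real CARD('m) * e * norm x" for k
  proof -
    have "\<bar>(A *v x) $ k\<bar> \<le> (\<Sum>l\<in>UNIV. \<bar>A $ k $ l * x $ l\<bar>)"
      by (simp add: matrix_vector_mult_def sum_abs)
    also have "\<dots> \<le> (\<Sum>l\<in>(UNIV::'m set). e * norm x)"
    proof (rule sum_mono)
      fix l
      have "\<bar>A $ k $ l\<bar> * \<bar>x $ l\<bar> \<le> e * norm x"
        using assms[of k l] component_le_norm_cart[of x l] by (intro mult_mono) auto
      then show "\<bar>A $ k $ l * x $ l\<bar> \<le> e * norm x" by (simp add: abs_mult)
    qed
    finally show ?thesis by simp
  qed
  then have "(\<Sum>k\<in>UNIV. \<bar>(A *v x) $ k\<bar>) \<le> (\<Sum>k\<in>(UNIV::'m set). real CARD('m) * e * norm x)"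
    by (intro sum_mono)
  then have "(\<Sum>k\<in>UNIV. \<bar>(A *v x) $ k\<bar>) \<le> (real CARD('m))\<^sup>2 * e * norm x"
    by (simp add: power2_eq_square)
  with norm_le_l1_cart[of "A *v x"] show ?thesis by linarith
qed

text \<open>
  The form attains a positive minimum on the unit sphere; the rest is homogeneity.
\<close>
lemma positive_definite_coercive:
  fixes U :: "real^'m^'m"
  assumes "positive_definite U"
  obtains c where "0 < c" "\<And>v. c * (norm v)\<^sup>2 \<le> v \<bullet> (U *v v)"
proof -
  let ?S = "sphere 0 1 :: (real^'m) set"
  have cont: "continuous_on ?S (\<lambda>v. v \<bullet> (U *v v))"
    by (intro continuous_intros linear_continuous_on matrix_vector_mul_bounded_linear)
  have ne: "?S \<noteq> {}" by simp
  obtain v0 where v0: "v0 \<in> ?S" "\<And>v. v \<in> ?S \<Longrightarrow> v0 \<bullet> (U *v v0) \<le> v \<bullet> (U *v v)"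
    using continuous_attains_inf[OF compact_sphere ne cont] by blast
  define c where "c = v0 \<bullet> (U *v v0)"
  have "v0 \<noteq> 0" using v0(1) by auto
  then have "0 < c" using assms unfolding positive_definite_def c_def by blast
  moreover have "c * (norm v)\<^sup>2 \<le> v \<bullet> (U *v v)" for v
  proof (cases "v = 0")
    case False
    define u where "u = (1 / norm v) *\<^sub>R v"
    have "u \<in> ?S" using False by (simp add: u_def)
    then have "c \<le> u \<bullet> (U *v u)" using v0(2) by (simp add: c_def)
    moreover have "v = norm v *\<^sub>R u" using False by (simp add: u_def)
    then have "v \<bullet> (U *v v) = (norm v)\<^sup>2 * (u \<bullet> (U *v u))"
      by (metis inner_scaleR_left inner_scaleR_right matrix_vector_mult_scaleR mult.assoc power2_eq_square)
    ultimately show ?thesis by (simp add: mult.commute mult_right_mono)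
  qed simp
  ultimately show thesis by (rule that)
qed

lemma positive_definite_matrix_inv:
  fixes U :: "real^'m^'m"
  assumes "positive_definite U"
  shows "matrix_inv U *v (U *v x) = x"
proof -
  have "\<forall>x. U *v x = 0 \<longrightarrow> x = 0"
    using assms unfolding positive_definite_def by (metis inner_zero_right less_irrefl)
  then have "invertible U"
    by (simp add: invertible_left_inverse matrix_left_invertible_ker)
  then have "\<exists>A'. U ** A' = mat 1 \<and> A' ** U = mat 1" unfolding invertible_def .
  then have "matrix_inv U ** U = mat 1"
    unfolding matrix_inv_def by (rule someI2_ex) simp
  then show ?thesis by (simp add: matrix_vector_mul_assoc)
qed

lemma sum_mset_component: "(\<Sum>x\<in>#C. f x) $ k = (\<Sum>x\<in>#C. f x $ k)"
  by (induction C) auto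

lemma sum_mset_sum: "(\<Sum>x\<in>#C. \<Sum>k\<in>I. f k x :: 'b::comm_monoid_add) = (\<Sum>k\<in>I. \<Sum>x\<in>#C. f k x)"
  by (induction C) (auto simp: sum.distrib)

lemma rank_one_sum_matrix:
  fixes z :: "'a \<Rightarrow> real^'m"
  shows "(\<Sum>x\<in>#C. (w x * (d \<bullet> z x)) *\<^sub>R z x) = (\<chi> k l. \<Sum>x\<in>#C. w x * (z x $ k * z x $ l)) *v d"
proof -
  have "(\<Sum>x\<in>#C. (w x * (d \<bullet> z x)) *\<^sub>R z x) $ k = (\<Sum>l\<in>UNIV. (\<Sum>x\<in>#C. w x * (z x $ k * z x $ l)) * d $ l)" for k
  proof -
    have "(\<Sum>x\<in>#C. (w x * (d \<bullet> z x)) *\<^sub>R z x) $ k = (\<Sum>x\<in>#C. \<Sum>l\<in>UNIV. w x * (z x $ k * z x $ l) * d $ l)"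
      by (simp add: sum_mset_component inner_vec_def sum_distrib_left sum_distrib_right mult_ac)
    also have "\<dots> = (\<Sum>l\<in>UNIV. (\<Sum>x\<in>#C. w x * (z x $ k * z x $ l)) * d $ l)"
      by (simp add: sum_mset_sum sum_mset_distrib_right)
    finally show ?thesis .
  qed
  then show ?thesis by (simp add: vec_eq_iff matrix_vector_mult_def)
qed

text \<open>
  If the sums over the pattern are within \<open>2 e\<close> of \<open>n\<close> times their limits, then at a zero of the score \<open>d\<close> has order
  \<open>e / n\<close>, and both errors of the linearization, the quadratic Taylor remainder \<open>n (norm d)\<^sup>2\<close> and the Hessian error
  \<open>e norm d\<close>, have order \<open>e\<^sup>2 / n\<close>.
\<close>
lemma logistic_zero_linearization:
  fixes z :: "'a \<Rightarrow> real^'m" and X D :: "'a multiset" and U :: "real^'m^'m"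
  defines "C \<equiv> X + D" and "m \<equiv> real CARD('m)"
  assumes b: "\<And>x. x \<in># C \<Longrightarrow> 0 < loglin b z \<theta>0 x" and r: "\<And>x. x \<in># C \<Longrightarrow> 0 < \<rho> x"
    and B: "\<And>x. x \<in># C \<Longrightarrow> norm (z x) \<le> B" "0 \<le> B"
    and zero: "logistic_score b z \<rho> X D \<theta> = 0"
  defines "s0 \<equiv> logistic_score b z \<rho> X D \<theta>0" and "d \<equiv> \<theta> - \<theta>0"
    and "w \<equiv> (\<lambda>x. logistic (loglin b z \<theta>0 x) (\<rho> x) 0 * (1 - logistic (loglin b z \<theta>0 x) (\<rho> x) 0))"
  assumes n: "0 < n" and e: "0 \<le> e"
    and hess: "\<And>k l. \<bar>(\<Sum>x\<in>#C. w x * (z x $ k * z x $ l)) - n * U $ k $ l\<bar> \<le> 2 * e"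
    and score: "\<And>k. \<bar>s0 $ k\<bar> \<le> 2 * e"
    and card: "real (size C) \<le> K * n"
    and U: "0 < c0" "\<And>v. 2 * c0 * (norm v)\<^sup>2 \<le> v \<bullet> (U *v v)"
    and t: "0 < t" "B ^ 3 * K * t \<le> c0 / 2"
    and n_large: "2 * m\<^sup>2 * e \<le> c0 * n" "2 * m * e < t * (n * c0) / 2"
  shows "norm (s0 - n *\<^sub>R (U *v d)) \<le> (16 * B ^ 3 * K * m\<^sup>2 / c0\<^sup>2 + 8 * m ^ 3 / c0) * (e\<^sup>2 / n)"
proof -
  define H where "H = (\<chi> k l. \<Sum>x\<in>#C. w x * (z x $ k * z x $ l))"
  have HU: "norm ((H - n *\<^sub>R U) *v v) \<le> m\<^sup>2 * (2 * e) * norm v" for v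
    unfolding m_def by (rule matrix_entry_bound) (use hess in \<open>simp add: H_def\<close>)
  have HU': "(H - n *\<^sub>R U) *v v = H *v v - n *\<^sub>R (U *v v)" for v
    by (simp add: matrix_vector_mult_diff_rdistrib scaleR_matrix_vector_assoc)
  have Hv: "(\<Sum>x\<in>#C. (w x * (v \<bullet> z x)) *\<^sub>R z x) = H *v v" for v
    unfolding H_def by (rule rank_one_sum_matrix)
  have Hquad: "(\<Sum>x\<in>#C. w x * (v \<bullet> z x)\<^sup>2) = v \<bullet> (H *v v)" for v
    unfolding Hv[symmetric] by (simp add: inner_sum_mset power2_eq_square mult_ac)
  have coercive: "n * c0 * (norm v)\<^sup>2 \<le> (\<Sum>x\<in>#C. w x * (v \<bullet> z x)\<^sup>2)" for v
  proof -
    have "\<bar>v \<bullet> ((H - n *\<^sub>R U) *v v)\<bar> \<le> norm v * norm ((H - n *\<^sub>R U) *v v)"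
      by (rule Cauchy_Schwarz_ineq2)
    also have "\<dots> \<le> norm v * (m\<^sup>2 * (2 * e) * norm v)"
      by (intro mult_left_mono HU) simp
    also have "\<dots> = 2 * m\<^sup>2 * e * (norm v)\<^sup>2" by (simp add: power2_eq_square)
    also have "\<dots> \<le> c0 * n * (norm v)\<^sup>2" by (intro mult_right_mono n_large) simp
    finally have *: "n * (v \<bullet> (U *v v)) - c0 * n * (norm v)\<^sup>2 \<le> v \<bullet> (H *v v)"
      by (simp add: HU' inner_diff_right abs_le_iff)
    moreover have "n * (2 * c0 * (norm v)\<^sup>2) \<le> n * (v \<bullet> (U *v v))"
      using n U(2)[of v] by (intro mult_left_mono) auto
    ultimately show ?thesis unfolding Hquad by (simp add: algebra_simps)
  qed
  have s0: "norm s0 \<le> 2 * m * e"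
  proof -
    have "norm s0 \<le> (\<Sum>k\<in>UNIV. \<bar>s0 $ k\<bar>)" by (rule norm_le_l1_cart)
    also have "\<dots> \<le> (\<Sum>k\<in>(UNIV::'m set). 2 * e)" by (intro sum_mono score)
    finally show ?thesis by (simp add: m_def)
  qed
  have radius: "B ^ 3 * real (size C) * t \<le> n * c0 / 2"
  proof -
    have "B ^ 3 * real (size C) * t \<le> B ^ 3 * (K * n) * t"
      using card B(2) t(1) by (intro mult_right_mono mult_left_mono) auto
    also have "\<dots> = n * (B ^ 3 * K * t)" by simp
    also have "\<dots> \<le> n * (c0 / 2)" using n t(2) by (intro mult_left_mono) auto
    finally show ?thesis by simp
  qed
  have small: "norm s0 < t * (n * c0) / 2" using s0 n_large(2) by linarith
  note bounds = logistic_zero_bounds[of X D b z \<theta>0 \<rho> B \<theta> "n * c0" t, folded C_def, OF _ _ _ B(2) zero,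
      folded s0_def d_def, OF _ _ _ coercive[unfolded w_def] t(1) radius small]
  have rem: "norm (s0 - H *v d) \<le> B ^ 3 * real (size C) * (norm d)\<^sup>2"
    by (rule bounds(1)[unfolded Hv[unfolded w_def]]) (fact b r B(1))+
  have "n * c0 / 2 * norm d \<le> norm s0"
    by (rule bounds(2)) (fact b r B(1))+
  then have d: "norm d \<le> 4 * m * e / (n * c0)"
    using s0 n U(1) by (simp add: field_simps)
  have "norm (s0 - n *\<^sub>R (U *v d)) \<le> norm (s0 - H *v d) + norm (H *v d - n *\<^sub>R (U *v d))"
    by (rule norm_diff_triangle_le[OF order_refl order_refl])
  also have "\<dots> \<le> B ^ 3 * (K * n) * (norm d)\<^sup>2 + m\<^sup>2 * (2 * e) * norm d"
  proof (rule add_mono)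
    have "B ^ 3 * real (size C) * (norm d)\<^sup>2 \<le> B ^ 3 * (K * n) * (norm d)\<^sup>2"
      using card B(2) by (intro mult_right_mono mult_left_mono) auto
    with rem show "norm (s0 - H *v d) \<le> B ^ 3 * (K * n) * (norm d)\<^sup>2" by linarith
    show "norm (H *v d - n *\<^sub>R (U *v d)) \<le> m\<^sup>2 * (2 * e) * norm d"
      using HU[of d] unfolding HU' .
  qed
  also have "\<dots> \<le> B ^ 3 * (K * n) * (4 * m * e / (n * c0))\<^sup>2 + m\<^sup>2 * (2 * e) * (4 * m * e / (n * c0))"
  proof (intro add_mono mult_left_mono power_mono d)
    have "0 \<le> K * n" using card by (meson of_nat_0_le_iff order_trans)
    then show "0 \<le> B ^ 3 * (K * n)" using B(2) by simp
  qed (use e in auto)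
  also have "\<dots> = (16 * B ^ 3 * K * m\<^sup>2 / c0\<^sup>2 + 8 * m ^ 3 / c0) * (e\<^sup>2 / n)"
    using n U(1) by (simp add: field_simps power2_eq_square power3_eq_cube)
  finally show ?thesis .
qed

section \<open>Moments of the score\<close>

context correlated_process
begin

text \<open>
  The pair correlation function need not be symmetric everywhere, but the expectation that the moment represents
  is.
\<close>
lemma pair_moment_commute:
  assumes "bounded_borel f" "bounded_borel f'"
  shows "pair_moment f f' = pair_moment f' f"
proof (rule has_bochner_integral_eq[OF campbell_pair[OF assms]])
  show "has_bochner_integral M (\<lambda>\<omega>. (\<Sum>x\<in>#Z \<omega>. f x) * (\<Sum>x\<in>#Z \<omega>. f' x)) (pair_moment f' f)"
    using campbell_pair[OF assms(2,1)] by (simp only: mult.commute)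
qed

text \<open>
  Bilinearity is inherited from the expectation that the pair moment represents.
\<close>
lemma pair_moment_sum:
  assumes "finite I" and f: "\<And>k. k \<in> I \<Longrightarrow> bounded_borel (f k)" and F: "bounded_borel (\<lambda>x. \<Sum>k\<in>I. a k * f k x)"
  shows "pair_moment (\<lambda>x. \<Sum>k\<in>I. a k * f k x) (\<lambda>x. \<Sum>k\<in>I. a k * f k x) = (\<Sum>k\<in>I. \<Sum>l\<in>I. a k * a l * pair_moment (f k) (f l))"
proof (rule has_bochner_integral_eq[OF campbell_pair[OF F F]])
  have "has_bochner_integral M (\<lambda>\<omega>. \<Sum>k\<in>I. \<Sum>l\<in>I. (a k * a l) * ((\<Sum>x\<in>#Z \<omega>. f k x) * (\<Sum>x\<in>#Z \<omega>. f l x)))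
     (\<Sum>k\<in>I. \<Sum>l\<in>I. a k * a l * pair_moment (f k) (f l))"
    by (intro has_bochner_integral_sum has_bochner_integral_mult_right campbell_pair f)
  also have "(\<lambda>\<omega>. \<Sum>k\<in>I. \<Sum>l\<in>I. (a k * a l) * ((\<Sum>x\<in>#Z \<omega>. f k x) * (\<Sum>x\<in>#Z \<omega>. f l x))) =
     (\<lambda>\<omega>. (\<Sum>x\<in>#Z \<omega>. \<Sum>k\<in>I. a k * f k x) * (\<Sum>x\<in>#Z \<omega>. \<Sum>k\<in>I. a k * f k x))"
    by (simp add: sum_mset_sum sum_mset_const_mult sum_product mult_ac)
  finally show "has_bochner_integral M (\<lambda>\<omega>. (\<Sum>x\<in>#Z \<omega>. \<Sum>k\<in>I. a k * f k x) * (\<Sum>x\<in>#Z \<omega>. \<Sum>k\<in>I. a k * f k x))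
     (\<Sum>k\<in>I. \<Sum>l\<in>I. a k * a l * pair_moment (f k) (f l))" .
qed

end

lemma bounded_borel_const: "bounded_borel (\<lambda>_. c)"
  by (auto simp: bounded_borel_def)

lemma bounded_borel_sum:
  assumes "finite I" "\<And>k. k \<in> I \<Longrightarrow> bounded_borel (f k)"
  shows "bounded_borel (\<lambda>x. \<Sum>k\<in>I. f k x)"
  using assms
proof (induction I rule: finite_induct)
  case (insert k I)
  then have "bounded_borel (f k)" "bounded_borel (\<lambda>x. \<Sum>k\<in>I. f k x)" by auto
  then obtain B1 B2 where "\<And>x. \<bar>f k x\<bar> \<le> B1" "\<And>x. \<bar>\<Sum>k\<in>I. f k x\<bar> \<le> B2"
    and [measurable]: "f k \<in> borel_measurable borel" "(\<lambda>x. \<Sum>k\<in>I. f k x) \<in> borel_measurable borel"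
    unfolding bounded_borel_def by auto
  then have "\<bar>f k x + (\<Sum>k\<in>I. f k x)\<bar> \<le> B1 + B2" for x
    by (meson abs_triangle_ineq add_mono order_trans)
  moreover have "(\<lambda>x. f k x + (\<Sum>k\<in>I. f k x)) \<in> borel_measurable borel" by measurable
  ultimately show ?case using insert.hyps unfolding bounded_borel_def by auto
qed (simp add: bounded_borel_const)

locale logistic_regression = prob_space M for M :: "'w measure" +
  fixes S :: "'a::euclidean_space set" and Y E :: "nat \<Rightarrow> 'w \<Rightarrow> 'a multiset"
    and b \<rho> :: "'a \<Rightarrow> real" and z :: "'a \<Rightarrow> real^'m" and g h :: "'a \<Rightarrow> 'a \<Rightarrow> real"
    and \<theta>0 :: "real^'m" and GY GE B :: real
  assumes S_borel [measurable]: "S \<in> sets borel"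
    and iidY: "iid_sequence M (config_space S) Y" and iidE: "iid_sequence M (config_space S) E"
    and independent: "indep_sequences M (config_space S) Y E"
    and b_pos: "\<And>u. u \<in> S \<Longrightarrow> 0 < b u" and \<rho>_pos: "\<And>u. u \<in> S \<Longrightarrow> 0 < \<rho> u"
    and z_measurable: "z \<in> borel_measurable (restrict_space borel S)"
    and z_bounded: "\<And>u. u \<in> S \<Longrightarrow> norm (z u) \<le> B" and B_nonneg: "0 \<le> B"
    and procY: "\<And>i. correlated_process M S (Y i) (loglin b z \<theta>0) h GY"
    and procE: "\<And>i. correlated_process M S (E i) \<rho> g GE"
begin

sublocale YP: correlated_process M S "Y i" "loglin b z \<theta>0" h GY for i by (rule procY)
sublocale EP: correlated_process M S "E i" \<rho> g GE for i by (rule procE)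

abbreviation "lam \<equiv> loglin b z \<theta>0"
abbreviation "KY \<equiv> correlated_process.ext_intensity S lam"
abbreviation "KE \<equiv> correlated_process.ext_intensity S \<rho>"
abbreviation "QY \<equiv> correlated_process.ext_product_density S lam h"
abbreviation "QE \<equiv> correlated_process.ext_product_density S \<rho> g"
abbreviation "RY \<equiv> correlated_process.pair_moment S lam h"
abbreviation "RE \<equiv> correlated_process.pair_moment S \<rho> g"
abbreviation "U \<equiv> U_mat S lam \<rho> z"
abbreviation "V \<equiv> V_mat S lam \<rho> z g h"

lemma lam_pos: "u \<in> S \<Longrightarrow> 0 < lam u"
  using b_pos by (simp add: loglin_def)

definition event_score :: "'m \<Rightarrow> 'a \<Rightarrow> real" where
  "event_score k u = indicator S u * (\<rho> u / (lam u + \<rho> u) * z u $ k)"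

definition dummy_score :: "'m \<Rightarrow> 'a \<Rightarrow> real" where
  "dummy_score k u = indicator S u * (lam u / (lam u + \<rho> u) * z u $ k)"

definition information_term :: "'m \<Rightarrow> 'm \<Rightarrow> 'a \<Rightarrow> real" where
  "information_term k l u = indicator S u * (lam u / (lam u + \<rho> u) * (\<rho> u / (lam u + \<rho> u)) * (z u $ k * z u $ l))"

lemma lam_measurable [measurable]: "(\<lambda>u. indicator S u * lam u) \<in> borel_measurable borel"
  using YP.ext_intensity_measurable by (simp add: YP.ext_intensity_def[abs_def] mult.commute)

lemma \<rho>_measurable [measurable]: "(\<lambda>u. indicator S u * \<rho> u) \<in> borel_measurable borel"
  using EP.ext_intensity_measurable by (simp add: EP.ext_intensity_def[abs_def] mult.commute)

lemma z_component_measurable [measurable]: "(\<lambda>u. indicator S u * z u $ k) \<in> borel_measurable borel"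
proof -
  have "(\<lambda>u. z u $ k) \<in> borel_measurable (restrict_space borel S)"
    using z_measurable by (rule measurable_compose) simp
  then show ?thesis by (simp add: borel_measurable_restrict_space_iff)
qed

lemma z_component_bound: "u \<in> S \<Longrightarrow> \<bar>z u $ k\<bar> \<le> B"
  using component_le_norm_cart[of "z u" k] z_bounded[of u] by linarith

lemma fractions: 
  assumes "u \<in> S"
  shows "0 \<le> lam u / (lam u + \<rho> u)" "lam u / (lam u + \<rho> u) \<le> 1"
    "0 \<le> \<rho> u / (lam u + \<rho> u)" "\<rho> u / (lam u + \<rho> u) \<le> 1" "\<rho> u / (lam u + \<rho> u) = 1 - lam u / (lam u + \<rho> u)"
  using lam_pos[OF assms] \<rho>_pos[OF assms] by (auto simp: field_simps)

lemma bounded_borel_event_score: "bounded_borel (event_score k)"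
  unfolding bounded_borel_def
proof
  have "event_score k = (\<lambda>u. (indicator S u * \<rho> u) / (indicator S u * lam u + indicator S u * \<rho> u) * (indicator S u * z u $ k))"
    by (auto simp: event_score_def fun_eq_iff indicator_def)
  then show "event_score k \<in> borel_measurable borel" by simp
  have "\<bar>event_score k u\<bar> \<le> B" for u
  proof (cases "u \<in> S")
    case True
    have "\<bar>\<rho> u / (lam u + \<rho> u)\<bar> \<le> 1"
      by (simp only: abs_of_nonneg[OF fractions(3)[OF True]] fractions(4)[OF True])
    then have "\<bar>\<rho> u / (lam u + \<rho> u)\<bar> * \<bar>z u $ k\<bar> \<le> 1 * B"
      using z_component_bound[OF True, of k] by (rule mult_mono) auto
    then show ?thesis using True unfolding event_score_def by (simp add: abs_mult)
  qed (simp add: event_score_def B_nonneg)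
  then show "\<exists>B. \<forall>x. \<bar>event_score k x\<bar> \<le> B" by blast
qed

lemma bounded_borel_dummy_score: "bounded_borel (dummy_score k)"
  unfolding bounded_borel_def
proof
  have "dummy_score k = (\<lambda>u. (indicator S u * lam u) / (indicator S u * lam u + indicator S u * \<rho> u) * (indicator S u * z u $ k))"
    by (auto simp: dummy_score_def fun_eq_iff indicator_def)
  then show "dummy_score k \<in> borel_measurable borel" by simp
  have "\<bar>dummy_score k u\<bar> \<le> B" for u
  proof (cases "u \<in> S")
    case True
    have "\<bar>lam u / (lam u + \<rho> u)\<bar> \<le> 1"
      by (simp only: abs_of_nonneg[OF fractions(1)[OF True]] fractions(2)[OF True])
    then have "\<bar>lam u / (lam u + \<rho> u)\<bar> * \<bar>z u $ k\<bar> \<le> 1 * B"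
      using z_component_bound[OF True, of k] by (rule mult_mono) auto
    then show ?thesis using True unfolding dummy_score_def by (simp add: abs_mult)
  qed (simp add: dummy_score_def B_nonneg)
  then show "\<exists>B. \<forall>x. \<bar>dummy_score k x\<bar> \<le> B" by blast
qed

lemma bounded_borel_information_term: "bounded_borel (information_term k l)"
proof -
  have "information_term k l = (\<lambda>u. dummy_score k u * event_score l u)"
    by (auto simp: information_term_def dummy_score_def event_score_def fun_eq_iff indicator_def)
  then show ?thesis using bounded_borel_mult[OF bounded_borel_dummy_score bounded_borel_event_score] by simp
qed

text \<open>
  This identity makes the score at \<open>\<theta>0\<close> unbiased: observed and dummy points have the same mean contribution.
\<close>
lemma event_dummy_score_balance: "event_score k u * KY u = dummy_score k u * KE u"
  by (simp add: event_score_def dummy_score_def YP.ext_intensity_def EP.ext_intensity_def)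

definition \<mu> :: "'m \<Rightarrow> real" where "\<mu> k = (LINT u|lborel. event_score k u * KY u)"

lemma \<mu>_E: "\<mu> k = (LINT u|lborel. dummy_score k u * KE u)"
  by (simp add: \<mu>_def event_dummy_score_balance)

lemma superposition_subset:
  assumes "\<omega> \<in> space M" shows "set_mset (superposition Y n \<omega>) \<subseteq> S" "set_mset (superposition E n \<omega>) \<subseteq> S"
proof -
  have "set_mset (superposition Z n \<omega>) = (\<Union>i<n. set_mset (Z i \<omega>))" for Z :: "nat \<Rightarrow> 'w \<Rightarrow> 'a multiset"
    unfolding superposition_def by (induction n) (auto simp: lessThan_Suc)
  then show "set_mset (superposition Y n \<omega>) \<subseteq> S" "set_mset (superposition E n \<omega>) \<subseteq> S"
    using YP.Z_subset[OF assms] EP.Z_subset[OF assms] by (simp_all add: UN_subset_iff)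
qed

text \<open>
  \<open>U\<close> as the mean Hessian of the negative log-likelihood.
\<close>
lemma U_entry: "U $ k $ l = (LINT u|lborel. information_term k l u * KY u) + (LINT u|lborel. information_term k l u * KE u)"
proof -
  have "U $ k $ l = (LINT u|lborel. information_term k l u * KY u + information_term k l u * KE u)"
    unfolding U_mat_def set_lebesgue_integral_def vec_lambda_beta
  proof (intro Bochner_Integration.integral_cong refl)
    fix u
    show "indicator S u *\<^sub>R (lam u * \<rho> u / (lam u + \<rho> u) * z u $ k * z u $ l) = information_term k l u * KY u + information_term k l u * KE u"
    proof (cases "u \<in> S")
      case True
      then have "lam u + \<rho> u \<noteq> 0" using lam_pos[OF True] \<rho>_pos[OF True] by linarith
      moreover have "p / d * (r / d) * d = p * r / d" if "d \<noteq> 0" for p r d :: real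
        using that by simp
      ultimately have "lam u / (lam u + \<rho> u) * (\<rho> u / (lam u + \<rho> u)) * (lam u + \<rho> u) = lam u * \<rho> u / (lam u + \<rho> u)"
        by blast
      note cancel = this
      have "p * q * L + p * q * r = p * (L + r) * q" for p q L r :: real
        by (simp add: distrib_left distrib_right)
      moreover have "indicator S u = (1::real)" using True by simp
      ultimately have "information_term k l u * KY u + information_term k l u * KE u =
          lam u / (lam u + \<rho> u) * (\<rho> u / (lam u + \<rho> u)) * (lam u + \<rho> u) * (z u $ k * z u $ l)"
        by (simp only: information_term_def YP.ext_intensity_def EP.ext_intensity_def mult_1_left mult_1_right)
      with cancel show ?thesis using True by (simp add: mult.assoc)
    qed (simp add: information_term_def)
  qed
  then show ?thesis
    using YP.integrable_bounded_borel_intensity[OF bounded_borel_information_term] EP.integrable_bounded_borel_intensity[OF bounded_borel_information_term] by simp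
qed

text \<open>
  \<open>U\<close> as the one-point part of the covariance of the score; with the previous lemma this is the information
  identity of the logistic likelihood.
\<close>
lemma U_entry': "U $ k $ l = (LINT u|lborel. event_score k u * event_score l u * KY u) + (LINT u|lborel. dummy_score k u * dummy_score l u * KE u)"
proof -
  have "information_term k l u * KY u + information_term k l u * KE u = event_score k u * event_score l u * KY u + dummy_score k u * dummy_score l u * KE u" for u
  proof (cases "u \<in> S")
    case True
    then have "lam u + \<rho> u \<noteq> 0" using lam_pos[OF True] \<rho>_pos[OF True] by linarith
    with True show ?thesis
      by (simp add: information_term_def event_score_def dummy_score_def YP.ext_intensity_def EP.ext_intensity_def divide_simps)
  qed (simp add: information_term_def event_score_def dummy_score_def)
  then have "(LINT u|lborel. information_term k l u * KY u + information_term k l u * KE u) = (LINT u|lborel. event_score k u * event_score l u * KY u + dummy_score k u * dummy_score l u * KE u)"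
    by simp
  then show ?thesis
    using YP.integrable_bounded_borel_intensity[OF bounded_borel_information_term[of k l]] EP.integrable_bounded_borel_intensity[OF bounded_borel_information_term[of k l]]
      YP.integrable_bounded_borel_intensity[OF bounded_borel_mult[OF bounded_borel_event_score[of k] bounded_borel_event_score[of l]]]
      EP.integrable_bounded_borel_intensity[OF bounded_borel_mult[OF bounded_borel_dummy_score[of k] bounded_borel_dummy_score[of l]]]
    by (simp add: U_entry)
qed

text \<open>
  The covariance of the contributions of \<open>Y\<^sub>i\<close> and \<open>E\<^sub>i\<close> to the score. In the pair terms the two weights, score
  function times intensity, agree for both processes, so the two pair correlation functions and the two products of means combine to
  \<open>g + h - 2\<close>.
\<close>
lemma V_entry: "V $ k $ l = (RY (event_score k) (event_score l) - \<mu> k * \<mu> l) + (RE (dummy_score k) (dummy_score l) - \<mu> k * \<mu> l)"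
proof -
  let ?P = "lborel \<Otimes>\<^sub>M lborel :: ('a \<times> 'a) measure"
  define q1 where "q1 p = event_score k (fst p) * event_score l (snd p) * QY p" for p
  define q2 where "q2 p = dummy_score k (fst p) * dummy_score l (snd p) * QE p" for p
  define q3 where "q3 p = event_score k (fst p) * event_score l (snd p) * (KY (fst p) * KY (snd p))" for p
  have i1: "integrable ?P q1" unfolding q1_def
    by (intro YP.integrable_bounded_borel_pair bounded_borel_event_score YP.ext_product_density_integrable)
  have i2: "integrable ?P q2" unfolding q2_def
    by (intro EP.integrable_bounded_borel_pair bounded_borel_dummy_score EP.ext_product_density_integrable)
  have i3: "integrable ?P q3" unfolding q3_def
    by (intro YP.integrable_bounded_borel_pair bounded_borel_event_score YP.ext_intensity_prod_integrable)
  have "(LINT p|?P. q3 p) = (LINT u|lborel. LINT v|lborel. q3 (u, v))"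
    by (rule lborel_pair.integral_fst'[symmetric, OF i3])
  also have "\<dots> = (LINT u|lborel. LINT v|lborel. (event_score k u * KY u) * (event_score l v * KY v))"
    by (simp add: q3_def mult_ac)
  also have "\<dots> = \<mu> k * \<mu> l"
    by (simp add: \<mu>_def)
  finally have e3: "(LINT p|?P. q3 p) = \<mu> k * \<mu> l" .
  have "(LINT u:S|lborel. LINT v:S|lborel.
        lam u * lam v * \<rho> u * \<rho> v * (z u $ k) * (z v $ l) /
          ((lam u + \<rho> u) * (lam v + \<rho> v)) * (g u v + h u v - 2)) =
     (LINT u|lborel. LINT v|lborel. q1 (u, v) + q2 (u, v) - 2 * q3 (u, v))"
    unfolding set_lebesgue_integral_def
    unfolding integral_scaleR_right[symmetric]
  proof (intro Bochner_Integration.integral_cong refl)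
    fix u v
    show "indicator S u *\<^sub>R indicator S v *\<^sub>R (lam u * lam v * \<rho> u * \<rho> v * (z u $ k) * (z v $ l) /
          ((lam u + \<rho> u) * (lam v + \<rho> v)) * (g u v + h u v - 2)) = q1 (u, v) + q2 (u, v) - 2 * q3 (u, v)"
    proof (cases "u \<in> S \<and> v \<in> S")
      case True
      then have "lam u + \<rho> u \<noteq> 0" "lam v + \<rho> v \<noteq> 0" using lam_pos[of u] \<rho>_pos[of u] lam_pos[of v] \<rho>_pos[of v] by auto
      with True show ?thesis
        by (simp add: q1_def q2_def q3_def event_score_def dummy_score_def YP.ext_product_density_def EP.ext_product_density_def YP.ext_intensity_def divide_simps)
           (simp add: algebra_simps)
    next
      case False
      then show ?thesis by (auto simp: q1_def q2_def q3_def event_score_def dummy_score_def)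
    qed
  qed
  also have "\<dots> = (LINT p|?P. q1 p + q2 p - 2 * q3 p)"
    using lborel_pair.integral_fst'[of "\<lambda>p. q1 p + q2 p - 2 * q3 p"] i1 i2 i3 by simp
  also have "\<dots> = (LINT p|?P. q1 p) + (LINT p|?P. q2 p) - 2 * (\<mu> k * \<mu> l)"
    using i1 i2 i3 e3 by simp
  finally show ?thesis
    unfolding V_mat_def YP.pair_moment_def EP.pair_moment_def
    by (simp add: U_entry' q1_def q2_def)
qed

lemma V_symmetric: "transpose V = V"
  by (simp add: vec_eq_iff transpose_def V_entry YP.pair_moment_commute[OF bounded_borel_event_score bounded_borel_event_score]
      EP.pair_moment_commute[OF bounded_borel_dummy_score bounded_borel_dummy_score] mult.commute)

end

section \<open>Asymptotic normality of the estimator\<close>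

context logistic_regression
begin

definition score :: "nat \<Rightarrow> 'w \<Rightarrow> real^'m" where
  "score n \<omega> = logistic_score b z \<rho> (superposition Y n \<omega>) (superposition E n \<omega>) \<theta>0"

lemma score_component:
  assumes "\<omega> \<in> space M"
  shows "score n \<omega> $ k = (\<Sum>x\<in>#superposition Y n \<omega>. event_score k x) - (\<Sum>x\<in>#superposition E n \<omega>. dummy_score k x)"
proof -
  have "(\<Sum>x\<in>#superposition Y n \<omega>. \<rho> x / (lam x + \<rho> x) * z x $ k) = (\<Sum>x\<in>#superposition Y n \<omega>. event_score k x)"
    using superposition_subset(1)[OF assms, of n]
    by (intro arg_cong[where f=sum_mset] image_mset_cong) (auto simp: event_score_def)
  moreover have "(\<Sum>x\<in>#superposition E n \<omega>. lam x / (lam x + \<rho> x) * z x $ k) = (\<Sum>x\<in>#superposition E n \<omega>. dummy_score k x)"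
    using superposition_subset(2)[OF assms, of n]
    by (intro arg_cong[where f=sum_mset] image_mset_cong) (auto simp: dummy_score_def)
  ultimately show ?thesis
    by (simp add: score_def logistic_score_def sum_mset_component)
qed

lemma measurable_superposition_sum:
  fixes f :: "'a \<Rightarrow> real"
  assumes "f \<in> borel_measurable borel"
  shows "(\<lambda>\<omega>. \<Sum>x\<in>#superposition Y n \<omega>. f x) \<in> borel_measurable M"
    "(\<lambda>\<omega>. \<Sum>x\<in>#superposition E n \<omega>. f x) \<in> borel_measurable M"
  unfolding sum_mset_superposition
  by (intro borel_measurable_sum measurable_compose[OF YP.Z_measurable measurable_sum_mset[OF assms]]
      measurable_compose[OF EP.Z_measurable measurable_sum_mset[OF assms]])+


lemma score_measurable [measurable]: "score n \<in> borel_measurable M"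
proof (subst borel_measurable_euclidean_space, rule ballI)
  fix i :: "real^'m" assume "i \<in> Basis"
  then obtain k where i: "i = axis k 1" by (auto simp: Basis_vec_def)
  have [measurable]: "event_score k \<in> borel_measurable borel" "dummy_score k \<in> borel_measurable borel"
    using bounded_borel_event_score bounded_borel_dummy_score by (auto simp: bounded_borel_def)
  have "(\<lambda>\<omega>. (\<Sum>x\<in>#superposition Y n \<omega>. event_score k x) - (\<Sum>x\<in>#superposition E n \<omega>. dummy_score k x)) \<in> borel_measurable M"
    by (intro borel_measurable_diff measurable_superposition_sum) simp_all
  moreover have "score n \<omega> \<bullet> i = (\<Sum>x\<in>#superposition Y n \<omega>. event_score k x) - (\<Sum>x\<in>#superposition E n \<omega>. dummy_score k x)"
    if "\<omega> \<in> space M" for \<omega>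
    using score_component[OF that] by (simp add: i inner_axis)
  ultimately show "(\<lambda>\<omega>. score n \<omega> \<bullet> i) \<in> borel_measurable M"
    by (simp cong: measurable_cong)
qed

lemma whp_Y:
  assumes "bounded_borel f"
  shows "whp M (\<lambda>n \<omega>. \<bar>(\<Sum>x\<in>#superposition Y n \<omega>. f x) - real n * (LINT u|lborel. f u * KY u)\<bar> \<le> real n powr (5/8))"
  unfolding sum_mset_superposition
  by (rule iid_square_integrable.whp_centered_sum[OF iid_point_process_sums[OF iidY procY assms]])

lemma whp_E:
  assumes "bounded_borel f"
  shows "whp M (\<lambda>n \<omega>. \<bar>(\<Sum>x\<in>#superposition E n \<omega>. f x) - real n * (LINT u|lborel. f u * KE u)\<bar> \<le> real n powr (5/8))"
  unfolding sum_mset_superposition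
  by (rule iid_square_integrable.whp_centered_sum[OF iid_point_process_sums[OF iidE procE assms]])

lemma whp_score: "whp M (\<lambda>n \<omega>. \<forall>k. \<bar>score n \<omega> $ k\<bar> \<le> 2 * real n powr (5/8))"
proof -
  have "whp M (\<lambda>n \<omega>. \<forall>k\<in>UNIV. \<bar>score n \<omega> $ k\<bar> \<le> 2 * real n powr (5/8))"
  proof (rule whp_ball_finite)
    fix k
    show "whp M (\<lambda>n \<omega>. \<bar>score n \<omega> $ k\<bar> \<le> 2 * real n powr (5/8))"
    proof (rule whp_mono[OF whp_conj[OF whp_Y[OF bounded_borel_event_score[of k]] whp_E[OF bounded_borel_dummy_score[of k]]]])
      fix n \<omega> assume "\<omega> \<in> space M"
      and "\<bar>(\<Sum>x\<in>#superposition Y n \<omega>. event_score k x) - real n * (LINT u|lborel. event_score k u * KY u)\<bar> \<le> real n powr (5/8) \<and>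
        \<bar>(\<Sum>x\<in>#superposition E n \<omega>. dummy_score k x) - real n * (LINT u|lborel. dummy_score k u * KE u)\<bar> \<le> real n powr (5/8)"
      then show "\<bar>score n \<omega> $ k\<bar> \<le> 2 * real n powr (5/8)"
        unfolding \<mu>_def[symmetric] \<mu>_E[symmetric] by (simp add: score_component, linarith)
    qed
  qed simp
  then show ?thesis by simp
qed

lemma whp_hessian:
  "whp M (\<lambda>n \<omega>. \<forall>k l. \<bar>(\<Sum>x\<in>#superposition Y n \<omega> + superposition E n \<omega>. information_term k l x) - real n * U $ k $ l\<bar>
     \<le> 2 * real n powr (5/8))"
proof -
  have "whp M (\<lambda>n \<omega>. \<forall>k\<in>UNIV. \<forall>l\<in>UNIV. \<bar>(\<Sum>x\<in>#superposition Y n \<omega> + superposition E n \<omega>. information_term k l x) - real n * U $ k $ l\<bar>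
     \<le> 2 * real n powr (5/8))"
  proof (intro whp_ball_finite)
    fix k l
    show "whp M (\<lambda>n \<omega>. \<bar>(\<Sum>x\<in>#superposition Y n \<omega> + superposition E n \<omega>. information_term k l x) - real n * U $ k $ l\<bar>
     \<le> 2 * real n powr (5/8))"
      by (rule whp_mono[OF whp_conj[OF whp_Y[OF bounded_borel_information_term[of k l]] whp_E[OF bounded_borel_information_term[of k l]]]])
         (simp add: U_entry distrib_left, linarith)
  qed simp_all
  then show ?thesis by simp
qed

lemma whp_count:
  obtains K where "0 \<le> K" "whp M (\<lambda>n \<omega>. real (size (superposition Y n \<omega> + superposition E n \<omega>)) \<le> K * real n)"
proof -
  define m1 where "m1 = (LINT u|lborel. 1 * KY u)"
  define m2 where "m2 = (LINT u|lborel. 1 * KE u)"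
  have "whp M (\<lambda>n \<omega>. real (size (superposition Y n \<omega> + superposition E n \<omega>)) \<le> (\<bar>m1\<bar> + \<bar>m2\<bar> + 2) * real n)"
  proof (rule whp_mono[OF whp_conj[OF whp_Y[OF bounded_borel_const[of 1]] whp_E[OF bounded_borel_const[of 1]]]])
    fix n \<omega>
    assume *: "\<bar>(\<Sum>x\<in>#superposition Y n \<omega>. 1) - real n * (LINT u|lborel. 1 * KY u)\<bar> \<le> real n powr (5/8) \<and>
        \<bar>(\<Sum>x\<in>#superposition E n \<omega>. 1) - real n * (LINT u|lborel. 1 * KE u)\<bar> \<le> real n powr (5/8)"
    have "real n powr (5/8) \<le> real n"
      using powr_mono[of "5/8" 1 "real n"] by (cases "n = 0") auto
    moreover have "real n * m1 \<le> real n * \<bar>m1\<bar>" "real n * m2 \<le> real n * \<bar>m2\<bar>"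
      by (intro mult_left_mono; simp)+
    ultimately show "real (size (superposition Y n \<omega> + superposition E n \<omega>)) \<le> (\<bar>m1\<bar> + \<bar>m2\<bar> + 2) * real n"
      using * unfolding m1_def[symmetric] m2_def[symmetric] by (simp add: algebra_simps abs_le_iff)
  qed
  then show thesis by (rule that[rotated]) simp
qed

text \<open>
  The score equation solved to first order: the bound is of order \<open>n\<^bsup>1/4\<^esup>\<close>.
\<close>
lemma estimator_linearization:
  assumes pd: "positive_definite U"
    and zero: "whp M (\<lambda>n \<omega>. logistic_score b z \<rho> (superposition Y n \<omega>) (superposition E n \<omega>) (\<theta> n \<omega>) = 0)"
  obtains L where "whp M (\<lambda>n \<omega>. norm (score n \<omega> - real n *\<^sub>R (U *v (\<theta> n \<omega> - \<theta>0)))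
      \<le> L * ((real n powr (5/8))\<^sup>2 / real n))"
proof -
  define m where "m = real CARD('m)"
  obtain c where c: "0 < c" "\<And>v. c * (norm v)\<^sup>2 \<le> v \<bullet> (U *v v)"
    using positive_definite_coercive[OF pd] by blast
  define c0 where "c0 = c / 2"
  have c0: "0 < c0" "\<And>v. 2 * c0 * (norm v)\<^sup>2 \<le> v \<bullet> (U *v v)" using c by (auto simp: c0_def)
  obtain K where K: "0 \<le> K" "whp M (\<lambda>n \<omega>. real (size (superposition Y n \<omega> + superposition E n \<omega>)) \<le> K * real n)"
    using whp_count by blast
  \<comment> \<open>The cubic remainder is at most \<open>B\<^sup>3 K n\<close> times the cube of the radius; the summand 1 avoids a division by 0.\<close>
  define t where "t = c0 / (2 * (B ^ 3 * K + 1))"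
  have BK: "0 \<le> B ^ 3 * K" using K(1) B_nonneg by simp
  have t: "0 < t" using c0 BK by (simp add: t_def)
  have t': "B ^ 3 * K * t \<le> c0 / 2"
  proof -
    have "B ^ 3 * K * t \<le> (B ^ 3 * K + 1) * t" using t by simp
    also have "\<dots> = c0 / 2" using BK by (simp add: t_def divide_simps)
    finally show ?thesis .
  qed
  have lim: "(\<lambda>n. real n powr (5/8) / real n) \<longlonglongrightarrow> 0" by real_asymp
  have l1: "\<forall>\<^sub>F n in sequentially. 2 * m\<^sup>2 * (real n powr (5/8) / real n) < c0"
    using tendsto_mult_right_zero[OF lim, of "2 * m\<^sup>2"] c0(1) by (rule order_tendstoD)
  have l2: "\<forall>\<^sub>F n in sequentially. 2 * m * (real n powr (5/8) / real n) < t * c0 / 2"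
    using tendsto_mult_right_zero[OF lim, of "2 * m"] by (rule order_tendstoD) (use t c0 in simp)
  have large: "\<forall>\<^sub>F n in sequentially. 0 < real n \<and> 2 * m\<^sup>2 * real n powr (5/8) \<le> c0 * real n \<and>
      2 * m * real n powr (5/8) < t * (real n * c0) / 2"
    using l1 l2 eventually_gt_at_top[of 0]
  proof eventually_elim
    case (elim n)
    then show ?case by (simp add: field_simps)
  qed
  have "whp M (\<lambda>n \<omega>. 0 < real n \<and> 2 * m\<^sup>2 * real n powr (5/8) \<le> c0 * real n \<and>
      2 * m * real n powr (5/8) < t * (real n * c0) / 2)"
    by (rule whp_eventually) (rule eventually_mono[OF large], simp)
  note all = whp_conj[OF this whp_conj[OF zero whp_conj[OF whp_score whp_conj[OF whp_hessian K(2)]]]]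
  show thesis
  proof (rule that, rule whp_mono[OF all], elim conjE)
    fix n \<omega> assume \<omega>: "\<omega> \<in> space M"
    let ?X = "superposition Y n \<omega>" and ?D = "superposition E n \<omega>"
    have inS: "x \<in> S" if "x \<in># ?X + ?D" for x
      using superposition_subset[OF \<omega>, of n] that by auto
    assume n: "0 < real n"
      and zero: "logistic_score b z \<rho> ?X ?D (\<theta> n \<omega>) = 0"
      and size: "real (size (?X + ?D)) \<le> K * real n"
      and score: "\<forall>k. \<bar>score n \<omega> $ k\<bar> \<le> 2 * real n powr (5/8)"
      and hess: "\<forall>k l. \<bar>(\<Sum>x\<in>#?X + ?D. information_term k l x) - real n * U $ k $ l\<bar> \<le> 2 * real n powr (5/8)"
      and n1: "2 * m\<^sup>2 * real n powr (5/8) \<le> c0 * real n"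
      and n2: "2 * m * real n powr (5/8) < t * (real n * c0) / 2"
    have information_term: "(\<Sum>x\<in>#?X + ?D. logistic (lam x) (\<rho> x) 0 * (1 - logistic (lam x) (\<rho> x) 0) * (z x $ k * z x $ l))
        = (\<Sum>x\<in>#?X + ?D. information_term k l x)" for k l
    proof (intro arg_cong[where f=sum_mset] image_mset_cong)
      fix x assume "x \<in># ?X + ?D"
      then have x: "x \<in> S" by (rule inS)
      have "logistic (lam x) (\<rho> x) 0 = lam x / (lam x + \<rho> x)" by (simp add: logistic_def)
      moreover have "1 - lam x / (lam x + \<rho> x) = \<rho> x / (lam x + \<rho> x)" using fractions(5)[OF x] by simp
      ultimately show "logistic (lam x) (\<rho> x) 0 * (1 - logistic (lam x) (\<rho> x) 0) * (z x $ k * z x $ l) = information_term k l x"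
        using x by (simp add: information_term_def)
    qed
    show "norm (score n \<omega> - real n *\<^sub>R (U *v (\<theta> n \<omega> - \<theta>0)))
        \<le> (16 * B ^ 3 * K * m\<^sup>2 / c0\<^sup>2 + 8 * m ^ 3 / c0) * ((real n powr (5/8))\<^sup>2 / real n)"
      unfolding score_def m_def
    proof (rule logistic_zero_linearization[where B=B and t=t, OF _ _ _ B_nonneg zero n])
      show "0 < loglin b z \<theta>0 x" "0 < \<rho> x" "norm (z x) \<le> B" if "x \<in># ?X + ?D" for x
        using inS[OF that] lam_pos \<rho>_pos z_bounded by auto
      show "\<bar>(\<Sum>x\<in>#?X + ?D. logistic (lam x) (\<rho> x) 0 * (1 - logistic (lam x) (\<rho> x) 0) * (z x $ k * z x $ l))
          - real n * U $ k $ l\<bar> \<le> 2 * real n powr (5/8)" for k l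
        unfolding information_term using hess by blast
      show "\<bar>logistic_score b z \<rho> ?X ?D \<theta>0 $ k\<bar> \<le> 2 * real n powr (5/8)" for k
        using score unfolding score_def by blast
    qed (use size c0 t t' n1 n2 in \<open>simp_all add: m_def\<close>)
  qed
qed

definition event_score_along :: "real^'m \<Rightarrow> 'a \<Rightarrow> real" where "event_score_along a x = (\<Sum>k\<in>UNIV. a $ k * event_score k x)"
text \<open>
  The sign is included, so that the score in direction \<open>a\<close> is a sum of two sums.
\<close>
definition dummy_score_along :: "real^'m \<Rightarrow> 'a \<Rightarrow> real" where "dummy_score_along a x = (\<Sum>k\<in>UNIV. - a $ k * dummy_score k x)"

lemma bounded_borel_event_score_along: "bounded_borel (event_score_along a)"
  unfolding event_score_along_def[abs_def] by (intro bounded_borel_sum bounded_borel_mult bounded_borel_const bounded_borel_event_score finite)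

lemma bounded_borel_dummy_score_along: "bounded_borel (dummy_score_along a)"
  unfolding dummy_score_along_def[abs_def] by (intro bounded_borel_sum bounded_borel_mult bounded_borel_const bounded_borel_dummy_score finite)

lemma mean_event_score_along: "(LINT u|lborel. event_score_along a u * KY u) = (\<Sum>k\<in>UNIV. a $ k * \<mu> k)"
  unfolding event_score_along_def sum_distrib_right using YP.integrable_bounded_borel_intensity[OF bounded_borel_event_score]
  by (simp add: mult.assoc \<mu>_def)

lemma mean_dummy_score_along: "(LINT u|lborel. dummy_score_along a u * KE u) = - (\<Sum>k\<in>UNIV. a $ k * \<mu> k)"
  unfolding dummy_score_along_def sum_distrib_right using EP.integrable_bounded_borel_intensity[OF bounded_borel_dummy_score]
  by (simp add: mult.assoc \<mu>_E sum_negf)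

text \<open>
  The asymptotic variance of the score in direction \<open>a\<close>, split into the parts due to the two independent sequences.
\<close>
lemma V_quadratic_form:
  "a \<bullet> (V *v a) = (RY (event_score_along a) (event_score_along a) - (LINT u|lborel. event_score_along a u * KY u)\<^sup>2) + (RE (dummy_score_along a) (dummy_score_along a) - (LINT u|lborel. dummy_score_along a u * KE u)\<^sup>2)"
proof -
  have Y: "RY (event_score_along a) (event_score_along a) = (\<Sum>k\<in>UNIV. \<Sum>l\<in>UNIV. a $ k * a $ l * RY (event_score k) (event_score l))"
    unfolding event_score_along_def[abs_def]
    by (rule YP.pair_moment_sum[OF finite bounded_borel_event_score bounded_borel_event_score_along[unfolded event_score_along_def[abs_def]]])
  have "RE (dummy_score_along a) (dummy_score_along a) = (\<Sum>k\<in>UNIV. \<Sum>l\<in>UNIV. - a $ k * - a $ l * RE (dummy_score k) (dummy_score l))"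
    unfolding dummy_score_along_def[abs_def]
    by (rule EP.pair_moment_sum[OF finite bounded_borel_dummy_score bounded_borel_dummy_score_along[unfolded dummy_score_along_def[abs_def]]])
  then have E: "RE (dummy_score_along a) (dummy_score_along a) = (\<Sum>k\<in>UNIV. \<Sum>l\<in>UNIV. a $ k * a $ l * RE (dummy_score k) (dummy_score l))" by simp
  have m: "(\<Sum>k\<in>UNIV. a $ k * \<mu> k)\<^sup>2 = (\<Sum>k\<in>UNIV. \<Sum>l\<in>UNIV. a $ k * a $ l * (\<mu> k * \<mu> l))"
    by (simp add: power2_eq_square sum_product mult_ac)
  have "a \<bullet> (V *v a) = (\<Sum>k\<in>UNIV. \<Sum>l\<in>UNIV.
      (a $ k * a $ l * RY (event_score k) (event_score l) - a $ k * a $ l * (\<mu> k * \<mu> l)) + (a $ k * a $ l * RE (dummy_score k) (dummy_score l) - a $ k * a $ l * (\<mu> k * \<mu> l)))"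
    unfolding quadratic_form_sum V_entry by (intro sum.cong refl) (simp add: algebra_simps)
  also have "\<dots> = (RY (event_score_along a) (event_score_along a) - (\<Sum>k\<in>UNIV. a $ k * \<mu> k)\<^sup>2) + (RE (dummy_score_along a) (dummy_score_along a) - (\<Sum>k\<in>UNIV. a $ k * \<mu> k)\<^sup>2)"
    unfolding sum.distrib sum_subtractf Y E m ..
  finally show ?thesis unfolding mean_event_score_along mean_dummy_score_along by simp
qed

lemma V_quadratic_nonneg: "0 \<le> a \<bullet> (V *v a)"
  unfolding V_quadratic_form
  by (intro add_nonneg_nonneg
      iid_square_integrable.variance_nonneg[OF iid_point_process_sums[OF iidY procY bounded_borel_event_score_along]]
      iid_square_integrable.variance_nonneg[OF iid_point_process_sums[OF iidE procE bounded_borel_dummy_score_along]])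

text \<open>
  The normalized score is a sum of two independent centered sums, to each of which the central limit theorem
  applies; the means that are subtracted cancel.
\<close>
lemma score_char:
  "(\<lambda>n. CLINT \<omega>|M. iexp (a \<bullet> ((1 / sqrt (real n)) *\<^sub>R score n \<omega>))) \<longlonglongrightarrow> exp (- (a \<bullet> (V *v a)) / 2)"
proof -
  define mY where "mY = (LINT u|lborel. event_score_along a u * KY u)"
  define mE where "mE = (LINT u|lborel. dummy_score_along a u * KE u)"
  define A where "A n \<omega> = ((\<Sum>i<n. \<Sum>x\<in>#Y i \<omega>. event_score_along a x) - real n * mY) / sqrt (real n)" for n \<omega>
  define D where "D n \<omega> = ((\<Sum>i<n. \<Sum>x\<in>#E i \<omega>. dummy_score_along a x) - real n * mE) / sqrt (real n)" for n \<omega>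
  have [measurable]: "event_score_along a \<in> borel_measurable borel" "dummy_score_along a \<in> borel_measurable borel"
    using bounded_borel_event_score_along bounded_borel_dummy_score_along by (auto simp: bounded_borel_def)
  have [measurable]: "A n \<in> borel_measurable M" "D n \<in> borel_measurable M" for n
    unfolding A_def[abs_def] D_def[abs_def] by simp_all
  have limA: "(\<lambda>n. char (distr M borel (A n)) 1) \<longlonglongrightarrow> exp (- (RY (event_score_along a) (event_score_along a) - mY\<^sup>2) * 1\<^sup>2 / 2)"
    unfolding A_def mY_def
    by (rule iid_square_integrable.clt_char[OF iid_point_process_sums[OF iidY procY bounded_borel_event_score_along]])
  have limD: "(\<lambda>n. char (distr M borel (D n)) 1) \<longlonglongrightarrow> exp (- (RE (dummy_score_along a) (dummy_score_along a) - mE\<^sup>2) * 1\<^sup>2 / 2)"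
    unfolding D_def mE_def
    by (rule iid_square_integrable.clt_char[OF iid_point_process_sums[OF iidE procE bounded_borel_dummy_score_along]])
  have "indep_var borel (A n) borel (D n)" for n
  proof -
    have "(\<lambda>y. ((\<Sum>i<n. \<Sum>x\<in>#y i. f x) - c) / sqrt (real n)) \<in> borel_measurable (PiM UNIV (\<lambda>_. config_space S))"
      if [measurable]: "f \<in> borel_measurable borel" for f :: "'a \<Rightarrow> real" and c
      by measurable
    then have "indep_var borel ((\<lambda>y. ((\<Sum>i<n. \<Sum>x\<in>#y i. event_score_along a x) - real n * mY) / sqrt (real n)) \<circ> (\<lambda>\<omega> i. Y i \<omega>))
        borel ((\<lambda>y. ((\<Sum>i<n. \<Sum>x\<in>#y i. dummy_score_along a x) - real n * mE) / sqrt (real n)) \<circ> (\<lambda>\<omega> i. E i \<omega>))"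
      using independent unfolding indep_sequences_def by (intro indep_var_compose) auto
    then show ?thesis by (simp add: comp_def A_def[abs_def] D_def[abs_def])
  qed
  note prod = char_distr_add[OF this, of _ 1]
  have "(\<lambda>n. char (distr M borel (\<lambda>\<omega>. A n \<omega> + D n \<omega>)) 1) \<longlonglongrightarrow>
      exp (- (RY (event_score_along a) (event_score_along a) - mY\<^sup>2) * 1\<^sup>2 / 2) * exp (- (RE (dummy_score_along a) (dummy_score_along a) - mE\<^sup>2) * 1\<^sup>2 / 2)"
    unfolding prod using tendsto_mult[OF limA limD] by simp
  also have "exp (- (RY (event_score_along a) (event_score_along a) - mY\<^sup>2) * 1\<^sup>2 / 2) * exp (- (RE (dummy_score_along a) (dummy_score_along a) - mE\<^sup>2) * 1\<^sup>2 / 2) = exp (- (a \<bullet> (V *v a)) / 2)"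
    unfolding V_quadratic_form mY_def[symmetric] mE_def[symmetric] exp_add[symmetric] by (simp add: field_simps)
  finally have lim: "(\<lambda>n. char (distr M borel (\<lambda>\<omega>. A n \<omega> + D n \<omega>)) 1) \<longlonglongrightarrow> complex_of_real (exp (- (a \<bullet> (V *v a)) / 2))" .
  have sum_eq: "a \<bullet> ((1 / sqrt (real n)) *\<^sub>R score n \<omega>) = 1 * (A n \<omega> + D n \<omega>)" if "\<omega> \<in> space M" for n \<omega>
  proof -
    have "a \<bullet> score n \<omega> = (\<Sum>k\<in>UNIV. a $ k * (\<Sum>x\<in>#superposition Y n \<omega>. event_score k x)) - (\<Sum>k\<in>UNIV. a $ k * (\<Sum>x\<in>#superposition E n \<omega>. dummy_score k x))"
      unfolding inner_vec_def score_component[OF that] by (simp add: right_diff_distrib sum_subtractf)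
    also have "\<dots> = (\<Sum>x\<in>#superposition Y n \<omega>. event_score_along a x) + (\<Sum>x\<in>#superposition E n \<omega>. dummy_score_along a x)"
    proof -
      have "(\<Sum>x\<in>#superposition E n \<omega>. dummy_score_along a x) = - (\<Sum>k\<in>UNIV. a $ k * (\<Sum>x\<in>#superposition E n \<omega>. dummy_score k x))"
        unfolding dummy_score_along_def sum_mset_sum sum_mset_const_mult by (simp add: sum_negf)
      moreover have "(\<Sum>x\<in>#superposition Y n \<omega>. event_score_along a x) = (\<Sum>k\<in>UNIV. a $ k * (\<Sum>x\<in>#superposition Y n \<omega>. event_score k x))"
        unfolding event_score_along_def sum_mset_sum sum_mset_const_mult ..
      ultimately show ?thesis by simp
    qed
    finally have "a \<bullet> score n \<omega> = (\<Sum>i<n. \<Sum>x\<in>#Y i \<omega>. event_score_along a x) + (\<Sum>i<n. \<Sum>x\<in>#E i \<omega>. dummy_score_along a x)"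
      unfolding sum_mset_superposition .
    moreover have "mE = - mY" unfolding mE_def mY_def mean_event_score_along mean_dummy_score_along by simp
    ultimately show ?thesis by (simp add: A_def D_def add_divide_distrib diff_divide_distrib)
  qed
  have "(CLINT \<omega>|M. iexp (a \<bullet> ((1 / sqrt (real n)) *\<^sub>R score n \<omega>))) = char (distr M borel (\<lambda>\<omega>. A n \<omega> + D n \<omega>)) 1" for n
  proof -
    have "char (distr M borel (\<lambda>\<omega>. A n \<omega> + D n \<omega>)) 1 = (CLINT \<omega>|M. iexp (1 * (A n \<omega> + D n \<omega>)))"
      by (rule char_distr) simp
    also have "\<dots> = (CLINT \<omega>|M. iexp (a \<bullet> ((1 / sqrt (real n)) *\<^sub>R score n \<omega>)))"
      by (intro Bochner_Integration.integral_cong refl) (simp only: sum_eq)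
    finally show ?thesis by (rule sym)
  qed
  with lim show ?thesis by (simp only:)
qed

text \<open>
  By the linearization, \<open>\<surd>n (\<theta>\<^sub>n - \<theta>0)\<close> differs from \<open>U\<^sup>-\<^sup>1 s\<^sub>n / \<surd>n\<close> by \<open>O(n\<^bsup>-1/4\<^esup>)\<close> with high probability, and
  the latter has the asserted limiting characteristic function.
\<close>
theorem asymptotic_normality:
  assumes pd: "positive_definite U" and meas [measurable]: "\<And>n. \<theta> n \<in> borel_measurable M"
    and zero: "whp M (\<lambda>n \<omega>. logistic_score b z \<rho> (superposition Y n \<omega>) (superposition E n \<omega>) (\<theta> n \<omega>) = 0)"
  shows "\<exists>N. mv_normal_law 0 (matrix_inv U ** V ** transpose (matrix_inv U)) N \<and>
     converges_in_distribution M (\<lambda>n \<omega>. sqrt (real n) *\<^sub>R (\<theta> n \<omega> - \<theta>0)) N"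
proof -
  let ?I = "matrix_inv U"
  let ?C = "?I ** V ** transpose ?I"
  have quad: "a \<bullet> (?C *v a) = (transpose ?I *v a) \<bullet> (V *v (transpose ?I *v a))" for a
  proof -
    have "(transpose ?I *v a) \<bullet> y = a \<bullet> (?I *v y)" for y
      by (metis dot_lmul_matrix transpose_matrix_vector)
    then show ?thesis by (simp add: matrix_vector_mul_assoc[symmetric])
  qed
  have symC: "transpose ?C = ?C"
    by (simp add: matrix_transpose_mul V_symmetric matrix_mul_assoc)
  obtain N where N: "mv_normal_law 0 ?C N"
    using mv_normal_law_exists[OF symC] V_quadratic_nonneg unfolding quad by blast
  define X where "X n \<omega> = ?I *v ((1 / sqrt (real n)) *\<^sub>R score n \<omega>)" for n \<omega>
  define Z where "Z n \<omega> = sqrt (real n) *\<^sub>R (\<theta> n \<omega> - \<theta>0)" for n \<omega>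
  have [measurable]: "(\<lambda>x. ?I *v x) \<in> borel_measurable borel"
    by (intro borel_measurable_continuous_onI linear_continuous_on matrix_vector_mul_bounded_linear)
  have mX: "X n \<in> borel_measurable M" and mZ: "Z n \<in> borel_measurable M" for n
    unfolding X_def[abs_def] Z_def[abs_def] by measurable
  have convX: "(\<lambda>n. CLINT \<omega>|M. iexp (a \<bullet> X n \<omega>)) \<longlonglongrightarrow> (CLINT x|N. iexp (a \<bullet> x))" for a
  proof -
    have "a \<bullet> X n \<omega> = (transpose ?I *v a) \<bullet> ((1 / sqrt (real n)) *\<^sub>R score n \<omega>)" for n \<omega>
      unfolding X_def by (metis dot_lmul_matrix transpose_matrix_vector)
    then show ?thesis
      unfolding iexp_integral_mv_normal_law[OF N] quad using score_char[of "transpose ?I *v a"] by (simp only:)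
  qed
  obtain L where L: "whp M (\<lambda>n \<omega>. norm (score n \<omega> - real n *\<^sub>R (U *v (\<theta> n \<omega> - \<theta>0)))
      \<le> L * ((real n powr (5/8))\<^sup>2 / real n))"
    using estimator_linearization[OF pd zero] by blast
  obtain \<kappa> where \<kappa>: "0 \<le> \<kappa>" "\<And>x. norm (?I *v x) \<le> norm x * \<kappa>"
    using bounded_linear.nonneg_bounded[OF matrix_vector_mul_bounded_linear[of ?I]] by blast
  define e where "e n = \<kappa> * L * ((real n powr (5/8))\<^sup>2 / real n / sqrt (real n))" for n
  have near: "whp M (\<lambda>n \<omega>. norm (Z n \<omega> - X n \<omega>) \<le> e n)"
  proof (rule whp_mono[OF L])
    fix n \<omega>
    assume *: "norm (score n \<omega> - real n *\<^sub>R (U *v (\<theta> n \<omega> - \<theta>0))) \<le> L * ((real n powr (5/8))\<^sup>2 / real n)"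
    have ZX: "X n \<omega> - Z n \<omega> = ?I *v ((1 / sqrt (real n)) *\<^sub>R (score n \<omega> - real n *\<^sub>R (U *v (\<theta> n \<omega> - \<theta>0))))"
    proof -
      have "?I *v ((1 / sqrt (real n)) *\<^sub>R (real n *\<^sub>R (U *v (\<theta> n \<omega> - \<theta>0)))) = Z n \<omega>"
        by (simp add: matrix_vector_mult_scaleR positive_definite_matrix_inv[OF pd] Z_def real_div_sqrt)
      then show ?thesis unfolding X_def scaleR_diff_right matrix_vector_mult_diff_distrib by simp
    qed
    have "norm (Z n \<omega> - X n \<omega>) \<le> norm ((1 / sqrt (real n)) *\<^sub>R (score n \<omega> - real n *\<^sub>R (U *v (\<theta> n \<omega> - \<theta>0)))) * \<kappa>"
      unfolding norm_minus_commute[of "Z n \<omega>"] ZX by (rule \<kappa>)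
    also have "\<dots> = (1 / sqrt (real n)) * norm (score n \<omega> - real n *\<^sub>R (U *v (\<theta> n \<omega> - \<theta>0))) * \<kappa>"
      by simp
    also have "\<dots> \<le> (1 / sqrt (real n)) * (L * ((real n powr (5/8))\<^sup>2 / real n)) * \<kappa>"
      using * \<kappa>(1) by (intro mult_right_mono mult_left_mono) auto
    also have "\<dots> = e n" by (simp add: e_def mult_ac)
    finally show "norm (Z n \<omega> - X n \<omega>) \<le> e n" .
  qed
  have "(\<lambda>n. (real n powr (5/8))\<^sup>2 / real n / sqrt (real n)) \<longlonglongrightarrow> 0" by real_asymp
  from tendsto_mult_right_zero[OF this, of "\<kappa> * L"] have e0: "e \<longlonglongrightarrow> 0"
    unfolding e_def[abs_def] .
  have "converges_in_distribution M Z N"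
  proof (rule levy_continuity_euclidean)
    show "prob_space M" by unfold_locales
    show "prob_space N" "sets N = sets borel" using N by (auto simp: mv_normal_law_def)
    show "(\<lambda>n. CLINT \<omega>|M. iexp (a \<bullet> Z n \<omega>)) \<longlonglongrightarrow> (CLINT x|N. iexp (a \<bullet> x))" for a
      by (rule slutsky_char[OF mX mZ convX near e0])
  qed (rule mZ)
  with N show ?thesis unfolding Z_def by blast
qed

end

theorem theorem4p2:
  fixes M :: "'w measure"
    and W :: "(real^2) set" and T :: "real set" and S :: "((real^2) \<times> real) set"
    and Y E :: "nat \<Rightarrow> 'w \<Rightarrow> ((real^2) \<times> real) multiset"
    and b \<rho> :: "(real^2) \<times> real \<Rightarrow> real"
    and z :: "(real^2) \<times> real \<Rightarrow> real^'m"
    and g h :: "(real^2) \<times> real \<Rightarrow> (real^2) \<times> real \<Rightarrow> real"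
    and \<Theta> :: "(real^'m) set" and \<theta>0 :: "real^'m"
    and \<theta>hat :: "nat \<Rightarrow> 'w \<Rightarrow> real^'m"
  assumes "S = W \<times> T" and "bounded S" and "open S" and "S \<noteq> {}"
    and "open \<Theta>" and "\<theta>0 \<in> \<Theta>"
    \<comment> \<open>(i); \<open>M\<close> is the underlying space under the true parameter\<close>
    and "prob_space M"
    and "iid_sequence M (config_space S) Y"
    and "iid_sequence M (config_space S) E"
    and "indep_sequences M (config_space S) Y E"
    \<comment> \<open>(ii)\<close>
    and "\<forall>u\<in>S. 0 < b u" and "set_integrable lborel S b"
    and "z \<in> borel_measurable (restrict_space borel S)"
    and "\<forall>i. has_intensity M S (Y i) (loglin b z \<theta>0)"
    and "\<forall>u\<in>S. 0 < \<rho> u" and "set_integrable lborel S \<rho>"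
    and "\<forall>i. has_intensity M S (E i) \<rho>"
    \<comment> \<open>(iii)\<close>
    and "\<forall>i. has_pair_correlation M S (E i) \<rho> g"
    and "\<forall>i. has_pair_correlation M S (Y i) (loglin b z \<theta>0) h"
    and "bdd_above ((\<lambda>(u, v). g u v) ` (S \<times> S))"
    and "bdd_above ((\<lambda>(u, v). h u v) ` (S \<times> S))"
    \<comment> \<open>(iv)\<close>
    and "\<forall>\<theta>\<in>\<Theta>. \<exists>\<epsilon>1>0. \<exists>\<epsilon>2>0.
           ereal \<epsilon>1 < (INF u\<in>S. ereal (\<rho> u / loglin b z \<theta> u)) \<and>
           (SUP u\<in>S. ereal (\<rho> u / loglin b z \<theta> u)) < ereal \<epsilon>2"
    \<comment> \<open>(v)--(viii)\<close>
    and "bounded (z ` S)"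
    and "convex \<Theta>"
    and "\<forall>\<theta>\<in>\<Theta>. \<forall>\<theta>'\<in>\<Theta>.
           (AE u in lborel. u \<in> S \<longrightarrow> loglin b z \<theta> u = loglin b z \<theta>' u) \<longrightarrow> \<theta> = \<theta>'"
    and "positive_definite (U_mat S (loglin b z \<theta>0) \<rho> z)"
    \<comment> \<open>the estimator is a random vector, attained with probability tending to one\<close>
    and "\<forall>n. \<theta>hat n \<in> borel_measurable M"
    and "(\<lambda>n. measure M {\<omega> \<in> space M. \<theta>hat n \<omega> \<in> \<Theta> \<and>
           logistic_score b z \<rho> (superposition Y n \<omega>) (superposition E n \<omega>) (\<theta>hat n \<omega>) = 0})
         \<longlonglongrightarrow> 1"
  shows "\<exists>N. mv_normal_law 0
           (matrix_inv (U_mat S (loglin b z \<theta>0) \<rho> z)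
              ** V_mat S (loglin b z \<theta>0) \<rho> z g h
              ** transpose (matrix_inv (U_mat S (loglin b z \<theta>0) \<rho> z))) N
         \<and> converges_in_distribution M (\<lambda>n \<omega>. sqrt (real n) *\<^sub>R (\<theta>hat n \<omega> - \<theta>0)) N"
proof -
  have S_borel: "S \<in> sets borel" using \<open>open S\<close> by simp
  obtain B where B: "0 \<le> B" "\<And>u. u \<in> S \<Longrightarrow> norm (z u) \<le> B"
  proof -
    obtain B0 where "\<forall>x\<in>z ` S. norm x \<le> B0" using \<open>bounded (z ` S)\<close> by (auto simp: bounded_iff)
    then show thesis by (intro that[of "max 0 B0"]) auto
  qed
  obtain GE where GE: "\<And>u v. u \<in> S \<Longrightarrow> v \<in> S \<Longrightarrow> g u v \<le> GE"
    using \<open>bdd_above ((\<lambda>(u, v). g u v) ` (S \<times> S))\<close> by (force simp: bdd_above_def)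
  obtain GY where GY: "\<And>u v. u \<in> S \<Longrightarrow> v \<in> S \<Longrightarrow> h u v \<le> GY"
    using \<open>bdd_above ((\<lambda>(u, v). h u v) ` (S \<times> S))\<close> by (force simp: bdd_above_def)
  have b_pos: "\<And>u. u \<in> S \<Longrightarrow> 0 < b u" and \<rho>_pos: "\<And>u. u \<in> S \<Longrightarrow> 0 < \<rho> u"
    using \<open>\<forall>u\<in>S. 0 < b u\<close> \<open>\<forall>u\<in>S. 0 < \<rho> u\<close> by auto
  have lam_pos: "u \<in> S \<Longrightarrow> 0 < loglin b z \<theta>0 u" for u
    using b_pos by (simp add: loglin_def)
  have lam_integrable: "set_integrable lborel S (loglin b z \<theta>0)"
    unfolding set_integrable_def
  proof (rule Bochner_Integration.integrable_bound)
    show "integrable lborel (\<lambda>u. exp (norm \<theta>0 * B) * (indicator S u *\<^sub>R b u))"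
      using \<open>set_integrable lborel S b\<close> by (simp add: set_integrable_def)
    have "loglin b z \<theta>0 \<in> borel_measurable (restrict_space borel S)"
      using \<open>\<forall>i. has_intensity M S (Y i) (loglin b z \<theta>0)\<close> by (simp add: has_intensity_def)
    then show "(\<lambda>u. indicator S u *\<^sub>R loglin b z \<theta>0 u) \<in> borel_measurable lborel"
      using S_borel by (simp add: borel_measurable_restrict_space_iff)
    have "norm (indicator S u *\<^sub>R loglin b z \<theta>0 u) \<le> norm (exp (norm \<theta>0 * B) * (indicator S u *\<^sub>R b u))" for u
    proof (cases "u \<in> S")
      case True
      have "\<theta>0 \<bullet> z u \<le> norm \<theta>0 * norm (z u)" by (rule norm_cauchy_schwarz)
      also have "\<dots> \<le> norm \<theta>0 * B" using B(2)[OF True] by (intro mult_left_mono) auto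
      finally show ?thesis using b_pos[OF True] True by (simp add: loglin_def abs_mult mult.commute)
    qed simp
    then show "AE u in lborel. norm (indicator S u *\<^sub>R loglin b z \<theta>0 u)
        \<le> norm (exp (norm \<theta>0 * B) * (indicator S u *\<^sub>R b u))" by simp
  qed
  interpret prob_space M by fact
  have procY: "correlated_process M S (Y i) (loglin b z \<theta>0) h GY" for i
    by unfold_locales
       (use S_borel \<open>\<forall>i. has_pair_correlation M S (Y i) (loglin b z \<theta>0) h\<close> lam_pos lam_integrable GY in auto)
  have procE: "correlated_process M S (E i) \<rho> g GE" for i
    by unfold_locales
       (use S_borel \<open>\<forall>i. has_pair_correlation M S (E i) \<rho> g\<close> \<rho>_pos \<open>set_integrable lborel S \<rho>\<close> GE in auto)
  interpret logistic_regression M S Y E b \<rho> z g h \<theta>0 GY GE B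
    by (intro logistic_regression.intro logistic_regression_axioms.intro) (fact assms S_borel b_pos \<rho>_pos B procY procE)+
  have "whp M (\<lambda>n \<omega>. \<theta>hat n \<omega> \<in> \<Theta> \<and>
      logistic_score b z \<rho> (superposition Y n \<omega>) (superposition E n \<omega>) (\<theta>hat n \<omega>) = 0)"
    by (rule whp_of_prob_tendsto_1) fact
  then have zero: "whp M (\<lambda>n \<omega>.
      logistic_score b z \<rho> (superposition Y n \<omega>) (superposition E n \<omega>) (\<theta>hat n \<omega>) = 0)"
    by (rule whp_mono) simp
  show ?thesis
    by (rule asymptotic_normality[OF _ _ zero])
       (fact, use \<open>\<forall>n. \<theta>hat n \<in> borel_measurable M\<close> in blast)
qed

end
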